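(* $\mathcal{F}_1$-Formula-SAT on formulas of size $s$ over $n$ variables can be solved in time $O(2^n(s/n+1))$ in the Word-RAM model.
   Context: Class $\mathcal{F}_1$: a formula $F$ over variables $x_1,\dots,x_n$ (a tree) is in $\mathcal{F}_1$ if (i) every gate in the first layer (gates whose children are all leaves/inputs) computes an arbitrary function of its inputs that can be evaluated in time $2^{o(n)}$, and the inputs of each such gate are either all from $\{x_1,\dots,x_{n/2}\}$ or all from $\{x_{n/2+1},\dots,x_n\}$; inputs are connected only to first-layer gates; (ii) all gates in higher layers are AND or OR gates. The size of $F$ is the number of first-layer gates. $\mathcal{F}_1$-Formula-SAT: given $F\in\mathcal{F}_1$, decide whether some $x\in\{0,1\}^n$ has $F(x)=\mathsf{true}$. Word-RAM: words of $\Theta(\log n)$ bits with unit-time standard operations (constants, bitwise AND/OR/NOT, shift, addition, subtraction, multiplication, division with remainder). *)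

theory Defs
  imports Complex_Main "HOL-Library.Landau_Symbols"
begin

section \<open>Word-RAM\<close>

text \<open>
  A program is a list of instructions over registers (named by natural numbers; a program mentions
  only finitely many) and a random-access memory, all holding words of \<open>w\<close> bits.
  Each instruction takes one time unit. Words are represented as
  natural numbers below \<open>2 ^ w\<close>; hence only the addresses below \<open>2 ^ w\<close> are reachable. The machine
  halts when control leaves the program. The word size is not part of the program.
\<close>

datatype instr =
    LoadConst nat nat     \<comment> \<open>\<open>R i := c\<close>\<close>
  | BitAnd nat nat nat    \<comment> \<open>\<open>R i := R j op R k\<close>, likewise for the other binary operations\<close>
  | BitOr nat nat nat
  | BitNot nat nat
  | ShiftL nat nat nat
  | ShiftR nat nat nat
  | Add nat nat nat
  | Sub nat nat nat
  | Mul nat nat nat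
  | Div nat nat nat
  | Rem nat nat nat
  | Load nat nat          \<comment> \<open>\<open>R i := M[R j]\<close>\<close>
  | Store nat nat         \<comment> \<open>\<open>M[R i] := R j\<close>\<close>
  | Jump nat
  | JumpZero nat nat      \<comment> \<open>if \<open>R i = 0\<close> jump to the given instruction\<close>
  | JumpLess nat nat nat  \<comment> \<open>if \<open>R i < R j\<close> jump to the given instruction\<close>

type_synonym program = "instr list"

record state =
  pc :: nat
  regs :: "nat \<Rightarrow> nat"
  mem :: "nat \<Rightarrow> nat"

definition set_reg :: "nat \<Rightarrow> nat \<Rightarrow> nat \<Rightarrow> state \<Rightarrow> state" where
  "set_reg w i v \<sigma> = \<sigma>\<lparr>pc := Suc (pc \<sigma>), regs := (regs \<sigma>)(i := v mod 2 ^ w)\<rparr>"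

text \<open>Division by zero follows the HOL convention (\<open>a div 0 = 0\<close>, \<open>a mod 0 = a\<close>).\<close>

fun exec :: "nat \<Rightarrow> instr \<Rightarrow> state \<Rightarrow> state" where
  "exec w (LoadConst i c) \<sigma> = set_reg w i c \<sigma>"
| "exec w (BitAnd i j k) \<sigma> = set_reg w i (and (regs \<sigma> j) (regs \<sigma> k)) \<sigma>"
| "exec w (BitOr i j k) \<sigma> = set_reg w i (or (regs \<sigma> j) (regs \<sigma> k)) \<sigma>"
| "exec w (BitNot i j) \<sigma> = set_reg w i (2 ^ w - 1 - regs \<sigma> j) \<sigma>"
| "exec w (ShiftL i j k) \<sigma> = set_reg w i (push_bit (regs \<sigma> k) (regs \<sigma> j)) \<sigma>"
| "exec w (ShiftR i j k) \<sigma> = set_reg w i (drop_bit (regs \<sigma> k) (regs \<sigma> j)) \<sigma>"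
| "exec w (Add i j k) \<sigma> = set_reg w i (regs \<sigma> j + regs \<sigma> k) \<sigma>"
| "exec w (Sub i j k) \<sigma> = set_reg w i (regs \<sigma> j + 2 ^ w - regs \<sigma> k) \<sigma>"
| "exec w (Mul i j k) \<sigma> = set_reg w i (regs \<sigma> j * regs \<sigma> k) \<sigma>"
| "exec w (Div i j k) \<sigma> = set_reg w i (regs \<sigma> j div regs \<sigma> k) \<sigma>"
| "exec w (Rem i j k) \<sigma> = set_reg w i (regs \<sigma> j mod regs \<sigma> k) \<sigma>"
| "exec w (Load i j) \<sigma> = set_reg w i (mem \<sigma> (regs \<sigma> j)) \<sigma>"
| "exec w (Store i j) \<sigma> = \<sigma>\<lparr>pc := Suc (pc \<sigma>), mem := (mem \<sigma>)(regs \<sigma> i := regs \<sigma> j)\<rparr>"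
| "exec w (Jump l) \<sigma> = \<sigma>\<lparr>pc := l\<rparr>"
| "exec w (JumpZero i l) \<sigma> = \<sigma>\<lparr>pc := if regs \<sigma> i = 0 then l else Suc (pc \<sigma>)\<rparr>"
| "exec w (JumpLess i j l) \<sigma> = \<sigma>\<lparr>pc := if regs \<sigma> i < regs \<sigma> j then l else Suc (pc \<sigma>)\<rparr>"

definition step :: "program \<Rightarrow> nat \<Rightarrow> state \<Rightarrow> state" where
  "step P w \<sigma> = (if pc \<sigma> < length P then exec w (P ! pc \<sigma>) \<sigma> else \<sigma>)"

text \<open>The input occupies memory cells \<open>0, 1, \<dots>\<close>, its length is in register 0; all else is 0.\<close>

definition init_state :: "nat list \<Rightarrow> state" where
  "init_state xs = \<lparr>pc = 0, regs = (\<lambda>_. 0)(0 := length xs),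
     mem = (\<lambda>a. if a < length xs then xs ! a else 0)\<rparr>"

text \<open>
  On input \<open>xs\<close>, which has to fit into memory, \<open>P\<close> halts after at most \<open>t\<close> steps with the truth
  value \<open>b\<close> in register 0. (Halted states are fixed points of \<^const>\<open>step\<close>.)
\<close>

definition computes_within :: "program \<Rightarrow> nat \<Rightarrow> nat list \<Rightarrow> nat \<Rightarrow> bool \<Rightarrow> bool" where
  "computes_within P w xs t b \<longleftrightarrow>
     length xs < 2 ^ w \<and> (\<forall>x\<in>set xs. x < 2 ^ w) \<and>
     (let \<sigma> = (step P w ^^ t) (init_state xs)
      in length P \<le> pc \<sigma> \<and> regs \<sigma> 0 = of_bool b)"


section \<open>Formulas\<close>

text \<open>
  Variables are \<open>0, \<dots>, n - 1\<close>. A first-layer gate computes an arbitrary Boolean function \<open>gate_fun\<close>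
  of the variables \<open>gate_vars\<close>. The bit string \<open>gate_code\<close> is the description of this function
  through which the gate is presented to an algorithm; \<open>gate_fun\<close> itself is not part of the
  encoding of a formula below.
\<close>

datatype gate = Gate (gate_vars: "nat list") (gate_fun: "bool list \<Rightarrow> bool") (gate_code: "bool list")

datatype formula = First gate | Conj "formula list" | Disj "formula list"

fun eval :: "bool list \<Rightarrow> formula \<Rightarrow> bool" where
  "eval x (First g) \<longleftrightarrow> gate_fun g (map (\<lambda>i. x ! i) (gate_vars g))"
| "eval x (Conj Fs) \<longleftrightarrow> (\<forall>F\<in>set Fs. eval x F)"
| "eval x (Disj Fs) \<longleftrightarrow> (\<exists>F\<in>set Fs. eval x F)"

definition satisfiable :: "nat \<Rightarrow> formula \<Rightarrow> bool" where
  "satisfiable n F \<longleftrightarrow> (\<exists>x. length x = n \<and> eval x F)"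

fun formula_size :: "formula \<Rightarrow> nat" where
  "formula_size (First g) = 1"
| "formula_size (Conj Fs) = (\<Sum>F\<leftarrow>Fs. formula_size F)"
| "formula_size (Disj Fs) = (\<Sum>F\<leftarrow>Fs. formula_size F)"

definition subexponential :: "(nat \<Rightarrow> nat) \<Rightarrow> bool" where
  "subexponential T \<longleftrightarrow>
     (\<exists>g. g \<in> o(\<lambda>n. real n) \<and> (\<forall>n. real (T n) \<le> 2 powr g n))"

text \<open>
  The function of a gate is evaluated by an interpreter shared by all gates: \<open>E\<close>, given the code of the
  gate and the values \<open>bs\<close> of its inputs, outputs the value of the gate. Words have \<open>e * n\<close> bits.
  The time bound \<open>T n\<close> includes reading the code and the values, so it also bounds their length.
\<close>

definition eval_input :: "bool list \<Rightarrow> bool list \<Rightarrow> nat list" where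
  "eval_input bs code = length bs # map of_bool bs @ map of_bool code"

definition evaluable :: "program \<Rightarrow> nat \<Rightarrow> (nat \<Rightarrow> nat) \<Rightarrow> nat \<Rightarrow> gate \<Rightarrow> bool" where
  "evaluable E e T n g \<longleftrightarrow>
     length (gate_vars g) + length (gate_code g) \<le> T n \<and>
     (\<forall>bs. length bs = length (gate_vars g) \<longrightarrow>
        computes_within E (e * n) (eval_input bs (gate_code g)) (T n) (gate_fun g bs))"

text \<open>
  The class of formulas over \<open>n\<close> variables whose first-layer gates are evaluated by \<open>E\<close> in time
  \<open>T\<close> on words of \<open>e * n\<close> bits. Gates of higher layers have arbitrary fan-in at least 2: since
  \<^const>\<open>formula_size\<close> counts first-layer gates only, chains of gates of fan-in 1 (or
  gates of fan-in 0) would make the length of a formula unbounded in terms of its size.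
\<close>

fun F1 :: "program \<Rightarrow> nat \<Rightarrow> (nat \<Rightarrow> nat) \<Rightarrow> nat \<Rightarrow> formula \<Rightarrow> bool" where
  "F1 E e T n (First g) \<longleftrightarrow>
     (set (gate_vars g) \<subseteq> {0..<n div 2} \<or> set (gate_vars g) \<subseteq> {n div 2..<n}) \<and>
     evaluable E e T n g"
| "F1 E e T n (Conj Fs) \<longleftrightarrow> 2 \<le> length Fs \<and> (\<forall>F\<in>set Fs. F1 E e T n F)"
| "F1 E e T n (Disj Fs) \<longleftrightarrow> 2 \<le> length Fs \<and> (\<forall>F\<in>set Fs. F1 E e T n F)"

text \<open>Formulas are written in prefix (Polish) notation.\<close>

fun encode :: "formula \<Rightarrow> nat list" where
  "encode (First g) =
     [0, length (gate_vars g), length (gate_code g)] @ gate_vars g @ map of_bool (gate_code g)"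
| "encode (Conj Fs) = [1, length Fs] @ concat (map encode Fs)"
| "encode (Disj Fs) = [2, length Fs] @ concat (map encode Fs)"

definition sat_input :: "nat \<Rightarrow> formula \<Rightarrow> nat list" where
  "sat_input n F = n # encode F"

text \<open>
  \<open>P\<close> solves the satisfiability problem for this class in time \<open>t n s\<close>, where \<open>s\<close> is the size of
  the formula, on every word size that is at least \<open>c\<close> times the logarithm of \<open>2 ^ n * s\<close>; this
  is what is needed to address the input and tables indexed by assignments to the variables.
\<close>

definition solves_F1_SAT ::
  "program \<Rightarrow> nat \<Rightarrow> (nat \<Rightarrow> nat) \<Rightarrow> program \<Rightarrow> nat \<Rightarrow> (nat \<Rightarrow> nat \<Rightarrow> real) \<Rightarrow> bool" where
  "solves_F1_SAT E e T P c t \<longleftrightarrow>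
     (\<forall>n F w. 1 \<le> n \<and> F1 E e T n F \<and>
        real c * log 2 (2 ^ n * real (formula_size F)) \<le> real w \<longrightarrow>
        (\<exists>k. real k \<le> t n (formula_size F) \<and>
             computes_within P w (sat_input n F) k (satisfiable n F)))"

end

theory Submission
  imports Defs
begin

text \<open>
  Split the variables into halves, so that an assignment is a pair \<open>(a, b)\<close>. A first-layer gate sees
  only one half, hence running its interpreter for every gate and every assignment to its half
  takes time \<open>s * 2 ^ (n / 2 + o(n))\<close>. The values are tabulated; for gates on the second half, a table
  entry packs the values for a block of \<open>n\<close> consecutive \<open>b\<close> into one word. For each \<open>a\<close> and each
  block, the higher layers are then evaluated for \<open>n\<close> assignments at once by \<open>O(s)\<close> bitwise
  operations, and there are \<open>O(2 ^ n / n)\<close> such pairs.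

  Words are long enough for every run of the interpreter to get a memory region of its own, which
  is still zero as the interpreter expects.
\<close>

section \<open>Structured programs\<close>

text \<open>The interpreter \<open>E\<close> is written for words of \<open>e * n\<close> bits,
  whereas the solver has to run on all sufficiently long words. So \<open>E\<close> cannot simply be
  called: it is simulated, with arithmetic modulo \<open>2 ^ (e * n)\<close>. Clearing its
  \<open>2 ^ (e * n)\<close> memory cells after each run would be too slow, as \<open>e\<close> is
  an arbitrary constant; hence space is spent instead of time. The space exists because the
  word-size factor \<open>c\<close> may depend on \<open>E\<close>, \<open>e\<close> and
  \<open>T\<close>. A gate has about \<open>2 ^ (n / 2)\<close> table entries and may cost
  \<open>2 ^ n / n\<close> in total. If a run takes \<open>2 ^ (n / 4)\<close> steps, the tables
  cost \<open>2 ^ (3 * n / 4)\<close>, and the remaining quarter of the exponent pays for the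
  division by \<open>n\<close>. Evaluating \<open>n\<close> assignments at once requires the same
  control flow for all of them. Prefix notation read from right to left provides it: this is a stack
  machine whose stack height depends on the formula alone. Large fan-ins are split into binary
  connectives, so that every token costs a constant number of word operations and the number of
  tokens is linear in \<open>s\<close>.\<close>

datatype binop = OAnd | OOr | OShl | OShr | OAdd | OSub | OMul | ODiv | OMod

datatype exp = Cst nat | Reg nat | Bin binop exp exp | Cell exp

abbreviation EAnd (infixl "&&&" 60) where "a &&& b \<equiv> Bin OAnd a b"
abbreviation EOr (infixl "|||" 59) where "a ||| b \<equiv> Bin OOr a b"
abbreviation EShl (infixl "<<<" 62) where "a <<< b \<equiv> Bin OShl a b"
abbreviation EShr (infixl ">>>" 62) where "a >>> b \<equiv> Bin OShr a b"
abbreviation EAdd (infixl "\<oplus>" 65) where "a \<oplus> b \<equiv> Bin OAdd a b"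
abbreviation ESub (infixl "\<ominus>" 65) where "a \<ominus> b \<equiv> Bin OSub a b"
abbreviation EMul (infixl "\<otimes>" 70) where "a \<otimes> b \<equiv> Bin OMul a b"
abbreviation EDiv (infixl "\<oslash>" 70) where "a \<oslash> b \<equiv> Bin ODiv a b"
abbreviation EMod (infixl "%%" 70) where "a %% b \<equiv> Bin OMod a b"

datatype com =
    Skip
  | Assign nat exp (infix "::=" 56)
  | Put exp exp
  | Seq com com (infixr ";;" 53)
  | IfLess exp exp com com
  | WhileLess exp exp com

text \<open>Expressions denote exact natural numbers; \<open>ok\<close> expresses that no word overflows.\<close>

fun binop_val :: "binop \<Rightarrow> nat \<Rightarrow> nat \<Rightarrow> nat" where
  "binop_val OAnd a b = and a b"
| "binop_val OOr a b = or a b"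
| "binop_val OShl a b = a * 2 ^ b"
| "binop_val OShr a b = a div 2 ^ b"
| "binop_val OAdd a b = a + b"
| "binop_val OSub a b = a - b"
| "binop_val OMul a b = a * b"
| "binop_val ODiv a b = a div b"
| "binop_val OMod a b = a mod b"

fun ev :: "exp \<Rightarrow> (nat \<Rightarrow> nat) \<Rightarrow> (nat \<Rightarrow> nat) \<Rightarrow> nat" where
  "ev (Cst c) R M = c"
| "ev (Reg r) R M = R r"
| "ev (Bin b e1 e2) R M = binop_val b (ev e1 R M) (ev e2 R M)"
| "ev (Cell e1) R M = M (ev e1 R M)"

fun binop_ok :: "nat \<Rightarrow> binop \<Rightarrow> nat \<Rightarrow> nat \<Rightarrow> bool" where
  "binop_ok w OShl a b \<longleftrightarrow> a * 2 ^ b < 2 ^ w"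
| "binop_ok w OAdd a b \<longleftrightarrow> a + b < 2 ^ w"
| "binop_ok w OSub a b \<longleftrightarrow> b \<le> a"
| "binop_ok w OMul a b \<longleftrightarrow> a * b < 2 ^ w"
| "binop_ok w _ a b \<longleftrightarrow> True"

fun ok :: "nat \<Rightarrow> exp \<Rightarrow> (nat \<Rightarrow> nat) \<Rightarrow> (nat \<Rightarrow> nat) \<Rightarrow> bool" where
  "ok w (Cst c) R M \<longleftrightarrow> c < 2 ^ w"
| "ok w (Reg r) R M \<longleftrightarrow> True"
| "ok w (Bin b e1 e2) R M \<longleftrightarrow> ok w e1 R M \<and> ok w e2 R M \<and> binop_ok w b (ev e1 R M) (ev e2 R M)"
| "ok w (Cell e1) R M \<longleftrightarrow> ok w e1 R M"

text \<open>Expressions compile to straight-line code, so this number is both the code length and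
  the running time.\<close>

fun elen :: "exp \<Rightarrow> nat" where
  "elen (Cst c) = 1"
| "elen (Reg r) = 1"
| "elen (Bin b e1 e2) = elen e1 + elen e2 + 1"
| "elen (Cell e1) = elen e1 + 1"

text \<open>The time index counts machine instructions exactly. In a conditional the false branch
  costs one more than the true one, because its code comes first and ends with a jump over the other
  branch. A loop test costs two jumps in either case: the comparison, and a jump back to the test or
  out of the loop.\<close>

inductive run :: "nat \<Rightarrow> com \<Rightarrow> (nat \<Rightarrow> nat) \<Rightarrow> (nat \<Rightarrow> nat) \<Rightarrow> nat \<Rightarrow> (nat \<Rightarrow> nat) \<Rightarrow> (nat \<Rightarrow> nat) \<Rightarrow> bool"
  for w where
  run_Skip: "run w Skip R M 0 R M"
| run_Assign: "ok w a R M \<Longrightarrow> run w (r ::= a) R M (elen a + 1) (R(r := ev a R M)) M"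
| run_Put: "ok w a R M \<Longrightarrow> ok w b R M \<Longrightarrow>
    run w (Put a b) R M (elen a + elen b + 1) R (M(ev a R M := ev b R M))"
| run_Seq: "run w c1 R M t1 R1 M1 \<Longrightarrow> run w c2 R1 M1 t2 R2 M2 \<Longrightarrow> run w (c1 ;; c2) R M (t1 + t2) R2 M2"
| run_IfTrue: "ok w a R M \<Longrightarrow> ok w b R M \<Longrightarrow> ev a R M < ev b R M \<Longrightarrow> run w c1 R M t R1 M1 \<Longrightarrow>
    run w (IfLess a b c1 c2) R M (elen a + elen b + 1 + t) R1 M1"
| run_IfFalse: "ok w a R M \<Longrightarrow> ok w b R M \<Longrightarrow> \<not> ev a R M < ev b R M \<Longrightarrow> run w c2 R M t R1 M1 \<Longrightarrow>
    run w (IfLess a b c1 c2) R M (elen a + elen b + 2 + t) R1 M1"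
| run_WhileTrue: "ok w a R M \<Longrightarrow> ok w b R M \<Longrightarrow> ev a R M < ev b R M \<Longrightarrow> run w c R M t R1 M1 \<Longrightarrow>
    run w (WhileLess a b c) R1 M1 t' R2 M2 \<Longrightarrow>
    run w (WhileLess a b c) R M (elen a + elen b + 2 + t + t') R2 M2"
| run_WhileFalse: "ok w a R M \<Longrightarrow> ok w b R M \<Longrightarrow> \<not> ev a R M < ev b R M \<Longrightarrow>
    run w (WhileLess a b c) R M (elen a + elen b + 2) R M"

section \<open>Compilation to machine code\<close>

fun binop_instr :: "binop \<Rightarrow> nat \<Rightarrow> nat \<Rightarrow> nat \<Rightarrow> instr" where
  "binop_instr OAnd = BitAnd"
| "binop_instr OOr = BitOr"
| "binop_instr OShl = ShiftL"
| "binop_instr OShr = ShiftR"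
| "binop_instr OAdd = Add"
| "binop_instr OSub = Sub"
| "binop_instr OMul = Mul"
| "binop_instr ODiv = Div"
| "binop_instr OMod = Rem"

fun ecode :: "exp \<Rightarrow> nat \<Rightarrow> instr list" where
  "ecode (Cst c) d = [LoadConst d c]"
| "ecode (Reg r) d = [BitOr d r r]"
| "ecode (Bin b e1 e2) d = ecode e1 d @ ecode e2 (Suc d) @ [binop_instr b d d (Suc d)]"
| "ecode (Cell e1) d = ecode e1 d @ [Load d d]"

fun clen :: "com \<Rightarrow> nat" where
  "clen Skip = 0"
| "clen (r ::= a) = elen a + 1"
| "clen (Put a b) = elen a + elen b + 1"
| "clen (c1 ;; c2) = clen c1 + clen c2"
| "clen (IfLess a b c1 c2) = elen a + elen b + 2 + clen c1 + clen c2"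
| "clen (WhileLess a b c) = elen a + elen b + 3 + clen c"

text \<open>Registers from \<open>d\<close> on serve as scratch space; \<open>p\<close> is the position of the code.\<close>

fun code :: "nat \<Rightarrow> com \<Rightarrow> nat \<Rightarrow> instr list" where
  "code d Skip p = []"
| "code d (r ::= a) p = ecode a d @ [BitOr r d d]"
| "code d (Put a b) p = ecode a d @ ecode b (Suc d) @ [instr.Store d (Suc d)]"
| "code d (c1 ;; c2) p = code d c1 p @ code d c2 (p + clen c1)"
| "code d (IfLess a b c1 c2) p =
    (let q = p + elen a + elen b in
     ecode a d @ ecode b (Suc d) @ [JumpLess d (Suc d) (q + 2 + clen c2)] @
     code d c2 (q + 1) @ [Jump (q + 2 + clen c2 + clen c1)] @ code d c1 (q + 2 + clen c2))"
| "code d (WhileLess a b c) p =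
    (let q = p + elen a + elen b in
     ecode a d @ ecode b (Suc d) @ [JumpLess d (Suc d) (q + 2), Jump (q + 3 + clen c)] @
     code d c (q + 2) @ [Jump p])"

fun eregs :: "nat \<Rightarrow> exp \<Rightarrow> bool" where
  "eregs d (Cst c) \<longleftrightarrow> True"
| "eregs d (Reg r) \<longleftrightarrow> r < d"
| "eregs d (Bin b e1 e2) \<longleftrightarrow> eregs d e1 \<and> eregs d e2"
| "eregs d (Cell e1) \<longleftrightarrow> eregs d e1"

fun cregs :: "nat \<Rightarrow> com \<Rightarrow> bool" where
  "cregs d Skip \<longleftrightarrow> True"
| "cregs d (r ::= a) \<longleftrightarrow> r < d \<and> eregs d a"
| "cregs d (Put a b) \<longleftrightarrow> eregs d a \<and> eregs d b"
| "cregs d (c1 ;; c2) \<longleftrightarrow> cregs d c1 \<and> cregs d c2"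
| "cregs d (IfLess a b c1 c2) \<longleftrightarrow> eregs d a \<and> eregs d b \<and> cregs d c1 \<and> cregs d c2"
| "cregs d (WhileLess a b c) \<longleftrightarrow> eregs d a \<and> eregs d b \<and> cregs d c"

lemma length_ecode [simp]: "length (ecode a d) = elen a"
  by (induction a arbitrary: d) auto

lemma length_code [simp]: "length (code d c p) = clen c"
  by (induction c arbitrary: p) (auto simp: Let_def)

section \<open>Correctness of the compiled code\<close>

definition code_at :: "program \<Rightarrow> nat \<Rightarrow> instr list \<Rightarrow> bool" where
  "code_at P p cs \<longleftrightarrow> p + length cs \<le> length P \<and> (\<forall>i<length cs. P ! (p + i) = cs ! i)"

lemma code_at_append:
  "code_at P p (cs @ ds) \<longleftrightarrow> code_at P p cs \<and> code_at P (p + length cs) ds" (is "?l \<longleftrightarrow> ?r")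
proof
  show "?r" if l: ?l
  proof -
    have "P ! (p + length cs + i) = ds ! i" if "i < length ds" for i
      using l[unfolded code_at_def, THEN conjunct2, rule_format, of "length cs + i"] that
      by (simp add: add.assoc)
    then show ?thesis using l by (auto simp: code_at_def nth_append dest: spec)
  qed
  show "?l" if r: ?r
  proof -
    have "P ! (p + i) = (cs @ ds) ! i" if "i < length cs + length ds" for i
      using r that unfolding code_at_def
      by (cases "i < length cs") (auto simp: nth_append dest!: spec[of _ "i - length cs"])
    then show ?thesis using r by (auto simp: code_at_def)
  qed
qed

lemma code_at_Cons: "code_at P p (c # cs) \<longleftrightarrow> p < length P \<and> P ! p = c \<and> code_at P (Suc p) cs"
  using code_at_append[of P p "[c]" cs] by (auto simp: code_at_def)

lemma and_less_pow2: "and a b < (2::nat) ^ w" if "a < 2 ^ w"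
  using that by (metis take_bit_nat_eq_self_iff take_bit_and and.right_idem and.commute
      and_nat_def le_less_trans linorder_not_less and.left_commute AND_upper1 zero_le_numeral of_nat_0_le_iff
      of_nat_and_eq of_nat_le_iff)

lemma or_less_pow2: "or a b < (2::nat) ^ w" if "a < 2 ^ w" "b < 2 ^ w"
  using that by (metis take_bit_nat_eq_self_iff take_bit_or)

definition wf_mem :: "nat \<Rightarrow> (nat \<Rightarrow> nat) \<Rightarrow> (nat \<Rightarrow> nat) \<Rightarrow> bool" where
  "wf_mem w R M \<longleftrightarrow> (\<forall>r. R r < 2 ^ w) \<and> (\<forall>a. M a < 2 ^ w)"

lemma ev_less_pow2:
  assumes "wf_mem w R M" "ok w a R M"
  shows "ev a R M < 2 ^ w"
  using assms(2)
proof (induction a)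
  case (Bin b a1 a2)
  then show ?case
    by (cases b) (auto simp: and_less_pow2 or_less_pow2 intro: le_less_trans[OF div_le_dividend]
        le_less_trans[OF mod_less_eq_dividend])
qed (use assms(1) in \<open>auto simp: wf_mem_def\<close>)

lemma run_wf_mem: "run w c R M t R' M' \<Longrightarrow> wf_mem w R M \<Longrightarrow> wf_mem w R' M'"
proof (induction rule: run.induct)
  case (run_Assign a R M r)
  then show ?case using ev_less_pow2[of w R M a] by (auto simp: wf_mem_def)
next
  case (run_Put a R M b)
  then show ?case using ev_less_pow2[of w R M b] by (auto simp: wf_mem_def)
qed auto

text \<open>Without overflow the reduction modulo \<open>2 ^ w\<close> in \<open>exec\<close>
  changes nothing, except for subtraction, where it removes the \<open>2 ^ w\<close> that was added
  beforehand.\<close>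

lemma exec_binop:
  assumes "binop_ok w b (regs \<sigma> j) (regs \<sigma> k)" "regs \<sigma> j < 2 ^ w" "regs \<sigma> k < 2 ^ w"
  shows "exec w (binop_instr b i j k) \<sigma> =
    \<sigma>\<lparr>pc := Suc (pc \<sigma>), regs := (regs \<sigma>)(i := binop_val b (regs \<sigma> j) (regs \<sigma> k))\<rparr>"
proof (cases b)
  case OShr
  have "regs \<sigma> j div 2 ^ regs \<sigma> k < 2 ^ w" using assms(2) by (rule le_less_trans[OF div_le_dividend])
  then show ?thesis using OShr by (simp add: set_reg_def drop_bit_eq_div)
next
  case OSub
  then show ?thesis using assms
    by (auto simp: set_reg_def) (metis Nat.add_diff_assoc2 less_imp_diff_less mod_add_self2 mod_less)
next
  case ODiv
  have "regs \<sigma> j div regs \<sigma> k < 2 ^ w" using assms(2) by (rule le_less_trans[OF div_le_dividend])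
  then show ?thesis using ODiv by (simp add: set_reg_def)
next
  case OMod
  have "regs \<sigma> j mod regs \<sigma> k < 2 ^ w" using assms(2) by (rule le_less_trans[OF mod_less_eq_dividend])
  then show ?thesis using OMod by (simp add: set_reg_def)
qed (use assms in \<open>auto simp: set_reg_def push_bit_eq_mult and_less_pow2 or_less_pow2\<close>)

lemma step_at: "pc \<sigma> < length P \<Longrightarrow> P ! pc \<sigma> = i \<Longrightarrow> step P w \<sigma> = exec w i \<sigma>"
  by (simp add: step_def)

text \<open>The induction needs two bounds: \<open>d0\<close> limits the registers of the source
  program and stays fixed, while the target \<open>d\<close> grows with the nesting depth. That all
  registers below \<open>d\<close> are preserved protects the left operand while the right one is
  computed in \<open>Suc d\<close>.\<close>

lemma ecode_correct:
  assumes "wf_mem w R M" "eregs d0 a" "ok w a R M" "d0 \<le> d" "code_at P (pc \<sigma>) (ecode a d)"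
    and "\<And>r. r < d0 \<Longrightarrow> regs \<sigma> r = R r" "mem \<sigma> = M"
  shows "\<exists>\<sigma>'. (step P w ^^ elen a) \<sigma> = \<sigma>' \<and> pc \<sigma>' = pc \<sigma> + elen a \<and> mem \<sigma>' = M \<and>
    regs \<sigma>' d = ev a R M \<and> (\<forall>r<d. regs \<sigma>' r = regs \<sigma> r)"
  using assms(2-)
proof (induction a arbitrary: d \<sigma>)
  case (Cst c)
  then show ?case by (auto simp: code_at_Cons step_at set_reg_def)
next
  case (Reg r)
  then show ?case using assms(1) by (auto simp: code_at_Cons step_at set_reg_def wf_mem_def)
next
  case (Bin b a1 a2)
  have c: "code_at P (pc \<sigma>) (ecode a1 d)" "code_at P (pc \<sigma> + elen a1) (ecode a2 (Suc d))"
    "pc \<sigma> + elen a1 + elen a2 < length P" "P ! (pc \<sigma> + elen a1 + elen a2) = binop_instr b d d (Suc d)"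
    using Bin.prems by (auto simp: code_at_append code_at_Cons)
  obtain \<sigma>1 where 1: "(step P w ^^ elen a1) \<sigma> = \<sigma>1" "pc \<sigma>1 = pc \<sigma> + elen a1" "mem \<sigma>1 = M"
    "regs \<sigma>1 d = ev a1 R M" "\<And>r. r < d \<Longrightarrow> regs \<sigma>1 r = regs \<sigma> r"
    using Bin.IH(1)[of d \<sigma>] Bin.prems c by auto
  obtain \<sigma>2 where 2: "(step P w ^^ elen a2) \<sigma>1 = \<sigma>2" "pc \<sigma>2 = pc \<sigma>1 + elen a2" "mem \<sigma>2 = M"
    "regs \<sigma>2 (Suc d) = ev a2 R M" "\<And>r. r < Suc d \<Longrightarrow> regs \<sigma>2 r = regs \<sigma>1 r"
    using Bin.IH(2)[of "Suc d" \<sigma>1] Bin.prems c 1 by auto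
  have e: "exec w (binop_instr b d d (Suc d)) \<sigma>2 = \<sigma>2\<lparr>pc := Suc (pc \<sigma>2),
      regs := (regs \<sigma>2)(d := binop_val b (regs \<sigma>2 d) (regs \<sigma>2 (Suc d)))\<rparr>"
    using Bin.prems(2) 1 2 assms(1) by (intro exec_binop) (auto intro: ev_less_pow2)
  have "(step P w ^^ (elen a1 + elen a2 + 1)) \<sigma> = step P w \<sigma>2"
    using 1(1) 2(1) by (simp add: add.commute[of "elen a1"] funpow_add)
  also have "\<dots> = exec w (binop_instr b d d (Suc d)) \<sigma>2"
    using 1 2 c by (simp add: step_at)
  finally show ?case using 1 2 e by auto
next
  case (Cell a)
  have c: "code_at P (pc \<sigma>) (ecode a d)" "pc \<sigma> + elen a < length P" "P ! (pc \<sigma> + elen a) = Load d d"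
    using Cell.prems by (auto simp: code_at_append code_at_Cons)
  obtain \<sigma>1 where 1: "(step P w ^^ elen a) \<sigma> = \<sigma>1" "pc \<sigma>1 = pc \<sigma> + elen a" "mem \<sigma>1 = M"
    "regs \<sigma>1 d = ev a R M" "\<And>r. r < d \<Longrightarrow> regs \<sigma>1 r = regs \<sigma> r"
    using Cell.IH(1)[of d \<sigma>] Cell.prems c by auto
  have "M (ev a R M) < 2 ^ w" using assms(1) by (auto simp: wf_mem_def)
  then show ?case using 1 c by (auto simp: step_at set_reg_def)
qed

lemma ecode2_correct:
  assumes "wf_mem w R M" "eregs d a" "eregs d b" "ok w a R M" "ok w b R M"
    "code_at P (pc \<sigma>) (ecode a d @ ecode b (Suc d) @ cs)"
    and "\<And>r. r < d \<Longrightarrow> regs \<sigma> r = R r" "mem \<sigma> = M"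
  shows "\<exists>\<sigma>'. (step P w ^^ (elen a + elen b)) \<sigma> = \<sigma>' \<and> pc \<sigma>' = pc \<sigma> + elen a + elen b \<and> mem \<sigma>' = M \<and>
    regs \<sigma>' d = ev a R M \<and> regs \<sigma>' (Suc d) = ev b R M \<and> (\<forall>r<d. regs \<sigma>' r = R r) \<and>
    code_at P (pc \<sigma> + elen a + elen b) cs"
proof -
  have c: "code_at P (pc \<sigma>) (ecode a d)" "code_at P (pc \<sigma> + elen a) (ecode b (Suc d))"
    "code_at P (pc \<sigma> + elen a + elen b) cs"
    using assms by (auto simp: code_at_append)
  obtain \<sigma>1 where 1: "(step P w ^^ elen a) \<sigma> = \<sigma>1" "pc \<sigma>1 = pc \<sigma> + elen a" "mem \<sigma>1 = M"
    "regs \<sigma>1 d = ev a R M" "\<And>r. r < d \<Longrightarrow> regs \<sigma>1 r = regs \<sigma> r"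
    using ecode_correct[of w R M d a d P \<sigma>] assms c by auto
  obtain \<sigma>2 where 2: "(step P w ^^ elen b) \<sigma>1 = \<sigma>2" "pc \<sigma>2 = pc \<sigma>1 + elen b" "mem \<sigma>2 = M"
    "regs \<sigma>2 (Suc d) = ev b R M" "\<And>r. r < Suc d \<Longrightarrow> regs \<sigma>2 r = regs \<sigma>1 r"
    using ecode_correct[of w R M d b "Suc d" P \<sigma>1] assms c 1 by auto
  have "(step P w ^^ (elen a + elen b)) \<sigma> = \<sigma>2"
    using 1(1) 2(1) by (simp add: add.commute[of "elen a"] funpow_add)
  with 1 2 c assms show ?thesis by auto
qed

lemma funpow_plus_eq:
  fixes f :: "'a \<Rightarrow> 'a"
  shows "(f ^^ m) x = y \<Longrightarrow> (f ^^ k) y = z \<Longrightarrow> (f ^^ (m + k)) x = z"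
  by (simp add: add.commute[of m] funpow_add)

lemma funpow_1: "step P w \<sigma> = \<sigma>' \<Longrightarrow> (step P w ^^ 1) \<sigma> = \<sigma>'"
  by simp

text \<open>The induction follows the derivation of \<open>run\<close>, since the remaining rounds
  of a loop form a smaller derivation but not a smaller command. Registers from \<open>d\<close> on
  hold leftovers of expression evaluation, so agreement is claimed only below
  \<open>d\<close>.\<close>

lemma code_correct:
  assumes "run w c R M t R' M'" "wf_mem w R M" "cregs d c" "code_at P p (code d c p)"
    and "pc \<sigma> = p" "\<And>r. r < d \<Longrightarrow> regs \<sigma> r = R r" "mem \<sigma> = M"
  shows "\<exists>\<sigma>'. (step P w ^^ t) \<sigma> = \<sigma>' \<and> pc \<sigma>' = p + clen c \<and> mem \<sigma>' = M' \<and>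
    (\<forall>r<d. regs \<sigma>' r = R' r)"
  using assms
proof (induction arbitrary: p \<sigma> rule: run.induct)
  case (run_Skip R M)
  then show ?case by auto
next
  case (run_Assign a R M r)
  have c: "code_at P (pc \<sigma>) (ecode a d)" "p + elen a < length P" "P ! (p + elen a) = BitOr r d d"
    using run_Assign.prems by (auto simp: code_at_append code_at_Cons)
  obtain \<sigma>1 where 1: "(step P w ^^ elen a) \<sigma> = \<sigma>1" "pc \<sigma>1 = pc \<sigma> + elen a" "mem \<sigma>1 = M"
    "regs \<sigma>1 d = ev a R M" "\<And>r. r < d \<Longrightarrow> regs \<sigma>1 r = regs \<sigma> r"
    using ecode_correct[of w R M d a d P \<sigma>] run_Assign c by auto
  have "ev a R M < 2 ^ w" using run_Assign ev_less_pow2 by auto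
  then have "step P w \<sigma>1 = \<sigma>1\<lparr>pc := p + elen a + 1, regs := (regs \<sigma>1)(r := ev a R M)\<rparr>"
    using 1 c run_Assign.prems by (auto simp: step_at set_reg_def)
  from funpow_plus_eq[OF 1(1) funpow_1[OF this]]
  show ?case using 1 run_Assign.prems by auto
next
  case (run_Put a R M b)
  obtain \<sigma>1 where 1: "(step P w ^^ (elen a + elen b)) \<sigma> = \<sigma>1" "pc \<sigma>1 = pc \<sigma> + elen a + elen b" "mem \<sigma>1 = M"
    "regs \<sigma>1 d = ev a R M" "regs \<sigma>1 (Suc d) = ev b R M" "\<And>r. r < d \<Longrightarrow> regs \<sigma>1 r = R r"
    "code_at P (pc \<sigma> + elen a + elen b) [instr.Store d (Suc d)]"
    using ecode2_correct[of w R M d a b P \<sigma> "[instr.Store d (Suc d)]"] run_Put by auto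
  then have "step P w \<sigma>1 = \<sigma>1\<lparr>pc := p + elen a + elen b + 1, mem := M(ev a R M := ev b R M)\<rparr>"
    using run_Put.prems by (auto simp: step_at code_at_Cons)
  from funpow_plus_eq[OF 1(1) funpow_1[OF this]]
  show ?case using 1 run_Put.prems by auto
next
  case (run_Seq c1 R M t1 R1 M1 c2 t2 R2 M2)
  obtain \<sigma>1 where 1: "(step P w ^^ t1) \<sigma> = \<sigma>1" "pc \<sigma>1 = p + clen c1" "mem \<sigma>1 = M1"
     "\<And>r. r < d \<Longrightarrow> regs \<sigma>1 r = R1 r"
    using run_Seq.IH(1)[of p \<sigma>] run_Seq.prems by (auto simp: code_at_append)
  obtain \<sigma>2 where 2: "(step P w ^^ t2) \<sigma>1 = \<sigma>2" "pc \<sigma>2 = p + clen c1 + clen c2" "mem \<sigma>2 = M2"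
     "\<And>r. r < d \<Longrightarrow> regs \<sigma>2 r = R2 r"
    using run_Seq.IH(2)[of "p + clen c1" \<sigma>1] run_Seq.prems 1 run_wf_mem[OF run_Seq.hyps(1)]
    by (auto simp: code_at_append)
  from funpow_plus_eq[OF 1(1) 2(1)] 2 show ?case by auto
next
  case (run_IfTrue a R M b c1 t R1 M1 c2)
  let ?q = "p + elen a + elen b"
  let ?cs = "[JumpLess d (Suc d) (?q + 2 + clen c2)] @
     code d c2 (?q + 1) @ [Jump (?q + 2 + clen c2 + clen c1)] @ code d c1 (?q + 2 + clen c2)"
  obtain \<sigma>1 where 1: "(step P w ^^ (elen a + elen b)) \<sigma> = \<sigma>1" "pc \<sigma>1 = pc \<sigma> + elen a + elen b" "mem \<sigma>1 = M"
    "regs \<sigma>1 d = ev a R M" "regs \<sigma>1 (Suc d) = ev b R M" "\<And>r. r < d \<Longrightarrow> regs \<sigma>1 r = R r"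
    "code_at P (pc \<sigma> + elen a + elen b) ?cs"
    using ecode2_correct[of w R M d a b P \<sigma> ?cs] run_IfTrue by (auto simp: Let_def)
  have c: "?q < length P" "P ! ?q = JumpLess d (Suc d) (?q + 2 + clen c2)"
    "code_at P (?q + 2 + clen c2) (code d c1 (?q + 2 + clen c2))"
    using 1(7) run_IfTrue.prems by (auto simp: code_at_append code_at_Cons add_ac)
  have s: "step P w \<sigma>1 = \<sigma>1\<lparr>pc := ?q + 2 + clen c2\<rparr>"
    using run_IfTrue 1 c by (auto simp: step_at)
  obtain \<sigma>2 where 2: "(step P w ^^ t) (\<sigma>1\<lparr>pc := ?q + 2 + clen c2\<rparr>) = \<sigma>2"
    "pc \<sigma>2 = ?q + 2 + clen c2 + clen c1" "mem \<sigma>2 = M1" "\<And>r. r < d \<Longrightarrow> regs \<sigma>2 r = R1 r"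
    using run_IfTrue.IH[of "?q + 2 + clen c2" "\<sigma>1\<lparr>pc := ?q + 2 + clen c2\<rparr>"] run_IfTrue.prems 1 c
    by auto
  from funpow_plus_eq[OF funpow_plus_eq[OF 1(1) funpow_1[OF s]] 2(1)] 2 show ?case
    by (auto simp: add_ac)
next
  case (run_IfFalse a R M b c2 t R1 M1 c1)
  let ?q = "p + elen a + elen b"
  let ?cs = "[JumpLess d (Suc d) (?q + 2 + clen c2)] @
     code d c2 (?q + 1) @ [Jump (?q + 2 + clen c2 + clen c1)] @ code d c1 (?q + 2 + clen c2)"
  obtain \<sigma>1 where 1: "(step P w ^^ (elen a + elen b)) \<sigma> = \<sigma>1" "pc \<sigma>1 = pc \<sigma> + elen a + elen b" "mem \<sigma>1 = M"
    "regs \<sigma>1 d = ev a R M" "regs \<sigma>1 (Suc d) = ev b R M" "\<And>r. r < d \<Longrightarrow> regs \<sigma>1 r = R r"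
    "code_at P (pc \<sigma> + elen a + elen b) ?cs"
    using ecode2_correct[of w R M d a b P \<sigma> ?cs] run_IfFalse by (auto simp: Let_def)
  have c: "?q < length P" "P ! ?q = JumpLess d (Suc d) (?q + 2 + clen c2)"
    "code_at P (?q + 1) (code d c2 (?q + 1))"
    "?q + 1 + clen c2 < length P" "P ! (?q + 1 + clen c2) = Jump (?q + 2 + clen c2 + clen c1)"
    using 1(7) run_IfFalse.prems by (auto simp: code_at_append code_at_Cons add_ac)
  have s: "step P w \<sigma>1 = \<sigma>1\<lparr>pc := ?q + 1\<rparr>"
    using run_IfFalse 1 c by (auto simp: step_at)
  obtain \<sigma>2 where 2: "(step P w ^^ t) (\<sigma>1\<lparr>pc := ?q + 1\<rparr>) = \<sigma>2"
    "pc \<sigma>2 = ?q + 1 + clen c2" "mem \<sigma>2 = M1" "\<And>r. r < d \<Longrightarrow> regs \<sigma>2 r = R1 r"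
    using run_IfFalse.IH[of "?q + 1" "\<sigma>1\<lparr>pc := ?q + 1\<rparr>"] run_IfFalse.prems 1 c
    by auto
  have s2: "step P w \<sigma>2 = \<sigma>2\<lparr>pc := ?q + 2 + clen c2 + clen c1\<rparr>"
    using 2 c by (auto simp: step_at)
  from funpow_plus_eq[OF funpow_plus_eq[OF funpow_plus_eq[OF 1(1) funpow_1[OF s]] 2(1)] funpow_1[OF s2]] 2
  show ?case by (auto simp: add_ac)
next
  case (run_WhileTrue a R M b c t R1 M1 t' R2 M2)
  let ?q = "p + elen a + elen b"
  let ?cs = "[JumpLess d (Suc d) (?q + 2), Jump (?q + 3 + clen c)] @ code d c (?q + 2) @ [Jump p]"
  obtain \<sigma>1 where 1: "(step P w ^^ (elen a + elen b)) \<sigma> = \<sigma>1" "pc \<sigma>1 = pc \<sigma> + elen a + elen b" "mem \<sigma>1 = M"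
    "regs \<sigma>1 d = ev a R M" "regs \<sigma>1 (Suc d) = ev b R M" "\<And>r. r < d \<Longrightarrow> regs \<sigma>1 r = R r"
    "code_at P (pc \<sigma> + elen a + elen b) ?cs"
    using ecode2_correct[of w R M d a b P \<sigma> ?cs] run_WhileTrue by (auto simp: Let_def)
  have c: "?q < length P" "P ! ?q = JumpLess d (Suc d) (?q + 2)"
    "code_at P (?q + 2) (code d c (?q + 2))"
    "?q + 2 + clen c < length P" "P ! (?q + 2 + clen c) = Jump p"
    using 1(7) run_WhileTrue.prems by (auto simp: code_at_append code_at_Cons add_ac)
  have s: "step P w \<sigma>1 = \<sigma>1\<lparr>pc := ?q + 2\<rparr>"
    using run_WhileTrue 1 c by (auto simp: step_at)
  obtain \<sigma>2 where 2: "(step P w ^^ t) (\<sigma>1\<lparr>pc := ?q + 2\<rparr>) = \<sigma>2"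
    "pc \<sigma>2 = ?q + 2 + clen c" "mem \<sigma>2 = M1" "\<And>r. r < d \<Longrightarrow> regs \<sigma>2 r = R1 r"
    using run_WhileTrue.IH(1)[of "?q + 2" "\<sigma>1\<lparr>pc := ?q + 2\<rparr>"] run_WhileTrue.prems 1 c
    by auto
  have s2: "step P w \<sigma>2 = \<sigma>2\<lparr>pc := p\<rparr>"
    using 2 c by (auto simp: step_at)
  obtain \<sigma>3 where 3: "(step P w ^^ t') (\<sigma>2\<lparr>pc := p\<rparr>) = \<sigma>3"
    "pc \<sigma>3 = p + clen (WhileLess a b c)" "mem \<sigma>3 = M2" "\<And>r. r < d \<Longrightarrow> regs \<sigma>3 r = R2 r"
    using run_WhileTrue.IH(2)[of p "\<sigma>2\<lparr>pc := p\<rparr>"] run_WhileTrue.prems 2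
      run_wf_mem[OF run_WhileTrue.hyps(4)] by auto
  have "elen a + elen b + 2 + t + t' = elen a + elen b + 1 + t + 1 + t'" by simp
  with funpow_plus_eq[OF funpow_plus_eq[OF funpow_plus_eq[OF funpow_plus_eq[OF 1(1) funpow_1[OF s]] 2(1)]
      funpow_1[OF s2]] 3(1)] 3
  show ?case by metis
next
  case (run_WhileFalse a R M b c)
  let ?q = "p + elen a + elen b"
  let ?cs = "[JumpLess d (Suc d) (?q + 2), Jump (?q + 3 + clen c)] @ code d c (?q + 2) @ [Jump p]"
  obtain \<sigma>1 where 1: "(step P w ^^ (elen a + elen b)) \<sigma> = \<sigma>1" "pc \<sigma>1 = pc \<sigma> + elen a + elen b" "mem \<sigma>1 = M"
    "regs \<sigma>1 d = ev a R M" "regs \<sigma>1 (Suc d) = ev b R M" "\<And>r. r < d \<Longrightarrow> regs \<sigma>1 r = R r"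
    "code_at P (pc \<sigma> + elen a + elen b) ?cs"
    using ecode2_correct[of w R M d a b P \<sigma> ?cs] run_WhileFalse by (auto simp: Let_def)
  have c: "?q < length P" "P ! ?q = JumpLess d (Suc d) (?q + 2)"
    "?q + 1 < length P" "P ! (?q + 1) = Jump (?q + 3 + clen c)"
    using 1(7) run_WhileFalse.prems by (auto simp: code_at_append code_at_Cons add_ac)
  have s: "step P w \<sigma>1 = \<sigma>1\<lparr>pc := ?q + 1\<rparr>"
    using run_WhileFalse 1 c by (auto simp: step_at)
  have s2: "step P w (\<sigma>1\<lparr>pc := ?q + 1\<rparr>) = \<sigma>1\<lparr>pc := ?q + 3 + clen c\<rparr>"
    using c by (auto simp: step_at)
  have "elen a + elen b + 2 = elen a + elen b + 1 + 1" by simp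
  with funpow_plus_eq[OF funpow_plus_eq[OF 1(1) funpow_1[OF s]] funpow_1[OF s2]] 1 run_WhileFalse.prems
  show ?case by (auto simp: add_ac)
qed

text \<open>Total correctness from a given state; the first argument of \<open>Q\<close> is the running time.\<close>

definition H :: "nat \<Rightarrow> com \<Rightarrow> (nat \<Rightarrow> nat) \<Rightarrow> (nat \<Rightarrow> nat) \<Rightarrow>
    (nat \<Rightarrow> (nat \<Rightarrow> nat) \<Rightarrow> (nat \<Rightarrow> nat) \<Rightarrow> bool) \<Rightarrow> bool" where
  "H w c R M Q \<longleftrightarrow> (\<exists>t R' M'. run w c R M t R' M' \<and> Q t R' M')"

lemma H_mono: "H w c R M Q \<Longrightarrow> (\<And>t R' M'. Q t R' M' \<Longrightarrow> Q' t R' M') \<Longrightarrow> H w c R M Q'"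
  unfolding H_def by blast

lemma H_Skip: "Q 0 R M \<Longrightarrow> H w Skip R M Q"
  unfolding H_def by (blast intro: run.intros)

lemma H_Assign: "ok w a R M \<Longrightarrow> Q (elen a + 1) (R(r := ev a R M)) M \<Longrightarrow> H w (r ::= a) R M Q"
  unfolding H_def by (blast intro: run.intros)

lemma H_Put: "ok w a R M \<Longrightarrow> ok w b R M \<Longrightarrow> Q (elen a + elen b + 1) R (M(ev a R M := ev b R M)) \<Longrightarrow>
    H w (Put a b) R M Q"
  unfolding H_def by (blast intro: run.intros)

lemma H_Seq: "H w c1 R M (\<lambda>t1 R1 M1. H w c2 R1 M1 (\<lambda>t2. Q (t1 + t2))) \<Longrightarrow> H w (c1 ;; c2) R M Q"
  unfolding H_def by (blast intro: run.intros)

lemma H_IfLess: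
  assumes "ok w a R M" "ok w b R M"
    and "ev a R M < ev b R M \<Longrightarrow> H w c1 R M (\<lambda>t. Q (elen a + elen b + 1 + t))"
    and "\<not> ev a R M < ev b R M \<Longrightarrow> H w c2 R M (\<lambda>t. Q (elen a + elen b + 2 + t))"
  shows "H w (IfLess a b c1 c2) R M Q"
  using assms unfolding H_def by (cases "ev a R M < ev b R M") (blast intro: run.intros)+

text \<open>The index \<open>\<tau>\<close> of the invariant is a potential: it bounds the remaining running time.\<close>

lemma H_WhileLess:
  assumes inv: "I \<tau> R M"
    and ok: "\<And>\<tau> R M. I \<tau> R M \<Longrightarrow> ok w a R M \<and> ok w b R M \<and> elen a + elen b + 2 \<le> \<tau>"
    and body: "\<And>\<tau> R M. I \<tau> R M \<Longrightarrow> ev a R M < ev b R M \<Longrightarrow>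
      H w c R M (\<lambda>t R' M'. \<exists>\<tau>'. I \<tau>' R' M' \<and> elen a + elen b + 2 + t + \<tau>' \<le> \<tau>)"
  shows "H w (WhileLess a b c) R M
    (\<lambda>t R' M'. t \<le> \<tau> \<and> (\<exists>\<tau>'. I \<tau>' R' M') \<and> \<not> ev a R' M' < ev b R' M')"
  using inv
\<comment> \<open>Every round pays at least 2 steps for its test, so the potential strictly
  decreases; termination comes from the same induction as the time bound.\<close>
proof (induction \<tau> arbitrary: R M rule: less_induct)
  case (less \<tau>)
  show ?case
  proof (cases "ev a R M < ev b R M")
    case True
    then obtain t R1 M1 \<tau>' where 1: "run w c R M t R1 M1" "I \<tau>' R1 M1" "elen a + elen b + 2 + t + \<tau>' \<le> \<tau>"
      using body[OF less.prems] by (auto simp: H_def)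
    then obtain t' R2 M2 \<tau>2 where 2: "run w (WhileLess a b c) R1 M1 t' R2 M2" "t' \<le> \<tau>'" "I \<tau>2 R2 M2"
      "\<not> ev a R2 M2 < ev b R2 M2"
      using less.IH[of \<tau>' R1 M1] by (auto simp: H_def)
    have "run w (WhileLess a b c) R M (elen a + elen b + 2 + t + t') R2 M2"
      using ok[OF less.prems] True 1(1) 2(1) by (blast intro: run_WhileTrue)
    moreover have "elen a + elen b + 2 + t + t' \<le> \<tau>" using 1 2 by simp
    ultimately show ?thesis unfolding H_def using 2 by blast
  next
    case False
    then show ?thesis unfolding H_def using ok[OF less.prems] less.prems run_WhileFalse by blast
  qed
qed

text \<open>Counting loops. Besides the body, a round pays \<open>elen a + 3\<close>: one step to
  read the counter, \<open>elen a\<close> to evaluate the limit again, two for jumps. Since the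
  limit is an expression, it must be known to evaluate to \<open>hi\<close> in every state that
  satisfies the invariant.\<close>

lemma H_for:
  assumes "I x0 R M" "R r = x0" "x0 \<le> hi"
    and ok: "\<And>x R M. I x R M \<Longrightarrow> x \<le> hi \<Longrightarrow> ok w a R M \<and> ev a R M = hi"
    and body: "\<And>x R M. I x R M \<Longrightarrow> R r = x \<Longrightarrow> x < hi \<Longrightarrow>
      H w c R M (\<lambda>t R' M'. t \<le> cb \<and> R' r = Suc x \<and> I (Suc x) R' M')"
  shows "H w (WhileLess (Reg r) a c) R M
    (\<lambda>t R' M'. t \<le> (hi - x0) * (cb + elen a + 3) + elen a + 3 \<and> R' r = hi \<and> I hi R' M')"
proof -
  let ?J = "\<lambda>\<tau> R M. \<exists>x. I x R M \<and> R r = x \<and> x \<le> hi \<and> \<tau> = (hi - x) * (cb + elen a + 3) + elen a + 3"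
  have "H w (WhileLess (Reg r) a c) R M
    (\<lambda>t R' M'. t \<le> (hi - x0) * (cb + elen a + 3) + elen a + 3 \<and> (\<exists>\<tau>'. ?J \<tau>' R' M') \<and>
       \<not> ev (Reg r) R' M' < ev a R' M')"
  proof (rule H_WhileLess)
    show "?J ((hi - x0) * (cb + elen a + 3) + elen a + 3) R M" using assms by auto
  next
    fix \<tau> R M assume "?J \<tau> R M"
    then show "ok w (Reg r) R M \<and> ok w a R M \<and> elen (Reg r) + elen a + 2 \<le> \<tau>" using ok by auto
  next
    fix \<tau> R M assume J: "?J \<tau> R M" and lt: "ev (Reg r) R M < ev a R M"
    from J obtain x where x: "I x R M" "R r = x" "x \<le> hi" "\<tau> = (hi - x) * (cb + elen a + 3) + elen a + 3"
      by auto
    with lt ok[of x R M] have "x < hi" by auto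
    then have l: "hi - x = Suc (hi - Suc x)" by simp
    show "H w c R M (\<lambda>t R' M'. \<exists>\<tau>'. ?J \<tau>' R' M' \<and> elen (Reg r) + elen a + 2 + t + \<tau>' \<le> \<tau>)"
    proof (rule H_mono[OF body[OF x(1,2) \<open>x < hi\<close>]])
      fix t R' M' assume "t \<le> cb \<and> R' r = Suc x \<and> I (Suc x) R' M'"
      then show "\<exists>\<tau>'. ?J \<tau>' R' M' \<and> elen (Reg r) + elen a + 2 + t + \<tau>' \<le> \<tau>"
        using \<open>x < hi\<close> unfolding x(4) l by (intro exI[of _ "(hi - Suc x) * (cb + elen a + 3) + elen a + 3"]) auto
    qed
  qed
  then show ?thesis
  proof (rule H_mono)
    fix t R' M'
    assume "t \<le> (hi - x0) * (cb + elen a + 3) + elen a + 3 \<and> (\<exists>\<tau>'. ?J \<tau>' R' M') \<and>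
       \<not> ev (Reg r) R' M' < ev a R' M'"
    then obtain x where "t \<le> (hi - x0) * (cb + elen a + 3) + elen a + 3" "I x R' M'" "R' r = x" "x \<le> hi"
      "\<not> R' r < ev a R' M'" by auto
    with ok[of x R' M'] show "t \<le> (hi - x0) * (cb + elen a + 3) + elen a + 3 \<and> R' r = hi \<and> I hi R' M'"
      by auto
  qed
qed

section \<open>Running the gate interpreter\<close>

text \<open>Register \<open>r\<close> of the interpreter is kept in register \<open>30 + r\<close>, its program counter in register
  20 and its memory at the address in register 17; registers 5 and 6 hold the number of its words
  and its word size.\<close>

definition sim_op :: "binop \<Rightarrow> nat \<Rightarrow> nat \<Rightarrow> nat \<Rightarrow> com" where
  "sim_op b i j k = 30 + i ::= Bin b (Reg (30 + j)) (Reg (30 + k)) %% Reg 5 ;; 20 ::= Reg 20 \<oplus> Cst 1"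

text \<open>Binary operations are formed exactly in the longer words of the simulating machine and
  then reduced modulo register 5. Complement is subtraction from the word of all ones. A left shift
  by the simulated word size or more is treated separately, as the exact result could overflow even
  the longer words. Jump targets are capped at the program length \<open>l\<close>: every larger
  value means a halt as well, and the constant then fits into a word.\<close>

fun sim :: "nat \<Rightarrow> instr \<Rightarrow> com" where
  "sim l (LoadConst i c) = 30 + i ::= Cst c %% Reg 5 ;; 20 ::= Reg 20 \<oplus> Cst 1"
| "sim l (BitAnd i j k) = sim_op OAnd i j k"
| "sim l (BitOr i j k) = sim_op OOr i j k"
| "sim l (BitNot i j) = 30 + i ::= Reg 5 \<ominus> Cst 1 \<ominus> Reg (30 + j) ;; 20 ::= Reg 20 \<oplus> Cst 1"
| "sim l (ShiftL i j k) = IfLess (Reg (30 + k)) (Reg 6) (sim_op OShl i j k)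
     (30 + i ::= Cst 0 ;; 20 ::= Reg 20 \<oplus> Cst 1)"
| "sim l (ShiftR i j k) = sim_op OShr i j k"
| "sim l (Add i j k) = sim_op OAdd i j k"
| "sim l (Sub i j k) = 30 + i ::= (Reg (30 + j) \<oplus> Reg 5 \<ominus> Reg (30 + k)) %% Reg 5 ;; 20 ::= Reg 20 \<oplus> Cst 1"
| "sim l (Mul i j k) = sim_op OMul i j k"
| "sim l (Div i j k) = sim_op ODiv i j k"
| "sim l (Rem i j k) = sim_op OMod i j k"
| "sim l (Load i j) = 30 + i ::= Cell (Reg 17 \<oplus> Reg (30 + j)) %% Reg 5 ;; 20 ::= Reg 20 \<oplus> Cst 1"
| "sim l (Store i j) = Put (Reg 17 \<oplus> Reg (30 + i)) (Reg (30 + j)) ;; 20 ::= Reg 20 \<oplus> Cst 1"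
| "sim l (Jump a) = 20 ::= Cst (min a l)"
| "sim l (JumpZero i a) = IfLess (Reg (30 + i)) (Cst 1) (20 ::= Cst (min a l)) (20 ::= Reg 20 \<oplus> Cst 1)"
| "sim l (JumpLess i j a) =
     IfLess (Reg (30 + i)) (Reg (30 + j)) (20 ::= Cst (min a l)) (20 ::= Reg 20 \<oplus> Cst 1)"

fun instr_regs :: "instr \<Rightarrow> nat set" where
  "instr_regs (LoadConst i c) = {i}"
| "instr_regs (BitAnd i j k) = {i, j, k}"
| "instr_regs (BitOr i j k) = {i, j, k}"
| "instr_regs (BitNot i j) = {i, j}"
| "instr_regs (ShiftL i j k) = {i, j, k}"
| "instr_regs (ShiftR i j k) = {i, j, k}"
| "instr_regs (Add i j k) = {i, j, k}"
| "instr_regs (Sub i j k) = {i, j, k}"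
| "instr_regs (Mul i j k) = {i, j, k}"
| "instr_regs (Div i j k) = {i, j, k}"
| "instr_regs (Rem i j k) = {i, j, k}"
| "instr_regs (Load i j) = {i, j}"
| "instr_regs (Store i j) = {i, j}"
| "instr_regs (Jump a) = {}"
| "instr_regs (JumpZero i a) = {i}"
| "instr_regs (JumpLess i j a) = {i, j}"

text \<open>Only loaded constants have to be bounded here; \<open>sim\<close> caps the jump
  targets.\<close>

fun instr_const :: "instr \<Rightarrow> nat" where
  "instr_const (LoadConst i c) = c"
| "instr_const _ = 0"

definition instr_within :: "nat \<Rightarrow> nat \<Rightarrow> instr \<Rightarrow> bool" where
  "instr_within d m ins \<longleftrightarrow> (\<forall>r\<in>instr_regs ins. r < d) \<and> instr_const ins < m"

text \<open>Program counters beyond the code are all identified with \<open>l\<close>. The bounds by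
  \<open>B\<close> belong to the relation because the longer words of the simulating machine do not
  enforce them.\<close>

definition erel :: "nat \<Rightarrow> nat \<Rightarrow> nat \<Rightarrow> nat \<Rightarrow> state \<Rightarrow> (nat \<Rightarrow> nat) \<Rightarrow> (nat \<Rightarrow> nat) \<Rightarrow> bool" where
  "erel d l B a0 \<sigma> R M \<longleftrightarrow> R 20 = min (pc \<sigma>) l \<and> (\<forall>r<d. R (30 + r) = regs \<sigma> r) \<and>
     (\<forall>a<B. M (a0 + a) = mem \<sigma> a) \<and> (\<forall>r. regs \<sigma> r < B) \<and> (\<forall>a<B. mem \<sigma> a < B)"

definition eframe :: "nat \<Rightarrow> nat \<Rightarrow> (nat \<Rightarrow> nat) \<Rightarrow> (nat \<Rightarrow> nat) \<Rightarrow> (nat \<Rightarrow> nat) \<Rightarrow> (nat \<Rightarrow> nat) \<Rightarrow> bool" where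
  "eframe B a0 R M R' M' \<longleftrightarrow> (\<forall>r<30. r \<noteq> 20 \<longrightarrow> R' r = R r) \<and>
     (\<forall>x. x < a0 \<or> a0 + B \<le> x \<longrightarrow> M' x = M x)"

lemma eframe_trans: "eframe B a0 R M R1 M1 \<Longrightarrow> eframe B a0 R1 M1 R2 M2 \<Longrightarrow> eframe B a0 R M R2 M2"
  by (auto simp: eframe_def)

lemma eframe_refl: "eframe B a0 R M R M"
  by (auto simp: eframe_def)

lemma sim_set_reg:
  assumes rel: "erel d l (2 ^ w0) a0 \<sigma> R M" and "pc \<sigma> < l" "l < 2 ^ w"
    and "i < d" "ok w a R M" "ev a R M = v mod 2 ^ w0" "elen a \<le> 7"
  shows "H w (30 + i ::= a ;; 20 ::= Reg 20 \<oplus> Cst 1) R M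
    (\<lambda>t R' M'. t \<le> 12 \<and> erel d l (2 ^ w0) a0 (set_reg w0 i v \<sigma>) R' M' \<and> eframe (2 ^ w0) a0 R M R' M')"
  using assms
  by (intro H_Seq H_Assign) (auto simp: erel_def eframe_def set_reg_def)

text \<open>Words with at least twice as many bits hold the exact product of two simulated words,
  hence also sums, the intermediate value of a subtraction, and shifts by less than
  \<open>w0\<close>.\<close>

lemma sim_correct:
  assumes rel: "erel d l (2 ^ w0) a0 \<sigma> R M" and pc: "pc \<sigma> < l" "l < 2 ^ w"
    and ins: "instr_within d (2 ^ w) ins" and w: "2 ^ w0 * 2 ^ w0 \<le> (2::nat) ^ w" "a0 + 2 ^ w0 \<le> 2 ^ w"
      "2 \<le> (2::nat) ^ w0"
    and R: "R 5 = 2 ^ w0" "R 6 = w0" "R 17 = a0"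
  shows "H w (sim l ins) R M
    (\<lambda>t R' M'. t \<le> 20 \<and> erel d l (2 ^ w0) a0 (exec w0 ins \<sigma>) R' M' \<and> eframe (2 ^ w0) a0 R M R' M')"
proof -
  let ?B = "2 ^ w0 :: nat"
  have reg: "R (30 + r) = regs \<sigma> r" "regs \<sigma> r < ?B" if "r < d" for r
    using rel that by (auto simp: erel_def)
  have mem: "M (a0 + a) = mem \<sigma> a" "mem \<sigma> a < ?B" if "a < ?B" for a
    using rel that by (auto simp: erel_def)
  have le: "2 * ?B \<le> 2 ^ w" using w(1) mult_le_mono1[OF w(3), of ?B] by linarith
  have mul: "x * y < 2 ^ w" if "x < ?B" "y < ?B" for x y
    using mult_strict_mono[OF that] w(1) by (meson less_le_trans zero_le zero_less_power pos2)
  note sr = H_mono[OF sim_set_reg[OF rel pc]]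
  have op: "H w (sim_op b i j k) R M (\<lambda>t R' M'. t \<le> 12 \<and>
      erel d l ?B a0 (set_reg w0 i v \<sigma>) R' M' \<and> eframe ?B a0 R M R' M')"
    if "i < d" "j < d" "k < d" "binop_ok w b (regs \<sigma> j) (regs \<sigma> k)"
      "binop_val b (regs \<sigma> j) (regs \<sigma> k) mod ?B = v mod ?B" for b i j k v
    unfolding sim_op_def using that reg R
    by (intro sim_set_reg[OF rel pc]) auto
  show ?thesis
  proof (cases ins)
    case (LoadConst i c)
    then show ?thesis using ins R by (simp del: One_nat_def, intro sr) (auto simp: instr_within_def)
  next
    case (BitAnd i j k)
    then show ?thesis using ins by (simp del: One_nat_def, intro H_mono[OF op]) (auto simp: instr_within_def)
  next
    case (BitOr i j k)
    then show ?thesis using ins by (simp del: One_nat_def, intro H_mono[OF op]) (auto simp: instr_within_def)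
  next
    case (BitNot i j)
    then have "i < d" "j < d" using ins by (auto simp: instr_within_def)
    then have *: "?B - Suc 0 - regs \<sigma> j < ?B" using reg[of j] by simp
    show ?thesis using BitNot ins reg[OF \<open>j < d\<close>] R le w(3) \<open>i < d\<close> *
      by (simp del: One_nat_def, intro sr) auto
  next
    case (ShiftL i j k)
    then have d: "i < d" "j < d" "k < d" using ins by (auto simp: instr_within_def)
    show ?thesis
    proof (cases "regs \<sigma> k < w0")
      case True
      have "(2::nat) ^ regs \<sigma> k < ?B" using True by simp
      then have "regs \<sigma> j * 2 ^ regs \<sigma> k < 2 ^ w" using reg(2)[OF d(2)] mul by blast
      then show ?thesis using ShiftL d reg R True
        by (simp del: One_nat_def, intro H_IfLess H_mono[OF op]) (auto simp: push_bit_eq_mult)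
    next
      \<comment> \<open>All bits leave the simulated word, which justifies the constant 0 written by
        \<open>sim\<close>.\<close>
      case False
      then have "(2::nat) ^ w0 dvd 2 ^ regs \<sigma> k" by (simp add: le_imp_power_dvd)
      then have "push_bit (regs \<sigma> k) (regs \<sigma> j) mod 2 ^ w0 = 0"
        by (simp add: push_bit_eq_mult mod_eq_0_iff_dvd)
      then show ?thesis using ShiftL d reg R False
        by (simp del: One_nat_def, intro H_IfLess sr) auto
    qed
  next
    case (ShiftR i j k)
    then show ?thesis using ins by (simp del: One_nat_def, intro H_mono[OF op]) (auto simp: instr_within_def drop_bit_eq_div)
  next
    case (Add i j k)
    then have d: "i < d" "j < d" "k < d" using ins by (auto simp: instr_within_def)
    have "regs \<sigma> j + regs \<sigma> k < 2 ^ w" using reg(2)[OF d(2)] reg(2)[OF d(3)] le by linarith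
    then show ?thesis using Add d by (simp del: One_nat_def, intro H_mono[OF op]) auto
  next
    case (Sub i j k)
    then have d: "i < d" "j < d" "k < d" using ins by (auto simp: instr_within_def)
    have "regs \<sigma> j + ?B < 2 ^ w" using reg(2)[OF d(2)] reg(2)[OF d(3)] le by linarith
    then show ?thesis using Sub d reg(1)[OF d(2)] reg(1)[OF d(3)] reg(2)[OF d(3)] R
      by (simp del: One_nat_def, intro sr) auto
  next
    case (Mul i j k)
    then have d: "i < d" "j < d" "k < d" using ins by (auto simp: instr_within_def)
    have "regs \<sigma> j * regs \<sigma> k < 2 ^ w" using reg(2)[OF d(2)] reg(2)[OF d(3)] mul by blast
    then show ?thesis using Mul d by (simp del: One_nat_def, intro H_mono[OF op]) auto
  next
    case (Div i j k)
    then show ?thesis using ins by (simp del: One_nat_def, intro H_mono[OF op]) (auto simp: instr_within_def)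
  next
    case (Rem i j k)
    then show ?thesis using ins by (simp del: One_nat_def, intro H_mono[OF op]) (auto simp: instr_within_def)
  next
    case (Load i j)
    then have d: "i < d" "j < d" using ins by (auto simp: instr_within_def)
    have "a0 + regs \<sigma> j < 2 ^ w" using reg(2)[OF d(2)] w(2) by linarith
    then show ?thesis using Load d reg[OF d(2)] mem[OF reg(2)[OF d(2)]] R
      by (simp del: One_nat_def, intro sr) auto
  next
    case (Store i j)
    then have d: "i < d" "j < d" using ins by (auto simp: instr_within_def)
    have "a0 + regs \<sigma> i < 2 ^ w" using reg(2)[OF d(1)] w(2) by linarith
    then show ?thesis using Store reg[OF d(1)] reg[OF d(2)] R rel pc
      by (simp del: One_nat_def, intro H_Seq H_Put H_Assign) (auto simp: erel_def eframe_def dest: leD)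
  next
    case (Jump a)
    then show ?thesis using rel pc by (simp del: One_nat_def, intro H_Assign) (auto simp: erel_def eframe_def)
  next
    case (JumpZero i a)
    then have d: "i < d" using ins by (auto simp: instr_within_def)
    then show ?thesis using rel pc reg[OF d] w le unfolding JumpZero sim.simps exec.simps
      by (intro H_IfLess H_Assign) (auto simp: erel_def eframe_def)
  next
    case (JumpLess i j a)
    then have d: "i < d" "j < d" using ins by (auto simp: instr_within_def)
    then show ?thesis using rel pc reg[OF d(1)] reg[OF d(2)] w le unfolding JumpLess sim.simps exec.simps
      by (intro H_IfLess H_Assign) (auto simp: erel_def eframe_def)
  qed
qed

text \<open>The machine has no indirect jumps, so the simulated program counter is located by a
  chain of comparisons. Its length is that of \<open>E\<close>, a constant.\<close>

fun dispatch :: "nat \<Rightarrow> nat \<Rightarrow> instr list \<Rightarrow> com" where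
  "dispatch l i [] = Skip"
| "dispatch l i (x # xs) = IfLess (Reg 20) (Cst (Suc i)) (sim l x) (dispatch l (Suc i) xs)"

lemma dispatch_correct:
  assumes "R 20 = i + q" "q < length xs" "i + length xs < 2 ^ w"
    and "H w (sim l (xs ! q)) R M (\<lambda>t R' M'. t \<le> 20 \<and> Q R' M')"
  shows "H w (dispatch l i xs) R M (\<lambda>t R' M'. t \<le> 4 * length xs + 20 \<and> Q R' M')"
  using assms
proof (induction xs arbitrary: i q)
  case (Cons x xs)
  show ?case
  proof (cases q)
    case 0
    then show ?thesis using Cons.prems
      by (simp, intro H_IfLess) (auto elim: H_mono)
  next
    case (Suc q')
    have "H w (dispatch l (Suc i) xs) R M (\<lambda>t R' M'. t \<le> 4 * length xs + 20 \<and> Q R' M')"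
      using Cons.prems Suc by (intro Cons.IH[of "Suc i" q']) auto
    then show ?thesis using Cons.prems Suc
      by (simp, intro H_IfLess) (auto elim: H_mono)
  qed
qed simp

text \<open>The simulation loop stops once \<open>E\<close> has halted, whereas
  \<open>computes_within\<close> inspects the state after exactly \<open>T\<close> steps; both
  states agree.\<close>

lemma step_funpow_halted:
  assumes "length P \<le> pc ((step P w ^^ j) \<sigma>)" "j \<le> t"
  shows "(step P w ^^ t) \<sigma> = (step P w ^^ j) \<sigma>"
  using assms(2)
proof (induction rule: dec_induct)
  case (step m)
  have "(step P w ^^ Suc m) \<sigma> = step P w ((step P w ^^ j) \<sigma>)" using step.IH by simp
  also have "\<dots> = (step P w ^^ j) \<sigma>" using assms(1) by (subst step_def) simp
  finally show ?case .
qed simp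

definition interp :: "program \<Rightarrow> com" where
  "interp E = WhileLess (Reg 20) (Cst (length E)) (dispatch (length E) 0 E)"

lemma interp_correct:
  assumes rel: "erel d (length E) (2 ^ w0) a0 \<sigma> R M" and l: "length E < 2 ^ w"
    and ins: "\<forall>ins\<in>set E. instr_within d (2 ^ w) ins"
    and w: "2 ^ w0 * 2 ^ w0 \<le> (2::nat) ^ w" "a0 + 2 ^ w0 \<le> 2 ^ w" "2 \<le> (2::nat) ^ w0"
    and R: "R 5 = 2 ^ w0" "R 6 = w0" "R 17 = a0"
    and halt: "length E \<le> pc ((step E w0 ^^ T) \<sigma>)"
  shows "H w (interp E) R M
    (\<lambda>t R' M'. t \<le> T * (4 * length E + 24) + 4 \<and> erel d (length E) (2 ^ w0) a0 ((step E w0 ^^ T) \<sigma>) R' M' \<and>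
      eframe (2 ^ w0) a0 R M R' M')"
proof -
  \<comment> \<open>A simulated step costs at most \<open>4 * length E + 20\<close> for the dispatch
    and the instruction, and 4 for the loop test.\<close>
  let ?c = "4 * length E + 24"
  let ?I = "\<lambda>\<tau> R' M'. \<exists>j\<le>T. erel d (length E) (2 ^ w0) a0 ((step E w0 ^^ j) \<sigma>) R' M' \<and>
     eframe (2 ^ w0) a0 R M R' M' \<and> \<tau> = (T - j) * ?c + 4"
  have "H w (interp E) R M (\<lambda>t R' M'. t \<le> T * ?c + 4 \<and> (\<exists>\<tau>'. ?I \<tau>' R' M') \<and>
     \<not> ev (Reg 20) R' M' < ev (Cst (length E)) R' M')"
    unfolding interp_def
  proof (rule H_WhileLess)
    show "?I (T * ?c + 4) R M" using rel by (intro exI[of _ 0]) (auto simp: eframe_refl)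
  next
    fix \<tau> R1 M1 assume "?I \<tau> R1 M1"
    then show "ok w (Reg 20) R1 M1 \<and> ok w (Cst (length E)) R1 M1 \<and>
        elen (Reg 20) + elen (Cst (length E)) + 2 \<le> \<tau>" using l by auto
  next
    fix \<tau> R1 M1 assume "?I \<tau> R1 M1" and lt: "ev (Reg 20) R1 M1 < ev (Cst (length E)) R1 M1"
    then obtain j where j: "j \<le> T" "erel d (length E) (2 ^ w0) a0 ((step E w0 ^^ j) \<sigma>) R1 M1"
      "eframe (2 ^ w0) a0 R M R1 M1" "\<tau> = (T - j) * ?c + 4" by auto
    let ?\<sigma> = "(step E w0 ^^ j) \<sigma>"
    have pc: "pc ?\<sigma> < length E" "R1 20 = pc ?\<sigma>" using lt j(2) by (auto simp: erel_def)
    with halt j(1) have "j < T" by (cases "j = T") auto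
    have st: "(step E w0 ^^ Suc j) \<sigma> = exec w0 (E ! pc ?\<sigma>) ?\<sigma>"
      using pc by (simp add: step_def)
    have "H w (sim (length E) (E ! pc ?\<sigma>)) R1 M1 (\<lambda>t R' M'. t \<le> 20 \<and>
        (erel d (length E) (2 ^ w0) a0 ((step E w0 ^^ Suc j) \<sigma>) R' M' \<and> eframe (2 ^ w0) a0 R1 M1 R' M'))"
      unfolding st using pc ins R j(3)
      by (intro sim_correct[OF j(2)] l w) (auto simp: eframe_def)
    from dispatch_correct[OF _ _ _ this, of 0] pc l
    have "H w (dispatch (length E) 0 E) R1 M1 (\<lambda>t R' M'. t \<le> 4 * length E + 20 \<and>
        erel d (length E) (2 ^ w0) a0 ((step E w0 ^^ Suc j) \<sigma>) R' M' \<and> eframe (2 ^ w0) a0 R1 M1 R' M')"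
      by simp
    then show "H w (dispatch (length E) 0 E) R1 M1 (\<lambda>t R' M'. \<exists>\<tau>'. ?I \<tau>' R' M' \<and>
        elen (Reg 20) + elen (Cst (length E)) + 2 + t + \<tau>' \<le> \<tau>)"
    proof (rule H_mono)
      fix t R2 M2
      assume *: "t \<le> 4 * length E + 20 \<and>
        erel d (length E) (2 ^ w0) a0 ((step E w0 ^^ Suc j) \<sigma>) R2 M2 \<and> eframe (2 ^ w0) a0 R1 M1 R2 M2"
      have "T - j = Suc (T - Suc j)" using \<open>j < T\<close> by simp
      then have "\<tau> = ?c + ((T - Suc j) * ?c + 4)" using j(4) by simp
      then have "elen (Reg 20) + elen (Cst (length E)) + 2 + t + ((T - Suc j) * ?c + 4) \<le> \<tau>"
        using * by simp
      then show "\<exists>\<tau>'. ?I \<tau>' R2 M2 \<and> elen (Reg 20) + elen (Cst (length E)) + 2 + t + \<tau>' \<le> \<tau>"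
        using * \<open>j < T\<close> eframe_trans[OF j(3)] by (intro exI[of _ "(T - Suc j) * ?c + 4"]) (auto intro!: exI[of _ "Suc j"])
    qed
  qed
  then show ?thesis
  proof (rule H_mono)
    fix t R' M'
    assume *: "t \<le> T * ?c + 4 \<and> (\<exists>\<tau>'. ?I \<tau>' R' M') \<and> \<not> ev (Reg 20) R' M' < ev (Cst (length E)) R' M'"
    then obtain j where j: "j \<le> T" "erel d (length E) (2 ^ w0) a0 ((step E w0 ^^ j) \<sigma>) R' M'"
      "eframe (2 ^ w0) a0 R M R' M'" by auto
    with * have "length E \<le> pc ((step E w0 ^^ j) \<sigma>)" by (auto simp: erel_def)
    from step_funpow_halted[OF this j(1)] j *
    show "t \<le> T * ?c + 4 \<and> erel d (length E) (2 ^ w0) a0 ((step E w0 ^^ T) \<sigma>) R' M' \<and>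
      eframe (2 ^ w0) a0 R M R' M'" by simp
  qed
qed

section \<open>A single run of the gate interpreter\<close>

text \<open>Unlike the memory regions, the registers of the interpreter are shared by all runs.
  There is only a constant number of them, so clearing them every time is cheap.\<close>

fun clear_regs :: "nat \<Rightarrow> com" where
  "clear_regs 0 = Skip"
| "clear_regs (Suc d) = clear_regs d ;; 30 + d ::= Cst 0"

lemma clear_regs_correct:
  "H w (clear_regs d) R M (\<lambda>t R' M'. t = 2 * d \<and> M' = M \<and> (\<forall>r<30. R' r = R r) \<and> (\<forall>r<d. R' (30 + r) = 0))"
proof (induction d)
  case (Suc d)
  show ?case unfolding clear_regs.simps
    by (rule H_Seq, rule H_mono[OF Suc], rule H_Assign) (auto simp: less_Suc_eq)
qed (auto intro: H_Skip)

text \<open>The gate is encoded at the address in register 8; bit \<open>v\<close> of register 16 is the value of variable \<open>v\<close>.\<close>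

definition load_gate :: com where
  "load_gate =
    Put (Reg 17) (Cell (Reg 8 \<oplus> Cst 1)) ;;
    18 ::= Cst 0 ;;
    WhileLess (Reg 18) (Cell (Reg 8 \<oplus> Cst 1))
     (Put (Reg 17 \<oplus> Cst 1 \<oplus> Reg 18) ((Reg 16 >>> Cell (Reg 8 \<oplus> Cst 3 \<oplus> Reg 18)) %% Cst 2) ;;
      18 ::= Reg 18 \<oplus> Cst 1) ;;
    18 ::= Cst 0 ;;
    WhileLess (Reg 18) (Cell (Reg 8 \<oplus> Cst 2))
     (Put (Reg 17 \<oplus> Cst 1 \<oplus> Cell (Reg 8 \<oplus> Cst 1) \<oplus> Reg 18)
          (Cell (Reg 8 \<oplus> Cst 3 \<oplus> Cell (Reg 8 \<oplus> Cst 1) \<oplus> Reg 18)) ;;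
      18 ::= Reg 18 \<oplus> Cst 1)"

definition gate_at :: "(nat \<Rightarrow> nat) \<Rightarrow> nat \<Rightarrow> gate \<Rightarrow> bool" where
  "gate_at M p g \<longleftrightarrow> M (p + 1) = length (gate_vars g) \<and> M (p + 2) = length (gate_code g) \<and>
     (\<forall>k<length (gate_vars g). M (p + 3 + k) = gate_vars g ! k) \<and>
     (\<forall>k<length (gate_code g). M (p + 3 + length (gate_vars g) + k) = of_bool (gate_code g ! k))"

definition gate_input :: "gate \<Rightarrow> nat \<Rightarrow> bool list" where
  "gate_input g z = map (bit z) (gate_vars g)"

lemma load_gate_correct:
  fixes g z
  defines "xs \<equiv> eval_input (gate_input g z) (gate_code g)"
  assumes g: "gate_at M p g" and R: "R 8 = p" "R 16 = z" "R 17 = a0"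
    and p: "p + 3 + length (gate_vars g) + length (gate_code g) \<le> a0"
    and w: "a0 + length xs < 2 ^ w" and M: "\<And>x. a0 \<le> x \<Longrightarrow> M x = 0"
  shows "H w load_gate R M
    (\<lambda>t R' M'. t \<le> 40 * (length (gate_vars g) + length (gate_code g)) + 40 \<and>
      (\<forall>x<a0. M' x = M x) \<and> (\<forall>a. M' (a0 + a) = (if a < length xs then xs ! a else 0)) \<and>
      (\<forall>r. r \<noteq> 18 \<longrightarrow> R' r = R r))"
proof -
  let ?v = "length (gate_vars g)" and ?k = "length (gate_code g)"
  \<comment> \<open>The first \<open>c + k\<close> cells of the interpreter's input are in place.
    The first copying loop starts with \<open>c = 1\<close>, after the header cell, the second with
    \<open>c = 1 + ?v\<close>, after the input values.\<close>
  define I where "I c k R' M' \<longleftrightarrow> R' 18 = k \<and> (\<forall>x<a0. M' x = M x) \<and>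
    (\<forall>a. M' (a0 + a) = (if a < c + k then xs ! a else 0)) \<and>
      (\<forall>r. r \<noteq> 18 \<longrightarrow> R' r = R r)" for c k :: nat and R' M' :: "nat \<Rightarrow> nat"
  have len: "length xs = 1 + ?v + ?k" by (simp add: xs_def eval_input_def gate_input_def)
  have xs0: "xs ! 0 = ?v" by (simp add: xs_def eval_input_def gate_input_def)
  have xs1: "xs ! (1 + k) = z div 2 ^ (gate_vars g ! k) mod 2" if "k < ?v" for k
    using that by (simp add: xs_def eval_input_def gate_input_def nth_append bit_iff_odd mod_2_eq_odd)
  have xs2: "xs ! (1 + ?v + k) = of_bool (gate_code g ! k)" if "k < ?k" for k
    using that by (simp add: xs_def eval_input_def gate_input_def nth_append)
  have small: "p + 3 + ?v + ?k + 1 < 2 ^ w" "a0 + 1 + ?v + ?k < 2 ^ w" "1 < (2::nat) ^ w" "2 < (2::nat) ^ w"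
    using p w len by auto
  note g' = g[unfolded gate_at_def]
  have same: "M' x = M x" if "I c k R' M'" "x < a0" for c k R' M' x using that by (auto simp: I_def)
  have gat: "M' (Suc p) = ?v" "M' (Suc (Suc p)) = ?k" if "I c k R' M'" for c k R' M'
    using same[OF that, of "p + 1"] same[OF that, of "p + 2"] g' p by auto
  have v: "M' (p + 3 + k') = gate_vars g ! k'" if "I c k R' M'" "k' < ?v" for c k R' M' k'
    using same[OF that(1), of "p + 3 + k'"] g' p that(2) by auto
  have c: "M' (p + 3 + ?v + k') = of_bool (gate_code g ! k')" if "I c k R' M'" "k' < ?k" for c k R' M' k'
    using same[OF that(1), of "p + 3 + ?v + k'"] g' p that(2) by auto
  have loop1: "H w (WhileLess (Reg 18) (Cell (Reg 8 \<oplus> Cst 1))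
     (Put (Reg 17 \<oplus> Cst 1 \<oplus> Reg 18) ((Reg 16 >>> Cell (Reg 8 \<oplus> Cst 3 \<oplus> Reg 18)) %% Cst 2) ;;
      18 ::= Reg 18 \<oplus> Cst 1)) R1 M1
     (\<lambda>t R' M'. t \<le> (?v - 0) * (20 + elen (Cell (Reg 8 \<oplus> Cst 1)) + 3) + elen (Cell (Reg 8 \<oplus> Cst 1)) + 3 \<and>
        R' 18 = ?v \<and> I 1 ?v R' M')" if "I 1 0 R1 M1" for R1 M1
  proof (rule H_for[where I = "I 1"])
    show "I 1 0 R1 M1" by fact
    show "R1 18 = 0" using that by (simp add: I_def)
    show "ok w (Cell (Reg 8 \<oplus> Cst 1)) R' M' \<and> ev (Cell (Reg 8 \<oplus> Cst 1)) R' M' = ?v"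
      if "I 1 k R' M'" for k R' M'
      using gat[OF that] that small R by (auto simp: I_def)
    show "H w (Put (Reg 17 \<oplus> Cst 1 \<oplus> Reg 18) ((Reg 16 >>> Cell (Reg 8 \<oplus> Cst 3 \<oplus> Reg 18)) %% Cst 2) ;;
      18 ::= Reg 18 \<oplus> Cst 1) R2 M2 (\<lambda>t R' M'. t \<le> 20 \<and> R' 18 = Suc k \<and> I 1 (Suc k) R' M')"
      if I: "I 1 k R2 M2" and "R2 18 = k" "k < ?v" for k R2 M2
    proof -
      have "R2 8 = p" "R2 16 = z" "R2 17 = a0" using I R by (auto simp: I_def)
      then show ?thesis
        apply (intro H_Seq H_Put H_Assign)
        using small that v[OF I, of k] xs1[of k] p
        by (auto simp: I_def add.assoc)
    qed
  qed auto
  have loop2: "H w (WhileLess (Reg 18) (Cell (Reg 8 \<oplus> Cst 2))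
     (Put (Reg 17 \<oplus> Cst 1 \<oplus> Cell (Reg 8 \<oplus> Cst 1) \<oplus> Reg 18)
          (Cell (Reg 8 \<oplus> Cst 3 \<oplus> Cell (Reg 8 \<oplus> Cst 1) \<oplus> Reg 18)) ;;
      18 ::= Reg 18 \<oplus> Cst 1)) R1 M1
     (\<lambda>t R' M'. t \<le> (?k - 0) * (30 + elen (Cell (Reg 8 \<oplus> Cst 2)) + 3) + elen (Cell (Reg 8 \<oplus> Cst 2)) + 3 \<and>
        R' 18 = ?k \<and> I (1 + ?v) ?k R' M')" if "I (1 + ?v) 0 R1 M1" for R1 M1
  proof (rule H_for[where I = "I (1 + ?v)"])
    show "I (1 + ?v) 0 R1 M1" by fact
    show "R1 18 = 0" using that by (simp add: I_def)
    show "ok w (Cell (Reg 8 \<oplus> Cst 2)) R' M' \<and> ev (Cell (Reg 8 \<oplus> Cst 2)) R' M' = ?k"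
      if "I (1 + ?v) k R' M'" for k R' M'
      using gat[OF that] that small R by (auto simp: I_def)
    show "H w (Put (Reg 17 \<oplus> Cst 1 \<oplus> Cell (Reg 8 \<oplus> Cst 1) \<oplus> Reg 18)
          (Cell (Reg 8 \<oplus> Cst 3 \<oplus> Cell (Reg 8 \<oplus> Cst 1) \<oplus> Reg 18)) ;;
      18 ::= Reg 18 \<oplus> Cst 1) R2 M2 (\<lambda>t R' M'. t \<le> 30 \<and> R' 18 = Suc k \<and> I (1 + ?v) (Suc k) R' M')"
      if I: "I (1 + ?v) k R2 M2" and "R2 18 = k" "k < ?k" for k R2 M2
    proof -
      have "R2 8 = p" "R2 16 = z" "R2 17 = a0" using I R by (auto simp: I_def)
      then show ?thesis
        apply (intro H_Seq H_Put H_Assign)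
        using small that c[OF I, of k] gat[OF I] xs2[of k] p
        by (auto simp: I_def add.assoc)
    qed
  qed auto
  have p1: "M (Suc p) = ?v" using g' by simp
  have "H w load_gate R M (\<lambda>t R' M'. t \<le> 40 * (?v + ?k) + 40 \<and> I (1 + ?v) ?k R' M')"
    unfolding load_gate_def
    apply (rule H_Seq, rule H_Put)
    subgoal by simp
    subgoal using small R by simp
    apply (rule H_Seq, rule H_Assign)
    subgoal using small by simp
    apply (rule H_Seq, rule H_mono[OF loop1])
    subgoal using R M p1 xs0 by (auto simp: I_def)
    apply (rule H_Seq, rule H_Assign)
    subgoal using small by simp
    apply (rule H_mono[OF loop2])
    subgoal by (auto simp: I_def)
    subgoal by auto
    done
  then show ?thesis
    by (rule H_mono) (auto simp: I_def len)
qed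

text \<open>Together with a zero region these commands establish \<open>init_state\<close>: register
  30 stands for register 0 of the interpreter, which has to contain the input length.\<close>

definition eval_gate :: "program \<Rightarrow> nat \<Rightarrow> com" where
  "eval_gate E d = load_gate ;; clear_regs d ;;
     30 ::= Cst 1 \<oplus> Cell (Reg 8 \<oplus> Cst 1) \<oplus> Cell (Reg 8 \<oplus> Cst 2) ;; 20 ::= Cst 0 ;; interp E"

lemma eval_gate_correct:
  assumes g: "gate_at M p g" and R: "R 8 = p" "R 16 = z" "R 17 = a0" "R 5 = 2 ^ w0" "R 6 = w0"
    and p: "p + 3 + length (gate_vars g) + length (gate_code g) \<le> a0"
    and M: "\<And>x. a0 \<le> x \<Longrightarrow> M x = 0"
    and E: "computes_within E w0 (eval_input (gate_input g z) (gate_code g)) T b"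
      "length (gate_vars g) + length (gate_code g) \<le> T"
    and l: "length E < 2 ^ w" "\<forall>ins\<in>set E. instr_within d (2 ^ w) ins" "0 < d"
    and w: "2 ^ w0 * 2 ^ w0 \<le> (2::nat) ^ w" "a0 + 2 ^ w0 \<le> 2 ^ w"
  shows "H w (eval_gate E d) R M
    (\<lambda>t R' M'. t \<le> (T + 1) * (4 * length E + 2 * d + 200) \<and>
      (\<forall>x. x < a0 \<or> a0 + 2 ^ w0 \<le> x \<longrightarrow> M' x = M x) \<and> R' 30 = of_bool b \<and>
      (\<forall>r<30. r \<noteq> 18 \<and> r \<noteq> 20 \<longrightarrow> R' r = R r))"
proof -
  define xs where "xs = eval_input (gate_input g z) (gate_code g)"
  let ?v = "length (gate_vars g)" and ?k = "length (gate_code g)"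
  let ?B = "2 ^ w0 :: nat"
  have len: "length xs = 1 + ?v + ?k" by (simp add: xs_def eval_input_def gate_input_def)
  have x: "length xs < ?B" "\<forall>x\<in>set xs. x < ?B" and halt: "length E \<le> pc ((step E w0 ^^ T) (init_state xs))"
    and res: "regs ((step E w0 ^^ T) (init_state xs)) 0 = of_bool b"
    using E by (auto simp: computes_within_def Let_def xs_def)
  \<comment> \<open>The input has length at least 1, and its length is a word of the interpreter, so
    there are at least two words.\<close>
  have B: "2 \<le> ?B" using x len by simp
  have small: "p + 3 + ?v + ?k + 1 < 2 ^ w" "a0 + 1 + ?v + ?k < 2 ^ w"
    using p w x len by auto
  have "0 < length xs" using len by simp
  have rel: "erel d (length E) ?B a0 (init_state xs) R1 M1"
    if "\<And>a. M1 (a0 + a) = (if a < length xs then xs ! a else 0)" "\<And>r. r < d \<Longrightarrow> R1 (30 + r) = (if r = 0 then length xs else 0)"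
      "R1 20 = 0" for R1 M1
    using that x B by (auto simp: erel_def init_state_def)
  have ld: "H w load_gate R M
    (\<lambda>t R' M'. t \<le> 40 * (?v + ?k) + 40 \<and>
      (\<forall>x<a0. M' x = M x) \<and> (\<forall>a. M' (a0 + a) = (if a < length xs then xs ! a else 0)) \<and>
      (\<forall>r. r \<noteq> 18 \<longrightarrow> R' r = R r))"
    unfolding xs_def using x w by (intro load_gate_correct[OF g R(1-3) p _ M]) (auto simp: xs_def)
  show ?thesis
    unfolding eval_gate_def
  proof (rule H_Seq, rule H_mono[OF ld], elim conjE, rule H_Seq, rule H_mono[OF clear_regs_correct], elim conjE)
    fix t1 R1 M1 t2 R2 M2
    assume 1: "t1 \<le> 40 * (?v + ?k) + 40" "\<forall>x<a0. M1 x = M x"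
      "\<forall>a. M1 (a0 + a) = (if a < length xs then xs ! a else 0)" "\<forall>r. r \<noteq> 18 \<longrightarrow> R1 r = R r"
    assume 2: "t2 = 2 * d" "M2 = M1" "\<forall>r<30. R2 r = R1 r" "\<forall>r<d. R2 (30 + r) = 0"
    have p12: "M1 (Suc p) = ?v" "M1 (Suc (Suc p)) = ?k"
      using 1(2)[rule_format, of "p + 1"] 1(2)[rule_format, of "p + 2"] g p by (auto simp: gate_at_def)
    have R2: "R2 8 = p" "R2 17 = a0" "R2 5 = ?B" "R2 6 = w0" using 1 2 R by auto
    define R3 where "R3 = R2(30 := length xs, 20 := 0)"
    have 3: "H w (interp E) R3 M1 (\<lambda>t R' M'. t \<le> T * (4 * length E + 24) + 4 \<and>
        erel d (length E) ?B a0 ((step E w0 ^^ T) (init_state xs)) R' M' \<and> eframe ?B a0 R3 M1 R' M')"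
    proof (rule interp_correct)
      show "erel d (length E) (2 ^ w0) a0 (init_state xs) R3 M1"
        using 1 2 l by (intro rel) (auto simp: R3_def)
    qed (use R2 halt l w B in \<open>auto simp: R3_def\<close>)
    have T: "40 * (?v + ?k) \<le> 40 * T" using E(2) by simp
    have fin: "t1 + (t2 + (elen (Cst 1 \<oplus> Cell (Reg 8 \<oplus> Cst 1) \<oplus> Cell (Reg 8 \<oplus> Cst 2)) + 1 + (elen (Cst 0) + 1 + t3)))
          \<le> (T + 1) * (4 * length E + 2 * d + 200) \<and>
      (\<forall>x. x < a0 \<or> a0 + 2 ^ w0 \<le> x \<longrightarrow> M' x = M x) \<and> R' 30 = of_bool b \<and>
      (\<forall>r<30. r \<noteq> 18 \<and> r \<noteq> 20 \<longrightarrow> R' r = R r)"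
      if t3: "t3 \<le> T * (4 * length E + 24) + 4"
       "erel d (length E) ?B a0 ((step E w0 ^^ T) (init_state xs)) R' M'" "eframe ?B a0 R3 M1 R' M'" for t3 R' M'
    proof (intro conjI)
      have "t1 + (t2 + (12 + (2 + t3))) \<le> 40 * T + 40 + (2 * d + (12 + (2 + (T * (4 * length E + 24) + 4))))"
        using 1(1) 2(1) T t3(1) by linarith
      also have "\<dots> \<le> (T + 1) * (4 * length E + 2 * d + 200)"
        by (simp add: algebra_simps)
      finally show "t1 + (t2 + (elen (Cst 1 \<oplus> Cell (Reg 8 \<oplus> Cst 1) \<oplus> Cell (Reg 8 \<oplus> Cst 2)) + 1 + (elen (Cst 0) + 1 + t3)))
          \<le> (T + 1) * (4 * length E + 2 * d + 200)" by simp
      show "\<forall>x. x < a0 \<or> a0 + 2 ^ w0 \<le> x \<longrightarrow> M' x = M x"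
      proof (intro allI impI)
        fix y assume y: "y < a0 \<or> a0 + 2 ^ w0 \<le> y"
        then have "M' y = M1 y" using t3(3) by (auto simp: eframe_def)
        also have "\<dots> = M y"
        proof (cases "y < a0")
          case False
          with y have "y = a0 + (y - a0)" "length xs \<le> y - a0" using x(1) by auto
          then have "M1 y = 0" using 1(3) by (metis not_less)
          then show ?thesis using M[of y] False by simp
        qed (use 1(2) in simp)
        finally show "M' y = M y" .
      qed
      show "R' 30 = of_bool b"
        using t3(2) l(3) res unfolding erel_def by (metis add.right_neutral)
      show "\<forall>r<30. r \<noteq> 18 \<and> r \<noteq> 20 \<longrightarrow> R' r = R r"
        using t3(3) 1(4) 2(3) by (auto simp: eframe_def R3_def)
    qed
    show "H w (30 ::= Cst 1 \<oplus> Cell (Reg 8 \<oplus> Cst 1) \<oplus> Cell (Reg 8 \<oplus> Cst 2) ;; 20 ::= Cst 0 ;; interp E) R2 M2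
       (\<lambda>t R' M'. t1 + (t2 + t) \<le> (T + 1) * (4 * length E + 2 * d + 200) \<and>
      (\<forall>x. x < a0 \<or> a0 + 2 ^ w0 \<le> x \<longrightarrow> M' x = M x) \<and> R' 30 = of_bool b \<and>
      (\<forall>r<30. r \<noteq> 18 \<and> r \<noteq> 20 \<longrightarrow> R' r = R r))"
    proof (rule H_Seq, rule H_Assign)
      show "ok w (Cst 1 \<oplus> Cell (Reg 8 \<oplus> Cst 1) \<oplus> Cell (Reg 8 \<oplus> Cst 2)) R2 M2"
        using small R2 p12 2(2) by auto
      have "ev (Cst 1 \<oplus> Cell (Reg 8 \<oplus> Cst 1) \<oplus> Cell (Reg 8 \<oplus> Cst 2)) R2 M2 = length xs"
        using R2 p12 2(2) len by simp
      then have R3: "(R2(30 := ev (Cst 1 \<oplus> Cell (Reg 8 \<oplus> Cst 1) \<oplus> Cell (Reg 8 \<oplus> Cst 2)) R2 M2))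
          (20 := ev (Cst 0) R4 M4) = R3" for R4 M4
        unfolding R3_def by simp
      show "H w (20 ::= Cst 0 ;; interp E)
        (R2(30 := ev (Cst 1 \<oplus> Cell (Reg 8 \<oplus> Cst 1) \<oplus> Cell (Reg 8 \<oplus> Cst 2)) R2 M2)) M2
       (\<lambda>t R' M'. t1 + (t2 + (elen (Cst 1 \<oplus> Cell (Reg 8 \<oplus> Cst 1) \<oplus> Cell (Reg 8 \<oplus> Cst 2)) + 1 + t))
         \<le> (T + 1) * (4 * length E + 2 * d + 200) \<and>
      (\<forall>x. x < a0 \<or> a0 + 2 ^ w0 \<le> x \<longrightarrow> M' x = M x) \<and> R' 30 = of_bool b \<and>
      (\<forall>r<30. r \<noteq> 18 \<and> r \<noteq> 20 \<longrightarrow> R' r = R r))"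
      proof (rule H_Seq, rule H_Assign)
        show "H w (interp E) ((R2(30 := ev (Cst 1 \<oplus> Cell (Reg 8 \<oplus> Cst 1) \<oplus> Cell (Reg 8 \<oplus> Cst 2)) R2 M2))
          (20 := ev (Cst 0) (R2(30 := ev (Cst 1 \<oplus> Cell (Reg 8 \<oplus> Cst 1) \<oplus> Cell (Reg 8 \<oplus> Cst 2)) R2 M2)) M2)) M2
         (\<lambda>t R' M'. t1 + (t2 + (elen (Cst 1 \<oplus> Cell (Reg 8 \<oplus> Cst 1) \<oplus> Cell (Reg 8 \<oplus> Cst 2)) + 1 +
            (elen (Cst 0) + 1 + t)))
         \<le> (T + 1) * (4 * length E + 2 * d + 200) \<and>
          (\<forall>x. x < a0 \<or> a0 + 2 ^ w0 \<le> x \<longrightarrow> M' x = M x) \<and> R' 30 = of_bool b \<and>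
          (\<forall>r<30. r \<noteq> 18 \<and> r \<noteq> 20 \<longrightarrow> R' r = R r))"
          unfolding R3 unfolding 2(2) by (rule H_mono[OF 3]) (rule fin; simp)
      qed simp
    qed
  qed
qed

section \<open>Formulas in prefix notation with binary connectives\<close>

datatype tok = TGate gate | TAnd | TOr

fun tok_code :: "tok \<Rightarrow> nat" where
  "tok_code (TGate g) = 0"
| "tok_code TAnd = 1"
| "tok_code TOr = 2"

text \<open>A gate of fan-in \<open>k\<close> becomes \<open>k - 1\<close> binary connectives in
  front of its arguments.\<close>

fun toks :: "formula \<Rightarrow> tok list" where
  "toks (First g) = [TGate g]"
| "toks (Conj Fs) = replicate (length Fs - 1) TAnd @ concat (map toks Fs)"
| "toks (Disj Fs) = replicate (length Fs - 1) TOr @ concat (map toks Fs)"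

definition gval :: "gate \<Rightarrow> nat \<Rightarrow> bool" where
  "gval g z = gate_fun g (gate_input g z)"

text \<open>The recursion on the tail makes this a stack machine that reads prefix notation from
  right to left; the head of the result is the top of the stack. The fallback branches for short
  stacks do not occur on token lists that satisfy \<open>wf_toks\<close>.\<close>

fun run_toks :: "nat \<Rightarrow> tok list \<Rightarrow> bool list" where
  "run_toks z [] = []"
| "run_toks z (TGate g # ts) = gval g z # run_toks z ts"
| "run_toks z (TAnd # ts) = (case run_toks z ts of a # b # st \<Rightarrow> (a \<and> b) # st | st \<Rightarrow> st)"
| "run_toks z (TOr # ts) = (case run_toks z ts of a # b # st \<Rightarrow> (a \<or> b) # st | st \<Rightarrow> st)"

text \<open>The connective adjacent to \<open>ts\<close> acts first and merges the two topmost
  values, which leaves one connective and one value fewer.\<close>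

lemma run_toks_replicate_TAnd:
  "length vs = Suc k \<Longrightarrow> run_toks z ts = vs @ st \<Longrightarrow>
    run_toks z (replicate k TAnd @ ts) = (\<forall>v\<in>set vs. v) # st"
proof (induction k arbitrary: vs ts)
  case 0
  then show ?case by (cases vs) auto
next
  case (Suc k)
  then obtain a b us where vs: "vs = a # b # us" by (cases vs; cases "tl vs") auto
  have "run_toks z (replicate k TAnd @ TAnd # ts) = (\<forall>v\<in>set ((a \<and> b) # us). v) # st"
    using Suc.prems vs by (intro Suc.IH) auto
  then show ?case using vs by (simp add: replicate_app_Cons_same)
qed

lemma run_toks_replicate_TOr:
  "length vs = Suc k \<Longrightarrow> run_toks z ts = vs @ st \<Longrightarrow>
    run_toks z (replicate k TOr @ ts) = (\<exists>v\<in>set vs. v) # st"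
proof (induction k arbitrary: vs ts)
  case 0
  then show ?case by (cases vs) auto
next
  case (Suc k)
  then obtain a b us where vs: "vs = a # b # us" by (cases vs; cases "tl vs") auto
  have "run_toks z (replicate k TOr @ TOr # ts) = (\<exists>v\<in>set ((a \<or> b) # us). v) # st"
    using Suc.prems vs by (intro Suc.IH) auto
  then show ?case using vs by (simp add: replicate_app_Cons_same)
qed

text \<open>The stack height does not mention the assignment: this is what lets many evaluations
  share the same stack addresses.\<close>

fun height :: "tok list \<Rightarrow> nat" where
  "height [] = 0"
| "height (TGate g # ts) = Suc (height ts)"
| "height (TAnd # ts) = height ts - 1"
| "height (TOr # ts) = height ts - 1"

fun wf_toks :: "tok list \<Rightarrow> bool" where
  "wf_toks [] \<longleftrightarrow> True"
| "wf_toks (TGate g # ts) \<longleftrightarrow> wf_toks ts"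
| "wf_toks (TAnd # ts) \<longleftrightarrow> wf_toks ts \<and> 2 \<le> height ts"
| "wf_toks (TOr # ts) \<longleftrightarrow> wf_toks ts \<and> 2 \<le> height ts"

lemma length_run_toks: "wf_toks ts \<Longrightarrow> length (run_toks z ts) = height ts"
  by (induction ts rule: height.induct) (auto split: list.splits)

lemma height_le_length: "height ts \<le> length ts"
  by (induction ts rule: height.induct) auto

lemma wf_toks_drop: "wf_toks ts \<Longrightarrow> wf_toks (drop k ts)"
proof (induction ts arbitrary: k rule: height.induct)
qed (auto simp: drop_Cons split: nat.splits)

lemma wf_toks_replicate:
  "wf_toks ts \<Longrightarrow> k < height ts \<Longrightarrow> t = TAnd \<or> t = TOr \<Longrightarrow>
    wf_toks (replicate k t @ ts) \<and> height (replicate k t @ ts) = height ts - k"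
  by (induction k) auto

lemma wf_toks_concat:
  assumes "\<And>F ts. F \<in> set Fs \<Longrightarrow> wf_toks ts \<Longrightarrow> wf_toks (toks F @ ts) \<and> height (toks F @ ts) = Suc (height ts)"
    and "wf_toks ts"
  shows "wf_toks (concat (map toks Fs) @ ts) \<and> height (concat (map toks Fs) @ ts) = length Fs + height ts"
  using assms by (induction Fs) auto

lemma wf_toks_toks:
  "F1 E e T n F \<Longrightarrow> wf_toks ts \<Longrightarrow> wf_toks (toks F @ ts) \<and> height (toks F @ ts) = Suc (height ts)"
proof (induction F arbitrary: ts)
  case (Conj Fs)
  have *: "wf_toks (concat (map toks Fs) @ ts) \<and> height (concat (map toks Fs) @ ts) = length Fs + height ts"
    using Conj by (intro wf_toks_concat) auto
  then show ?case
    using wf_toks_replicate[of "concat (map toks Fs) @ ts" "length Fs - 1" TAnd] Conj.prems by auto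
next
  case (Disj Fs)
  have *: "wf_toks (concat (map toks Fs) @ ts) \<and> height (concat (map toks Fs) @ ts) = length Fs + height ts"
    using Disj by (intro wf_toks_concat) auto
  then show ?case
    using wf_toks_replicate[of "concat (map toks Fs) @ ts" "length Fs - 1" TOr] Disj.prems by auto
qed auto

lemma run_toks_concat:
  assumes "\<And>F ts. F \<in> set Fs \<Longrightarrow> run_toks z (toks F @ ts) = f F # run_toks z ts"
  shows "run_toks z (concat (map toks Fs) @ ts) = map f Fs @ run_toks z ts"
  using assms by (induction Fs) auto

definition assignment :: "nat \<Rightarrow> nat \<Rightarrow> bool list" where
  "assignment n z = map (bit z) [0..<n]"

lemma run_toks_toks:
  "F1 E e T n F \<Longrightarrow> 0 < n \<Longrightarrow> run_toks z (toks F @ ts) = eval (assignment n z) F # run_toks z ts"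
proof (induction F arbitrary: ts)
  case (First g)
  then have "v < n" if "v \<in> set (gate_vars g)" for v using that by auto
  then have "map (\<lambda>i. assignment n z ! i) (gate_vars g) = gate_input g z"
    by (auto simp: assignment_def gate_input_def)
  then show ?case by (simp add: gval_def)
next
  case (Conj Fs)
  have "run_toks z (concat (map toks Fs) @ ts) = map (eval (assignment n z)) Fs @ run_toks z ts"
    using Conj by (intro run_toks_concat) auto
  then show ?case
    using run_toks_replicate_TAnd[of "map (eval (assignment n z)) Fs" "length Fs - 1" z] Conj.prems by auto
next
  case (Disj Fs)
  have "run_toks z (concat (map toks Fs) @ ts) = map (eval (assignment n z)) Fs @ run_toks z ts"
    using Disj by (intro run_toks_concat) auto
  then show ?case
    using run_toks_replicate_TOr[of "map (eval (assignment n z)) Fs" "length Fs - 1" z] Disj.prems by auto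
qed

lemma sum_list_Suc_length:
  "(\<And>x. x \<in> set xs \<Longrightarrow> Suc (f x) = 2 * (g x :: nat)) \<Longrightarrow>
    (\<Sum>x\<leftarrow>xs. f x) + length xs = 2 * (\<Sum>x\<leftarrow>xs. g x)"
  by (induction xs) force+

text \<open>Each of \<open>k\<close> arguments has twice its size minus one tokens, and the
  \<open>k - 1\<close> connectives compensate all but one of the missing units. The number of
  operations per batch is thereby linear in the size.\<close>

lemma length_toks: "F1 E e T n F \<Longrightarrow> Suc (length (toks F)) = 2 * formula_size F"
proof (induction F)
  case (Conj Fs)
  have "(\<Sum>F\<leftarrow>Fs. length (toks F)) + length Fs = 2 * (\<Sum>F\<leftarrow>Fs. formula_size F)"
    using Conj by (intro sum_list_Suc_length) auto
  then show ?case using Conj.prems by (simp add: length_concat comp_def) arith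
next
  case (Disj Fs)
  have "(\<Sum>F\<leftarrow>Fs. length (toks F)) + length Fs = 2 * (\<Sum>F\<leftarrow>Fs. formula_size F)"
    using Disj by (intro sum_list_Suc_length) auto
  then show ?case using Disj.prems by (simp add: length_concat comp_def) arith
qed auto

lemma sum_list_scaled_le:
  fixes f g :: "'a \<Rightarrow> nat"
  shows "(\<And>x. x \<in> set xs \<Longrightarrow> c * f x \<le> g x) \<Longrightarrow> c * (\<Sum>x\<leftarrow>xs. f x) \<le> (\<Sum>x\<leftarrow>xs. g x)"
  by (induction xs) (auto simp: algebra_simps intro: add_mono)

text \<open>Every first-layer gate has three header cells. With \<open>length_toks\<close> this
  makes the input length an upper bound for the number of tokens, so memory areas can be dimensioned
  before the formula is read.\<close>

lemma length_encode_ge: "3 * formula_size F \<le> length (encode F)"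
proof (induction F)
  case (Conj Fs)
  then have "3 * (\<Sum>F\<leftarrow>Fs. formula_size F) \<le> (\<Sum>F\<leftarrow>Fs. length (encode F))"
    by (intro sum_list_scaled_le) auto
  then show ?case by (simp add: length_concat comp_def)
next
  case (Disj Fs)
  then have "3 * (\<Sum>F\<leftarrow>Fs. formula_size F) \<le> (\<Sum>F\<leftarrow>Fs. length (encode F))"
    by (intro sum_list_scaled_le) auto
  then show ?case by (simp add: length_concat comp_def)
qed auto

lemma sum_list_add_length_le:
  fixes f g :: "'a \<Rightarrow> nat"
  shows "(\<And>x. x \<in> set xs \<Longrightarrow> f x + 2 \<le> c * g x) \<Longrightarrow> (\<Sum>x\<leftarrow>xs. f x) + 2 * length xs \<le> c * (\<Sum>x\<leftarrow>xs. g x)"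
  by (induction xs) (auto simp: algebra_simps, force)

text \<open>The slack 2 carries the induction: \<open>k\<close> arguments supply
  \<open>2 * k \<ge> 4\<close> units, two pay for the header of the gate and two remain. Fan-in at
  least 2 is essential here.\<close>

lemma length_encode_le: "F1 E e T n F \<Longrightarrow> length (encode F) + 2 \<le> (T n + 5) * formula_size F"
proof (induction F)
  case (First g)
  then show ?case by (auto simp: evaluable_def)
next
  case (Conj Fs)
  have "(\<Sum>F\<leftarrow>Fs. length (encode F)) + 2 * length Fs \<le> (T n + 5) * (\<Sum>F\<leftarrow>Fs. formula_size F)"
    using Conj by (intro sum_list_add_length_le) auto
  then show ?case using Conj.prems by (simp add: length_concat comp_def)
next
  case (Disj Fs)
  have "(\<Sum>F\<leftarrow>Fs. length (encode F)) + 2 * length Fs \<le> (T n + 5) * (\<Sum>F\<leftarrow>Fs. formula_size F)"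
    using Disj by (intro sum_list_add_length_le) auto
  then show ?case using Disj.prems by (simp add: length_concat comp_def)
qed

lemma formula_size_pos: "F1 E e T n F \<Longrightarrow> 0 < formula_size F"
  using length_toks[of E e T n F] by auto

section \<open>Assignments as numbers, split at bit \<open>h\<close>\<close>

lemma bit_add_mult_pow2:
  assumes "a < 2 ^ h"
  shows "bit (a + b * 2 ^ h :: nat) v \<longleftrightarrow> (if v < h then bit a v else bit b (v - h))"
proof -
  have "take_bit h (a + b * 2 ^ h) = a" using assms by (simp add: take_bit_eq_mod)
  then have 1: "bit a v \<longleftrightarrow> v < h \<and> bit (a + b * 2 ^ h) v" by (metis bit_take_bit_iff)
  have "drop_bit h (a + b * 2 ^ h) = b" using assms by (simp add: drop_bit_eq_div)
  then have 2: "bit b m \<longleftrightarrow> bit (a + b * 2 ^ h) (h + m)" for m by (metis bit_drop_bit_eq comp_apply)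
  show ?thesis using 1 2[of "v - h"] by auto
qed

lemma bit_mult_pow2: "bit (b * 2 ^ h :: nat) v \<longleftrightarrow> h \<le> v \<and> bit b (v - h)"
  using bit_add_mult_pow2[of 0 h b v] by auto

lemma gval_cong: "(\<And>v. v \<in> set (gate_vars g) \<Longrightarrow> bit z v = bit z' v) \<Longrightarrow> gval g z = gval g z'"
  unfolding gval_def gate_input_def by (auto intro!: arg_cong[where f = "gate_fun g"])

lemma gval_first_half: "set (gate_vars g) \<subseteq> {0..<h} \<Longrightarrow> a < 2 ^ h \<Longrightarrow> gval g (a + b * 2 ^ h) = gval g a"
  by (rule gval_cong) (auto simp: bit_add_mult_pow2)

text \<open>There is no bound on \<open>b\<close>: bits from position \<open>n\<close> on are not
  read by the gate, so the formula also covers the overlong last block.\<close>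

lemma gval_second_half: "set (gate_vars g) \<subseteq> {h..<n} \<Longrightarrow> a < 2 ^ h \<Longrightarrow> gval g (a + b * 2 ^ h) = gval g (b * 2 ^ h)"
  by (rule gval_cong) (auto simp: bit_add_mult_pow2 bit_mult_pow2)

section \<open>Gate tables\<close>

text \<open>For the first half of the variables, entry \<open>a\<close> is the value of the
  gate repeated \<open>n\<close> times; for the second half, entry \<open>j\<close> packs the values at
  \<open>j * n, \<dots>, j * n + n - 1\<close>. Both cases are the same loop with different contents of the registers 10 to 14.\<close>

definition fill_table :: "program \<Rightarrow> nat \<Rightarrow> com" where
  "fill_table E d =
   15 ::= Cst 0 ;;
   WhileLess (Reg 15) (Reg 11)
    (16 ::= Reg 15 \<otimes> Reg 12 ;;
     17 ::= Cst 5 \<otimes> Reg 4 \<oplus> (Reg 9 \<otimes> Reg 3 \<oplus> Reg 15) \<otimes> Reg 5 ;;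
     eval_gate E d ;;
     19 ::= Reg 10 \<oplus> Reg 15 \<oslash> Reg 13 ;;
     Put (Reg 19) (Cell (Reg 19) ||| (Reg 30 \<otimes> Reg 14 <<< Reg 15 %% Reg 13)) ;;
     15 ::= Reg 15 \<oplus> Cst 1)"

text \<open>Word sizes above a constant multiple of \<open>log (2 ^ n * s)\<close> satisfy the assumption \<open>big\<close>.\<close>

locale sat_instance =
  fixes E :: program and e :: nat and T :: "nat \<Rightarrow> nat" and n w d :: nat and F :: formula
  assumes n: "0 < n" and F1: "F1 E e T n F"
    and d: "0 < d" and E_len: "length E < 2 ^ w" and E_ins: "\<forall>ins\<in>set E. instr_within d (2 ^ w) ins"
    and big: "8 * (length (sat_input n F) * 2 ^ (n + 1)) * (2 ^ (e * n)) \<le> (2::nat) ^ w"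
      "(2::nat) ^ (e * n) * 2 ^ (e * n) \<le> 2 ^ w" "(2::nat) ^ (n + 1) * 2 ^ (n + 1) \<le> 2 ^ w"
begin

abbreviation "inp \<equiv> sat_input n F"
definition "L = length inp"
definition "h = n div 2"
text \<open>An upper bound for the number of entries tabulated per token. The second half needs the
  most, at most \<open>2 ^ (n - h) + n\<close>, and both summands are at most
  \<open>2 ^ n\<close>.\<close>

definition "S = (2::nat) ^ (n + 1)"
definition "K = L * S"
definition "B = (2::nat) ^ (e * n)"
definition "J = 2 ^ (n - h) div n + 1"

lemma B_pos: "1 \<le> B" by (simp add: B_def)
lemma S_ge: "4 \<le> S" using n power_increasing[of 2 "n + 1" "2::nat"] by (simp add: S_def)
lemma L_ge: "length (toks F) < L" "4 \<le> L"
proof -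
  have "L = length (encode F) + 1" by (simp add: L_def sat_input_def)
  with length_encode_ge[of F] length_toks[OF F1] formula_size_pos[OF F1]
  show "length (toks F) < L" "4 \<le> L" by linarith+
qed
lemma K_ge: "16 \<le> K" "L \<le> K" "4 * L \<le> K" using mult_le_mono[OF L_ge(2) S_ge] mult_le_mono2[OF S_ge, of L] by (auto simp: K_def)
lemma big': "8 * K * B \<le> 2 ^ w" "B * B \<le> 2 ^ w" "S * S \<le> 2 ^ w" "8 * K \<le> 2 ^ w"
proof -
  show *: "8 * K * B \<le> 2 ^ w" "B * B \<le> 2 ^ w" "S * S \<le> 2 ^ w"
    using big by (auto simp: K_def B_def S_def L_def mult_ac)
  show "8 * K \<le> 2 ^ w" using *(1) B_pos mult_le_mono2[OF B_pos, of "8 * K"] by linarith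
qed

lemma idx_less: "i * S + x < K" if "i < L" "x < S"
proof -
  have "i * S + x < Suc i * S" using that by simp
  also have "\<dots> \<le> L * S" using that by (intro mult_le_mono1) auto
  finally show ?thesis by (simp add: K_def)
qed

text \<open>A pair of token and table index is numbered by \<open>i * S + x < K\<close>, so
  \<open>K\<close> regions of \<open>B\<close> words suffice. All memory then ends at
  \<open>5 * K + K * B\<close>, within the \<open>8 * K * B\<close> addresses that the word size
  guarantees.\<close>

lemma mem_less: "5 * K + x * B + B \<le> 2 ^ w" if "x < K"
proof -
  have "x * B + B = Suc x * B" by simp
  also have "\<dots> \<le> K * B" using that by (intro mult_le_mono1) auto
  finally have "5 * K + x * B + B \<le> 5 * K + K * B" by simp
  also have "\<dots> \<le> 5 * (K * B) + K * B" using B_pos by simp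
  also have "\<dots> \<le> 8 * K * B" by simp
  finally show ?thesis using big' by linarith
qed

lemma Jn_le: "J * n \<le> 2 ^ (n - h) + n" "J * n \<le> S" "J \<le> S" "2 ^ (n - h) < J * n" "2 ^ h \<le> S" "(2::nat) ^ n < S"
proof -
  show 1: "J * n \<le> 2 ^ (n - h) + n" using div_times_less_eq_dividend[of "2 ^ (n - h)" n] by (simp add: J_def)
  have "(2::nat) ^ (n - h) \<le> 2 ^ n" by (rule power_increasing) auto
  moreover have "n < 2 ^ n" by (rule less_exp)
  moreover have "S = 2 ^ n + 2 ^ n" by (simp add: S_def)
  ultimately show "J * n \<le> S" using 1 by linarith
  moreover have "J * 1 \<le> J * n" using n by (intro mult_le_mono2) auto
  ultimately show "J \<le> S" by linarith
  show "2 ^ (n - h) < J * n"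
    using n dividend_less_times_div[of n "2 ^ (n - h)"] by (simp add: J_def algebra_simps)
  show "2 ^ h \<le> S" unfolding S_def h_def by (intro power_increasing) auto
  show "(2::nat) ^ n < S" by (simp add: S_def)
qed

text \<open>
  Memory from \<open>0\<close>: input, from \<open>K\<close>: tokens, from \<open>2 * K\<close> and \<open>3 * K\<close>: for token number \<open>q\<close>, the tables for the first
  and the second half of the variables at offset \<open>q * S\<close> (the table for the wrong half stays zero),
  up to \<open>5 * K\<close>: a stack growing downwards, from \<open>5 * K\<close>: the regions of \<open>B\<close> words for the interpreter.
  There are \<open>J\<close> blocks of \<open>n\<close> assignments to the second half; the last ones may exceed \<open>2 ^ (n - h)\<close>,
  which is harmless since excess bits are ignored.
  Register 8 points to the current gate in the input, register 9 counts the tokens.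
\<close>

definition creg :: "(nat \<Rightarrow> nat) \<Rightarrow> bool" where
  "creg R \<longleftrightarrow> R 0 = L \<and> R 1 = n \<and> R 2 = h \<and> R 3 = S \<and> R 4 = K \<and> R 5 = B \<and> R 6 = e * n \<and> R 7 = J"

definition "gate_cost = (T n + 1) * (4 * length E + 2 * d + 200) + 100"

text \<open>Run number \<open>b\<close> for token \<open>i\<close> takes region
  \<open>i * S + b\<close>. Region numbers only grow, so everything from the next region on is still
  zero, and this clause is handed from one run to the next. The last clause fits both tables:
  entries collect \<open>dv\<close> consecutive values, and each value is written as the pattern
  \<open>mk\<close>, shifted to its place in the block.\<close>

lemma fill_table_correct:
  assumes R: "creg R" "R 8 = p" "R 9 = i" "R 10 = bs" "R 11 = hi" "R 12 = zm" "R 13 = dv" "R 14 = mk"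
    and g: "gate_at M p g" "evaluable E e T n g" "p + 3 + length (gate_vars g) + length (gate_code g) \<le> L"
    and bounds: "i < L" "hi \<le> S" "2 * K \<le> bs" "bs + S \<le> 4 * K" "0 < dv" "\<And>q. q < dv \<Longrightarrow> mk * 2 ^ q < 2 ^ n" "zm \<le> 2 ^ n"
    and Z: "\<And>x. x < S \<Longrightarrow> M (bs + x) = 0" "\<And>x. 5 * K + i * S * B \<le> x \<Longrightarrow> M x = 0"
  shows "H w (fill_table E d) R M (\<lambda>t R' M'. t \<le> hi * (gate_cost + 4) + 6 \<and> (\<forall>r<15. R' r = R r) \<and>
     (\<forall>x<5 * K. x \<notin> {bs..<bs + S} \<longrightarrow> M' x = M x) \<and>
     (\<forall>x\<ge>5 * K + (i * S + hi) * B. M' x = 0) \<and>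
     (\<forall>x<S. \<forall>q. bit (M' (bs + x)) q \<longleftrightarrow>
        (\<exists>b<hi. b div dv = x \<and> gval g (b * zm) \<and> bit (mk * 2 ^ (b mod dv)) q)))"
proof -
  define I where "I c R' M' \<longleftrightarrow> (\<forall>r<15. R' r = R r) \<and>
     (\<forall>x<5 * K. x \<notin> {bs..<bs + S} \<longrightarrow> M' x = M x) \<and>
     (\<forall>x\<ge>5 * K + (i * S + c) * B. M' x = 0) \<and>
     (\<forall>x<S. \<forall>q. bit (M' (bs + x)) q \<longleftrightarrow>
        (\<exists>b<c. b div dv = x \<and> gval g (b * zm) \<and> bit (mk * 2 ^ (b mod dv)) q))"
    for c :: nat and R' M' :: "nat \<Rightarrow> nat"
  have RR: "R' 3 = S" "R' 4 = K" "R' 5 = B" "R' 6 = e * n" "R' 8 = p" "R' 9 = i" "R' 10 = bs" "R' 11 = hi"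
    "R' 12 = zm" "R' 13 = dv" "R' 14 = mk" if "\<forall>r<15. R' r = R r" for R'
    using that R by (auto simp: creg_def)
  let ?body = "16 ::= Reg 15 \<otimes> Reg 12 ;;
     17 ::= Cst 5 \<otimes> Reg 4 \<oplus> (Reg 9 \<otimes> Reg 3 \<oplus> Reg 15) \<otimes> Reg 5 ;;
     eval_gate E d ;;
     19 ::= Reg 10 \<oplus> Reg 15 \<oslash> Reg 13 ;;
     Put (Reg 19) (Cell (Reg 19) ||| (Reg 30 \<otimes> Reg 14 <<< Reg 15 %% Reg 13)) ;;
     15 ::= Reg 15 \<oplus> Cst 1"
  have body: "H w ?body R1 M1 (\<lambda>t R' M'. t \<le> gate_cost \<and> R' 15 = Suc c \<and> I (Suc c) R' M')"
    if I: "I c R1 M1" and c: "R1 15 = c" "c < hi" for c R1 M1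
  proof -
    have R1s: "\<forall>r<15. R1 r = R r" using I by (simp add: I_def)
    note R1 = RR[OF R1s]
    have cS: "c < S" using c bounds by simp
    have ic: "i * S + c < K" using idx_less[OF bounds(1) cS] .
    define a0 where "a0 = 5 * K + (i * S + c) * B"
    have a0: "a0 + B \<le> 2 ^ w" using mem_less[OF ic] by (simp add: a0_def)
    have a0K: "5 * K \<le> a0" by (simp add: a0_def)
    \<comment> \<open>Both factors are at most \<open>S\<close>; the size condition on
      \<open>S * S\<close> serves this product.\<close>
    have "c * zm \<le> S * 2 ^ n" using cS bounds(7) by (intro mult_le_mono) auto
    also have "\<dots> < S * S" using Jn_le(6) S_ge by (intro mult_strict_left_mono) auto
    finally have z: "c * zm < 2 ^ w" using big'(3) by linarith
    define b where "b = gval g (c * zm)"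
    define R2 where "R2 = R1(16 := c * zm, 17 := a0)"
    have disj: "p + 3 + length (gate_vars g) + length (gate_code g) \<le> a0" using g(3) a0K K_ge by linarith
    have same: "M1 x = M x" if "x < L" for x using I that bounds K_ge by (auto simp: I_def)
    have g1: "gate_at M1 p g"
      using g(1,3) unfolding gate_at_def by (auto simp: same)
    have ev: "computes_within E (e * n) (eval_input (gate_input g (c * zm)) (gate_code g)) (T n) b"
      "length (gate_vars g) + length (gate_code g) \<le> T n"
      using g(2) by (auto simp: evaluable_def b_def gval_def gate_input_def)
    have 1: "H w (eval_gate E d) R2 M1 (\<lambda>t R' M'. t \<le> (T n + 1) * (4 * length E + 2 * d + 200) \<and>
      (\<forall>x. x < a0 \<or> a0 + 2 ^ (e * n) \<le> x \<longrightarrow> M' x = M1 x) \<and> R' 30 = of_bool b \<and>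
      (\<forall>r<30. r \<noteq> 18 \<and> r \<noteq> 20 \<longrightarrow> R' r = R2 r))"
    proof (rule eval_gate_correct[OF g1 _ _ _ _ _ disj _ ev E_len E_ins d])
      show "M1 x = 0" if "a0 \<le> x" for x using I that by (auto simp: I_def a0_def)
    qed (use R1 big' a0 in \<open>auto simp: R2_def B_def\<close>)
    have d1: "c div dv < S" using cS by (rule le_less_trans[OF div_le_dividend])
    define y where "y = bs + c div dv"
    have y: "y < 4 * K" "2 * K \<le> y" "bs \<le> y" "y < bs + S" using d1 bounds by (auto simp: y_def)
    have mk: "mk * 2 ^ (c mod dv) < 2 ^ n" using bounds by auto
    have nw: "(2::nat) ^ n < 2 ^ w" using Jn_le(6) S_ge big'(3) by (meson le_less_trans less_le_trans le_square less_imp_le)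
    have mk2: "mk \<le> mk * 2 ^ (c mod dv)" by simp
    have mkw: "of_bool b * mk < 2 ^ w" "of_bool b * mk * 2 ^ (c mod dv) < 2 ^ w"
      using less_trans[OF mk nw] le_less_trans[OF mk2 less_trans[OF mk nw]] by (cases b; simp)+
    have fin: "t1 + (t2 + (t3 + (t4 + (t5 + t6)))) \<le> gate_cost \<and> R6 15 = Suc c \<and> I (Suc c) R6 M6"
      if "t1 = 4" "t2 = 12" "t3 \<le> (T n + 1) * (4 * length E + 2 * d + 200)" "t4 = 6" "t5 = 12" "t6 = 4"
        and 3: "\<forall>x. x < a0 \<or> a0 + 2 ^ (e * n) \<le> x \<longrightarrow> M3 x = M1 x"
        "\<forall>r<30. r \<noteq> 18 \<and> r \<noteq> 20 \<longrightarrow> R3 r = R2 r"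
        and 6: "R6 = R3(19 := y, 15 := Suc c)" "M6 = M3(y := or (M3 y) (of_bool b * mk * 2 ^ (c mod dv)))"
      for t1 t2 t3 t4 t5 t6 R3 M3 R6 M6
    proof (intro conjI)
      show "t1 + (t2 + (t3 + (t4 + (t5 + t6)))) \<le> gate_cost" using that by (simp add: gate_cost_def)
      show "R6 15 = Suc c" using 6 by simp
      have M3: "M3 x = M1 x" if "x < 5 * K" for x using 3(1) that a0K by auto
      show "I (Suc c) R6 M6"
        unfolding I_def
      proof (intro conjI)
        show "\<forall>r<15. R6 r = R r" using 6 3 R1s by (auto simp: R2_def)
        show "\<forall>x<5 * K. x \<notin> {bs..<bs + S} \<longrightarrow> M6 x = M x" using 6 M3 I y by (auto simp: I_def)
        show "\<forall>x\<ge>5 * K + (i * S + Suc c) * B. M6 x = 0"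
        proof (intro allI impI)
          fix x assume "5 * K + (i * S + Suc c) * B \<le> x"
          then have x: "a0 + B \<le> x" by (simp add: a0_def)
          then have "M3 x = M1 x" using 3(1) by (simp add: B_def)
          moreover have "M1 x = 0" using I x by (simp add: I_def a0_def)
          moreover have "x \<noteq> y" using x y a0K by linarith
          ultimately show "M6 x = 0" using 6 by simp
        qed
        show "\<forall>x<S. \<forall>q. bit (M6 (bs + x)) q \<longleftrightarrow>
          (\<exists>b<Suc c. b div dv = x \<and> gval g (b * zm) \<and> bit (mk * 2 ^ (b mod dv)) q)"
        proof (intro allI impI)
          fix x q assume x: "x < S"
          have old: "bit (M3 (bs + x)) q \<longleftrightarrow> (\<exists>b<c. b div dv = x \<and> gval g (b * zm) \<and> bit (mk * 2 ^ (b mod dv)) q)"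
            using I x M3[of "bs + x"] bounds(4) K_ge by (simp add: I_def)
          show "bit (M6 (bs + x)) q \<longleftrightarrow> (\<exists>b<Suc c. b div dv = x \<and> gval g (b * zm) \<and> bit (mk * 2 ^ (b mod dv)) q)"
          \<comment> \<open>Round \<open>c\<close> changes only the cell \<open>c div dv\<close>,
            and does so by a bitwise or, which keeps the bits of earlier rounds of the same
            block.\<close>
          proof (cases "x = c div dv")
            case True
            then have "M6 (bs + x) = or (M3 (bs + x)) (of_bool b * mk * 2 ^ (c mod dv))" using 6 by (simp add: y_def)
            then show ?thesis using old True by (auto simp: bit_or_iff b_def less_Suc_eq)
          next
            case False
            then have "M6 (bs + x) = M3 (bs + x)" using 6 by (simp add: y_def)
            then show ?thesis using old False by (auto simp: less_Suc_eq)
          qed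
        qed
      qed
    qed
    have addr: "5 * K < 2 ^ w" "i * S < 2 ^ w" "i * S + c < 2 ^ w" "(i * S + c) * B < 2 ^ w" "a0 < 2 ^ w"
      "5 < (2::nat) ^ w" "c + 1 < 2 ^ w" "y < 2 ^ w"
      using a0 B_pos ic K_ge big' cS y by (auto simp: a0_def)
    show ?thesis
      apply (rule H_Seq, rule H_Assign)
      subgoal using z R1 c by simp
      apply (rule H_Seq, rule H_Assign)
      subgoal using addr R1 c by (simp add: a0_def)
      apply (rule H_Seq)
      apply (rule H_mono[where Q = "\<lambda>t R' M'. t \<le> (T n + 1) * (4 * length E + 2 * d + 200) \<and>
        (\<forall>x. x < a0 \<or> a0 + 2 ^ (e * n) \<le> x \<longrightarrow> M' x = M1 x) \<and> R' 30 = of_bool b \<and>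
        (\<forall>r<30. r \<noteq> 18 \<and> r \<noteq> 20 \<longrightarrow> R' r = R2 r)"])
      subgoal using 1 R1 c by (simp add: R2_def a0_def)
      subgoal for t3 R3 M3
        apply (elim conjE)
        apply (intro H_Seq H_Assign H_Put)
            apply (use R1 c addr mkw in \<open>simp_all add: R2_def y_def\<close>)[4]
        apply (rule fin[where ?R3.0 = R3 and ?M3.0 = M3])
                 apply (use R1 c in \<open>simp_all add: R2_def y_def fun_eq_iff\<close>)
        done
      done
  qed
  have "H w (fill_table E d) R M (\<lambda>t R' M'. t \<le> hi * (gate_cost + 4) + 6 \<and> I hi R' M')"
    unfolding fill_table_def
  proof (rule H_Seq, rule H_Assign)
    show "H w (WhileLess (Reg 15) (Reg 11) ?body) (R(15 := ev (Cst 0) R M)) M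
      (\<lambda>t R' M'. elen (Cst 0) + 1 + t \<le> hi * (gate_cost + 4) + 6 \<and> I hi R' M')"
    proof (rule H_mono[OF H_for[where I = I and hi = hi and ?x0.0 = 0 and cb = gate_cost]])
      show "I 0 (R(15 := ev (Cst 0) R M)) M" using Z by (auto simp: I_def)
      show "ok w (Reg 11) R' M' \<and> ev (Reg 11) R' M' = hi" if "I x R' M'" for x R' M'
        using that R by (simp add: I_def)
      show "H w ?body R' M' (\<lambda>t R' M'. t \<le> gate_cost \<and> R' 15 = Suc x \<and> I (Suc x) R' M')"
        if "I x R' M'" "R' 15 = x" "x < hi" for x R' M' using body[OF that] .
    qed (auto simp: add.commute)
  qed simp
  then show ?thesis by (rule H_mono) (simp add: I_def)
qed

end

section \<open>Reading the formula\<close>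

text \<open>The first variable decides which half the gate reads. For a gate without variables the
  inspected cell has another meaning, but then the gate is constant and either branch yields a
  correct table.\<close>

definition gate_case :: "program \<Rightarrow> nat \<Rightarrow> com" where
  "gate_case E d =
   IfLess (Cell (Reg 8 \<oplus> Cst 3)) (Reg 2)
    (10 ::= Cst 2 \<otimes> Reg 4 \<oplus> Reg 9 \<otimes> Reg 3 ;; 11 ::= Cst 1 <<< Reg 2 ;; 12 ::= Cst 1 ;;
     13 ::= Cst 1 ;; 14 ::= (Cst 1 <<< Reg 1) \<ominus> Cst 1)
    (10 ::= Cst 3 \<otimes> Reg 4 \<oplus> Reg 9 \<otimes> Reg 3 ;; 11 ::= Reg 7 \<otimes> Reg 1 ;; 12 ::= Cst 1 <<< Reg 2 ;;
     13 ::= Reg 1 ;; 14 ::= Cst 1) ;;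
   fill_table E d ;;
   Put (Reg 4 \<oplus> Reg 9) (Cst 0) ;;
   9 ::= Reg 9 \<oplus> Cst 1 ;;
   8 ::= Reg 8 \<oplus> Cst 3 \<oplus> Cell (Reg 8 \<oplus> Cst 1) \<oplus> Cell (Reg 8 \<oplus> Cst 2)"

text \<open>The counter starts at 1 because fan-in \<open>k\<close> produces \<open>k - 1\<close>
  tokens. The tag in the input is already the token code and is copied unchanged.\<close>

definition op_case :: com where
  "op_case =
   18 ::= Cst 1 ;;
   WhileLess (Reg 18) (Cell (Reg 8 \<oplus> Cst 1))
    (Put (Reg 4 \<oplus> Reg 9) (Cell (Reg 8)) ;; 9 ::= Reg 9 \<oplus> Cst 1 ;; 18 ::= Reg 18 \<oplus> Cst 1) ;;
   8 ::= Reg 8 \<oplus> Cst 2"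

text \<open>In prefix notation the arguments simply follow their gate, so a single pass without a
  stack is enough.\<close>

definition parse :: "program \<Rightarrow> nat \<Rightarrow> com" where
  "parse E d = 8 ::= Cst 1 ;; 9 ::= Cst 0 ;;
   WhileLess (Reg 8) (Reg 0) (IfLess (Cell (Reg 8)) (Cst 1) (gate_case E d) op_case)"

lemma drop_eq_appendD:
  assumes "drop p xs = ys @ zs"
  shows "k < length ys \<Longrightarrow> xs ! (p + k) = ys ! k" "p \<le> length xs \<Longrightarrow> p + length ys \<le> length xs"
    "drop (p + length ys) xs = zs"
proof -
  show "xs ! (p + k) = ys ! k" if "k < length ys"
  proof -
    have "length (drop p xs) = length ys + length zs" using assms by simp
    then have "p \<le> length xs" using that by (cases "p \<le> length xs") auto
    then have "xs ! (p + k) = drop p xs ! k" by simp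
    then show ?thesis using assms that by (simp add: nth_append)
  qed
  show "p + length ys \<le> length xs" if "p \<le> length xs"
    using that arg_cong[OF assms, of length] by simp
  show "drop (p + length ys) xs = zs"
    using arg_cong[OF assms, of "drop (length ys)"] by (simp add: add.commute)
qed

context sat_instance
begin

text \<open>Combining both tables by a bitwise or spares the search the question to which half a
  gate belongs, since the entry for the other half is zero. The bits from \<open>n\<close> on are
  required to vanish.\<close>

definition table_ok :: "(nat \<Rightarrow> nat) \<Rightarrow> nat \<Rightarrow> tok \<Rightarrow> bool" where
  "table_ok M q t \<longleftrightarrow> (\<forall>g. t = TGate g \<longrightarrow> (\<forall>a<2 ^ h. \<forall>j<J. \<forall>r.
     bit (or (M (2 * K + q * S + a)) (M (3 * K + q * S + j))) r \<longleftrightarrow> r < n \<and> gval g (a + (j * n + r) * 2 ^ h)))"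

text \<open>The zero clauses concern the tables still to be filled, into which values are merged by
  a bitwise or, and the regions of future interpreter runs.\<close>

definition layout :: "tok list \<Rightarrow> (nat \<Rightarrow> nat) \<Rightarrow> bool" where
  "layout ts M \<longleftrightarrow> (\<forall>x<L. M x = inp ! x) \<and>
     (\<forall>q<length ts. M (K + q) = tok_code (ts ! q) \<and> table_ok M q (ts ! q)) \<and>
     (\<forall>x. 2 * K + length ts * S \<le> x \<and> x < 3 * K \<longrightarrow> M x = 0) \<and>
     (\<forall>x. 3 * K + length ts * S \<le> x \<and> x < 4 * K \<longrightarrow> M x = 0) \<and>
     (\<forall>x\<ge>5 * K + length ts * S * B. M x = 0)"

lemma layout_snoc:
  assumes lay: "layout ts M" and i: "length ts < L"
    and same: "\<And>x. x < 4 * K \<Longrightarrow> x \<noteq> K + length ts \<Longrightarrow> x \<notin> {2 * K + length ts * S..<2 * K + length ts * S + S} \<Longrightarrow>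
        x \<notin> {3 * K + length ts * S..<3 * K + length ts * S + S} \<Longrightarrow> M' x = M x"
    and new: "M' (K + length ts) = tok_code t" "table_ok M' (length ts) t"
    and Z: "\<And>x. 5 * K + Suc (length ts) * S * B \<le> x \<Longrightarrow> M' x = 0"
  shows "layout (ts @ [t]) M'"
  unfolding layout_def
proof (intro conjI allI impI)
  let ?i = "length ts"
  have iS: "?i * S + S \<le> K" using idx_less[OF i, of "S - 1"] S_ge by simp
  have iK: "?i < K" using i K_ge by simp
  show "M' x = inp ! x" if "x < L" for x
    using same[of x] that lay K_ge by (auto simp: layout_def)
  have lt: "q * S + S \<le> ?i * S" if "q < ?i" for q
    using mult_le_mono1[of "Suc q" ?i S] that by simp
  have tab: "M' (2 * K + q * S + x) = M (2 * K + q * S + x)" "M' (3 * K + q * S + x) = M (3 * K + q * S + x)"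
    if "q < ?i" "x < S" for q x
    using same[of "2 * K + q * S + x"] same[of "3 * K + q * S + x"] lt[OF that(1)] that(2) iS iK by auto
  have tok: "M' (K + q) = M (K + q)" if "q < ?i" for q
    using same[of "K + q"] that iK by auto
  show "M' (K + q) = tok_code ((ts @ [t]) ! q)" if "q < length (ts @ [t])" for q
    using that new(1) lay tok[of q] by (cases "q = ?i") (auto simp: nth_append layout_def)
  show "table_ok M' q ((ts @ [t]) ! q)" if "q < length (ts @ [t])" for q
  proof (cases "q = ?i")
    case False
    with that have q: "q < ?i" by simp
    have "table_ok M q (ts ! q)" using q lay by (simp add: layout_def)
    moreover have "a < S" if "a < 2 ^ h" for a using that Jn_le(5) by simp
    moreover have "j < S" if "j < J" for j using that Jn_le(3) by simp
    ultimately show ?thesis using q tab[OF q] by (simp add: table_ok_def nth_append)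
  qed (use new in simp)
  show "M' x = 0" if "2 * K + length (ts @ [t]) * S \<le> x \<and> x < 3 * K" for x
    using same[of x] that lay iK by (auto simp: layout_def)
  show "M' x = 0" if "3 * K + length (ts @ [t]) * S \<le> x \<and> x < 4 * K" for x
    using same[of x] that lay iK iS by (auto simp: layout_def)
  show "M' x = 0" if "5 * K + length (ts @ [t]) * S * B \<le> x" for x
    using Z[of x] that by simp
qed

text \<open>Connectives are charged as much as gates, which makes the cost of reading proportional
  to the number of tokens.\<close>

definition "tok_cost = (2 ^ (n - h) + n) * (gate_cost + 4) + 200"

lemma gate_case_correct:
  assumes lay: "layout ts M" and i: "length ts < L" and R: "creg R" "R 8 = p" "R 9 = length ts"
    and g: "gate_at M p g" "F1 E e T n (First g)" "p + 3 + length (gate_vars g) + length (gate_code g) \<le> L"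
  shows "H w (gate_case E d) R M (\<lambda>t R' M'. t \<le> tok_cost - 20 \<and> creg R' \<and>
    R' 8 = p + 3 + length (gate_vars g) + length (gate_code g) \<and> R' 9 = Suc (length ts) \<and>
    layout (ts @ [TGate g]) M')"
proof -
  let ?i = "length ts"
  let ?c = "M (p + 3) < h"
  define bs where "bs = (if ?c then 2 * K + ?i * S else 3 * K + ?i * S)"
  define hi where "hi = (if ?c then 2 ^ h else J * n)"
  define zm where "zm = (if ?c then 1 else (2::nat) ^ h)"
  define dv where "dv = (if ?c then 1 else n)"
  define mk where "mk = (if ?c then 2 ^ n - 1 else (1::nat))"
  define R1 where "R1 = R(10 := bs, 11 := hi, 12 := zm, 13 := dv, 14 := mk)"
  have iS: "?i * S + S \<le> K" using idx_less[OF i, of "S - 1"] S_ge by simp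
  have Rs: "R 0 = L" "R 1 = n" "R 2 = h" "R 3 = S" "R 4 = K" "R 7 = J" using R by (auto simp: creg_def)
  have hn: "2 ^ h \<le> (2::nat) ^ n" unfolding h_def by (intro power_increasing) auto
  have half: "set (gate_vars g) \<subseteq> {0..<h}" if "?c"
  proof (cases "gate_vars g")
    case (Cons v vs)
    then have "M (p + 3) = v" using g(1) by (auto simp: gate_at_def dest: spec[of _ 0])
    then show ?thesis using that g(2) Cons by (auto simp: h_def)
  qed simp
  have half2: "set (gate_vars g) \<subseteq> {h..<n}" if "\<not> ?c"
  proof (cases "gate_vars g")
    case (Cons v vs)
    then have "M (p + 3) = v" using g(1) by (auto simp: gate_at_def dest: spec[of _ 0])
    then show ?thesis using that g(2) Cons by (auto simp: h_def)
  qed simp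
  have pL: "p + 3 \<le> L" using g(3) by simp
  have small: "5 * K < 2 ^ w" "K + ?i < 2 ^ w" "2 ^ h < (2::nat) ^ w" "(2::nat) ^ n < 2 ^ w" "J * n < 2 ^ w" "L < 2 ^ w"
    "5 < (2::nat) ^ w" "?i * S < 2 ^ w" "3 * K + ?i * S < 2 ^ w" "2 * K + ?i * S < 2 ^ w" "p + 3 < 2 ^ w"
    using big' K_ge Jn_le iS S_ge i pL by linarith+
  have set: "H w (IfLess (Cell (Reg 8 \<oplus> Cst 3)) (Reg 2)
    (10 ::= Cst 2 \<otimes> Reg 4 \<oplus> Reg 9 \<otimes> Reg 3 ;; 11 ::= Cst 1 <<< Reg 2 ;; 12 ::= Cst 1 ;;
     13 ::= Cst 1 ;; 14 ::= (Cst 1 <<< Reg 1) \<ominus> Cst 1)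
    (10 ::= Cst 3 \<otimes> Reg 4 \<oplus> Reg 9 \<otimes> Reg 3 ;; 11 ::= Reg 7 \<otimes> Reg 1 ;; 12 ::= Cst 1 <<< Reg 2 ;;
     13 ::= Reg 1 ;; 14 ::= Cst 1)) R M (\<lambda>t R' M'. t \<le> 50 \<and> R' = R1 \<and> M' = M)"
    using Rs R small by (intro H_IfLess H_Seq H_Assign)
      (auto simp: R1_def bs_def hi_def zm_def dv_def mk_def)
  have R1: "creg R1" "R1 8 = p" "R1 9 = ?i" "R1 10 = bs" "R1 11 = hi" "R1 12 = zm" "R1 13 = dv" "R1 14 = mk"
    using R by (auto simp: R1_def creg_def)
  have hi_le: "hi \<le> 2 ^ (n - h) + n"
  proof -
    \<comment> \<open>Since \<open>h\<close> is rounded down, \<open>n - h\<close> is the larger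
      half, and one bound covers both kinds of tables.\<close>
    have "(2::nat) ^ h \<le> 2 ^ (n - h)" unfolding h_def by (intro power_increasing) auto
    then have "2 ^ h \<le> 2 ^ (n - h) + n" by (rule trans_le_add1)
    then show ?thesis using Jn_le(1) unfolding hi_def by presburger
  qed
  have fill: "H w (fill_table E d) R1 M (\<lambda>t R' M'. t \<le> hi * (gate_cost + 4) + 6 \<and> (\<forall>r<15. R' r = R1 r) \<and>
     (\<forall>x<5 * K. x \<notin> {bs..<bs + S} \<longrightarrow> M' x = M x) \<and>
     (\<forall>x\<ge>5 * K + (?i * S + hi) * B. M' x = 0) \<and>
     (\<forall>x<S. \<forall>q. bit (M' (bs + x)) q \<longleftrightarrow>
        (\<exists>b<hi. b div dv = x \<and> gval g (b * zm) \<and> bit (mk * 2 ^ (b mod dv)) q)))"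
  proof (rule fill_table_correct[OF R1 g(1) _ g(3) i])
    show "evaluable E e T n g" using g(2) by simp
    show "hi \<le> S" using Jn_le by (simp add: hi_def)
    show "2 * K \<le> bs" "bs + S \<le> 4 * K" using iS by (auto simp: bs_def)
    show "0 < dv" using n by (simp add: dv_def)
    show "mk * 2 ^ q < 2 ^ n" if "q < dv" for q using that by (auto simp: mk_def dv_def split: if_splits)
    show "zm \<le> 2 ^ n" using hn by (simp add: zm_def)
    show "M (bs + x) = 0" if "x < S" for x
      using lay that iS by (auto simp: layout_def bs_def)
    show "M x = 0" if "5 * K + ?i * S * B \<le> x" for x using lay that by (auto simp: layout_def)
  qed
  have fin: "layout (ts @ [TGate g]) (M1(K + ?i := 0))"
    if same: "\<forall>x<5 * K. x \<notin> {bs..<bs + S} \<longrightarrow> M1 x = M x"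
     and z: "\<forall>x\<ge>5 * K + (?i * S + hi) * B. M1 x = 0"
     and tab: "\<forall>x<S. \<forall>q. bit (M1 (bs + x)) q \<longleftrightarrow>
        (\<exists>b<hi. b div dv = x \<and> gval g (b * zm) \<and> bit (mk * 2 ^ (b mod dv)) q)" for M1
  proof (rule layout_snoc[OF lay i])
    let ?M = "M1(K + ?i := 0)"
    have iK: "K + ?i < 2 * K" using i K_ge by simp
    show "?M x = M x" if "x < 4 * K" "x \<noteq> K + ?i" "x \<notin> {2 * K + ?i * S..<2 * K + ?i * S + S}"
      "x \<notin> {3 * K + ?i * S..<3 * K + ?i * S + S}" for x
      using that same by (auto simp: bs_def split: if_splits)
    show "?M (K + ?i) = tok_code (TGate g)" by simp
    show "?M x = 0" if "5 * K + Suc ?i * S * B \<le> x" for x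
    proof -
      have "(?i * S + hi) * B \<le> Suc ?i * S * B"
        using Jn_le by (intro mult_le_mono1) (simp add: hi_def)
      with that have "5 * K + (?i * S + hi) * B \<le> x" by linarith
      with z have "M1 x = 0" by blast
      then show ?thesis by simp
    qed
    show "table_ok ?M ?i (TGate g)"
      unfolding table_ok_def
    proof (intro allI impI)
      fix g' and a j r :: nat assume "TGate g = TGate g'" and a: "a < 2 ^ h" and j: "j < J"
      then have g': "g' = g" by simp
      have aS: "a < S" "j < S" using a j Jn_le by auto
      have M1: "?M (2 * K + ?i * S + a) = M1 (2 * K + ?i * S + a)" "?M (3 * K + ?i * S + j) = M1 (3 * K + ?i * S + j)"
        using iK by auto
      have M0: "M (2 * K + ?i * S + a) = 0" "M (3 * K + ?i * S + j) = 0"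
        using lay aS iS by (auto simp: layout_def)
      show "bit (or (?M (2 * K + ?i * S + a)) (?M (3 * K + ?i * S + j))) r \<longleftrightarrow> r < n \<and> gval g' (a + (j * n + r) * 2 ^ h)"
      proof (cases ?c)
        case True
        have "M1 (3 * K + ?i * S + j) = 0"
          using same[rule_format, of "3 * K + ?i * S + j"] M0 True aS iS by (simp add: bs_def)
        moreover have "bit (M1 (2 * K + ?i * S + a)) r \<longleftrightarrow> gval g a \<and> bit (2 ^ n - 1 :: nat) r"
          using tab[rule_format, OF aS(1), of r] True a by (simp add: bs_def hi_def dv_def zm_def mk_def)
        moreover have "bit (2 ^ n - 1 :: nat) r \<longleftrightarrow> r < n"
          by (metis bit_mask_iff mask_eq_exp_minus_1 possible_bit_nat)
        ultimately show ?thesis unfolding M1 g'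
          using gval_first_half[OF half[OF True] a, of "j * n + r"] by (auto simp: bit_or_iff)
      next
        case False
        have "M1 (2 * K + ?i * S + a) = 0"
          using same[rule_format, of "2 * K + ?i * S + a"] M0 False aS iS by (simp add: bs_def)
        moreover have "bit (M1 (3 * K + ?i * S + j)) r \<longleftrightarrow>
            (\<exists>b<J * n. b div n = j \<and> gval g (b * 2 ^ h) \<and> r = b mod n)"
          using tab[rule_format, OF aS(2), of r] False
          by (auto simp: bs_def hi_def dv_def zm_def mk_def bit_exp_iff)
        moreover have "\<dots> \<longleftrightarrow> r < n \<and> gval g ((j * n + r) * 2 ^ h)" (is "?l \<longleftrightarrow> ?r")
        proof
          show ?r if ?l using that n by (auto simp: div_mult_mod_eq)
          show ?l if ?r
          proof (intro exI[of _ "j * n + r"] conjI)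
            have "j * n + r < Suc j * n" using that by simp
            also have "\<dots> \<le> J * n" using j by (intro mult_le_mono1) auto
            finally show "j * n + r < J * n" .
          qed (use that in auto)
        qed
        ultimately show ?thesis unfolding M1 g'
          using gval_second_half[OF half2[OF False] a, of "j * n + r"] by (auto simp: bit_or_iff)
      qed
    qed
  qed
  show ?thesis
    unfolding gate_case_def
  proof (rule H_Seq, rule H_mono[OF set], elim conjE, hypsubst, rule H_Seq, rule H_mono[OF fill], elim conjE)
    fix t1 t2 :: nat and R2 M2 :: "nat \<Rightarrow> nat"
    assume t1: "t1 \<le> 50" and t2: "t2 \<le> hi * (gate_cost + 4) + 6" and R2: "\<forall>r<15. R2 r = R1 r"
     and same: "\<forall>x<5 * K. x \<notin> {bs..<bs + S} \<longrightarrow> M2 x = M x"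
     and z: "\<forall>x\<ge>5 * K + (?i * S + hi) * B. M2 x = 0"
     and tab: "\<forall>x<S. \<forall>q. bit (M2 (bs + x)) q \<longleftrightarrow>
        (\<exists>b<hi. b div dv = x \<and> gval g (b * zm) \<and> bit (mk * 2 ^ (b mod dv)) q)"
    have "2 * K \<le> bs" by (simp add: bs_def)
    then have M2: "M2 x = M x" if "x < L" for x using that same K_ge by auto
    have g2: "M2 (p + 1) = length (gate_vars g)" "M2 (p + 2) = length (gate_code g)"
      using M2[of "p + 1"] M2[of "p + 2"] g pL by (auto simp: gate_at_def)
    have KL: "p + 1 < K + ?i" "p + 2 < K + ?i" using pL K_ge by auto
    have r2: "R2 4 = K" "R2 9 = ?i" "R2 8 = p" "creg R2"
      using R2 R1 by (auto simp: creg_def)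
    have time: "hi * (gate_cost + 4) + 100 \<le> tok_cost - 20"
      using mult_le_mono1[OF hi_le, of "gate_cost + 4"] unfolding tok_cost_def by linarith
    note f = fin[OF same z tab]
    show "H w (Put (Reg 4 \<oplus> Reg 9) (Cst 0) ;;
       9 ::= Reg 9 \<oplus> Cst 1 ;;
       8 ::= Reg 8 \<oplus> Cst 3 \<oplus> Cell (Reg 8 \<oplus> Cst 1) \<oplus> Cell (Reg 8 \<oplus> Cst 2)) R2 M2
      (\<lambda>t R' M'. t1 + (t2 + t) \<le> tok_cost - 20 \<and> creg R' \<and>
       R' 8 = p + 3 + length (gate_vars g) + length (gate_code g) \<and> R' 9 = Suc ?i \<and> layout (ts @ [TGate g]) M')"
      apply (intro H_Seq H_Put H_Assign)
      using small r2 g2 KL g(3) pL f t1 t2 time K_ge i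
          apply (auto simp: creg_def numeral_2_eq_2)
      done
  qed
qed

lemma op_case_correct:
  assumes lay: "layout ts M" and i: "length ts + k < L" and R: "creg R" "R 8 = p" "R 9 = length ts"
    and p: "M p = tok_code t" "M (p + 1) = Suc k" "p + 2 \<le> L" and t: "t = TAnd \<or> t = TOr"
  shows "H w op_case R M (\<lambda>tm R' M'. tm \<le> k * 25 + 30 \<and> creg R' \<and>
    R' 8 = p + 2 \<and> R' 9 = length ts + k \<and> layout (ts @ replicate k t) M')"
proof -
  define I where "I x R' M' \<longleftrightarrow> 1 \<le> x \<and> creg R' \<and> R' 8 = p \<and> R' 9 = length ts + (x - 1) \<and>
    layout (ts @ replicate (x - 1) t) M'" for x R' M'
  have small: "5 * K < 2 ^ w" "L < 2 ^ w" "5 < (2::nat) ^ w"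
    using big' K_ge by linarith+
  have inp: "M' p = tok_code t" "M' (p + 1) = Suc k" if "I x R' M'" for x R' M'
    using that lay p by (auto simp: I_def layout_def)
  have I1: "I 1 (R(18 := 1)) M" using lay R by (simp add: I_def creg_def)
  let ?body = "Put (Reg 4 \<oplus> Reg 9) (Cell (Reg 8)) ;; 9 ::= Reg 9 \<oplus> Cst 1 ;; 18 ::= Reg 18 \<oplus> Cst 1"
  have loop: "H w (WhileLess (Reg 18) (Cell (Reg 8 \<oplus> Cst 1)) ?body) (R(18 := 1)) M
    (\<lambda>t R' M'. t \<le> (Suc k - 1) * (18 + elen (Cell (Reg 8 \<oplus> Cst 1)) + 3) + elen (Cell (Reg 8 \<oplus> Cst 1)) + 3 \<and>
      R' 18 = Suc k \<and> I (Suc k) R' M')"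
  proof (rule H_for[where I = I])
    show "I 1 (R(18 := 1)) M" by (rule I1)
    show "ok w (Cell (Reg 8 \<oplus> Cst 1)) R' M' \<and> ev (Cell (Reg 8 \<oplus> Cst 1)) R' M' = Suc k"
      if "I x R' M'" for x R' M'
      using inp[OF that] that p small by (auto simp: I_def)
    show "H w ?body R' M' (\<lambda>t R' M'. t \<le> 18 \<and> R' 18 = Suc x \<and> I (Suc x) R' M')"
      if I: "I x R' M'" and x: "R' 18 = x" "x < Suc k" for x R' M'
    proof -
      let ?ts = "ts @ replicate (x - 1) t"
      have len: "length ?ts = length ts + (x - 1)" by simp
      have r: "R' 4 = K" "R' 8 = p" "R' 9 = length ?ts" "1 \<le> x" and lay': "layout ?ts M'"
        using I by (auto simp: I_def creg_def)
      have i': "length ?ts < L" using i x r by simp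
      have "layout (?ts @ [t]) (M'(K + length ?ts := tok_code t))"
      proof (rule layout_snoc[OF lay' i'])
        have le: "length ?ts * S * B \<le> Suc (length ?ts) * S * B" by (intro mult_le_mono1) simp
        have "K + length ?ts < 5 * K" using i' K_ge by linarith
        moreover have "M' y = 0" "5 * K \<le> y" if "5 * K + Suc (length ?ts) * S * B \<le> y" for y
        proof -
          have "5 * K + length ?ts * S * B \<le> y" using that le by linarith
          then show "M' y = 0" using lay' unfolding layout_def by blast
          show "5 * K \<le> y" using that by linarith
        qed
        ultimately show "(M'(K + length ?ts := tok_code t)) y = 0" if "5 * K + Suc (length ?ts) * S * B \<le> y" for y
          using that by fastforce
      qed (use t in \<open>auto simp: table_ok_def\<close>)
      moreover have "?ts @ [t] = ts @ replicate (Suc x - 1) t"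
        using r(4) by (cases x) (auto simp: replicate_append_same)
      ultimately have lay2: "layout (ts @ replicate (Suc x - 1) t) (M'(K + length ?ts := tok_code t))" by simp
      have s: "K + length ?ts < 2 ^ w" "length ?ts + 1 < 2 ^ w" "x + 1 < 2 ^ w"
        using i' i x small K_ge by linarith+
      show ?thesis
        apply (intro H_Seq H_Put H_Assign)
        using r s x inp[OF I] lay2 I p small len
            apply (auto simp: I_def creg_def)
        done
    qed
  qed (use R in auto)
  show ?thesis
    unfolding op_case_def
    apply (rule H_Seq, rule H_Assign)
    subgoal using small by simp
    apply (rule H_Seq)
    apply (rule H_mono[where Q = "\<lambda>t R' M'. t \<le> k * 25 + 7 \<and> I (Suc k) R' M'"])
    subgoal using loop by (auto elim!: H_mono)
    subgoal for t1 R1 M1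
      using small p by (intro H_Assign) (auto simp: I_def creg_def)
    done
qed

text \<open>At the end of the input no subformula can be pending.\<close>

lemma encode_nonempty: "encode G \<noteq> []"
  by (cases G) auto

lemma parse_correct:
  assumes R: "creg R" and lay: "layout [] M"
  shows "H w (parse E d) R M (\<lambda>t R' M'. t \<le> tok_cost * length (toks F) + 10 \<and> creg R' \<and>
    R' 9 = length (toks F) \<and> layout (toks F) M')"
proof -
  \<comment> \<open>\<open>ts\<close> has been written, and the rest of the input encodes a list
    \<open>Fs\<close> of pending formulas. A connective gate is replaced by its arguments in
    \<open>Fs\<close> while its tokens move to \<open>ts\<close>. The potential charges
    \<open>tok_cost\<close> for each token still missing.\<close>
  define I where "I \<tau> R' M' \<longleftrightarrow> (\<exists>ts Fs p. creg R' \<and> R' 8 = p \<and> p \<le> L \<and> R' 9 = length ts \<and> layout ts M' \<and>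
    drop p inp = concat (map encode Fs) \<and> ts @ concat (map toks Fs) = toks F \<and> (\<forall>G\<in>set Fs. F1 E e T n G) \<and>
    \<tau> = tok_cost * length (concat (map toks Fs)) + 4)" for \<tau> R' M'
  have small: "5 * K < 2 ^ w" "L < 2 ^ w" "5 < (2::nat) ^ w"
    using big' K_ge by linarith+
  let ?body = "IfLess (Cell (Reg 8)) (Cst 1) (gate_case E d) op_case"
  have loop: "H w (WhileLess (Reg 8) (Reg 0) ?body) R1 M
    (\<lambda>t R' M'. t \<le> tok_cost * length (toks F) + 4 \<and> (\<exists>\<tau>'. I \<tau>' R' M') \<and> \<not> ev (Reg 8) R' M' < ev (Reg 0) R' M')"
    if R1: "R1 = R(8 := 1, 9 := 0)" for R1
  proof (rule H_WhileLess)
    show "I (tok_cost * length (toks F) + 4) R1 M"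
      unfolding I_def
      by (rule exI[of _ "[]"], rule exI[of _ "[F]"], rule exI[of _ 1])
        (use R lay F1 L_ge in \<open>auto simp: R1 creg_def sat_input_def\<close>)
  next
    fix \<tau> R' M' assume "I \<tau> R' M'"
    then show "ok w (Reg 8) R' M' \<and> ok w (Reg 0) R' M' \<and> elen (Reg 8) + elen (Reg 0) + 2 \<le> \<tau>"
      by (auto simp: I_def)
  next
    fix \<tau> R' M' assume "I \<tau> R' M'" and lt: "ev (Reg 8) R' M' < ev (Reg 0) R' M'"
    then obtain ts Fs p where I: "creg R'" "R' 8 = p" "p \<le> L" "R' 9 = length ts" "layout ts M'"
      "drop p inp = concat (map encode Fs)" "ts @ concat (map toks Fs) = toks F" "\<forall>G\<in>set Fs. F1 E e T n G"
      "\<tau> = tok_cost * length (concat (map toks Fs)) + 4" unfolding I_def by blast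
    have "p < L" using lt I by (simp add: creg_def)
    then have "Fs \<noteq> []" using I(6) by (auto simp: L_def)
    then obtain G Gs where Fs: "Fs = G # Gs" by (cases Fs) auto
    have dr: "drop p inp = encode G @ concat (map encode Gs)" using I(6) Fs by simp
    note dD = drop_eq_appendD[OF dr]
    have M'inp: "M' (p + k) = encode G ! k" if "k < length (encode G)" for k
    proof -
      have "p + k < L" using dD(2) that I(3) by (simp add: L_def)
      then show ?thesis using I(5) dD(1)[OF that] by (simp add: layout_def)
    qed
    have pl: "p + length (encode G) \<le> L" using dD(2) I(3) by (simp add: L_def)
    have len: "length ts + length (toks G) \<le> length (toks F)"
      using arg_cong[OF I(7), of length] Fs by simp
    have FG: "F1 E e T n G" using I(8) Fs by simp
    have op: "H w ?body R' M' (\<lambda>t R' M'. \<exists>\<tau>'. I \<tau>' R' M' \<and> elen (Reg 8) + elen (Reg 0) + 2 + t + \<tau>' \<le> \<tau>)"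
      if op: "t = TAnd \<or> t = TOr" "encode G = [tok_code t, length Hs] @ concat (map encode Hs)"
        "toks G = replicate (length Hs - 1) t @ concat (map toks Hs)" "2 \<le> length Hs" "\<forall>H\<in>set Hs. F1 E e T n H" for Hs t
    proof -
      obtain k where k: "length Hs = Suc k" "1 \<le> k" using op(4) by (cases "length Hs") auto
      have m: "M' p = tok_code t" "M' (p + 1) = Suc k" using M'inp[of 0] M'inp[of 1] op(2) k by auto
      have p2: "p + 2 \<le> L" using pl op(2) by simp
      have d2: "drop (p + 2) inp = concat (map encode (Hs @ Gs))"
        using drop_eq_appendD(3)[of p inp "[tok_code t, length Hs]" "concat (map encode (Hs @ Gs))"] dr op(2) by simp
      have tk: "(ts @ replicate k t) @ concat (map toks (Hs @ Gs)) = toks F"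
        using I(7) Fs op(3) k by simp
      have "length ts + k < L" using len op(3) k L_ge by simp
      from op_case_correct[OF I(5) this I(1,2,4) m p2 op(1)]
      have *: "H w op_case R' M' (\<lambda>tm R' M'. tm \<le> k * 25 + 30 \<and> creg R' \<and>
        R' 8 = p + 2 \<and> R' 9 = length ts + k \<and> layout (ts @ replicate k t) M')" .
      have tc: "tok_code t \<noteq> 0" using op(1) by auto
      have cost: "\<tau> = tok_cost * k + (tok_cost * length (concat (map toks (Hs @ Gs))) + 4)"
        using I(9) Fs op(3) k by (simp add: algebra_simps)
      \<comment> \<open>The visit of a connective gate is paid for by its \<open>k\<close> tokens;
        there is at least one because the fan-in is at least 2.\<close>
      have kc: "k * 25 + 40 \<le> tok_cost * k"
      proof -
        have "100 * k \<le> tok_cost * k" by (intro mult_le_mono1) (simp add: tok_cost_def)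
        then show ?thesis using k(2) by linarith
      qed
      show ?thesis
      proof (rule H_IfLess)
        show "H w op_case R' M' (\<lambda>t R' M'. \<exists>\<tau>'. I \<tau>' R' M' \<and>
            elen (Reg 8) + elen (Reg 0) + 2 + (elen (Cell (Reg 8)) + elen (Cst 1) + 2 + t) + \<tau>' \<le> \<tau>)"
        proof (rule H_mono[OF *], elim conjE)
          fix t0 R2 M2 assume 2: "t0 \<le> k * 25 + 30" "creg R2" "R2 8 = p + 2" "R2 9 = length ts + k"
            "layout (ts @ replicate k t) M2"
          have "I (tok_cost * length (concat (map toks (Hs @ Gs))) + 4) R2 M2"
            unfolding I_def
            by (rule exI[of _ "ts @ replicate k t"], rule exI[of _ "Hs @ Gs"], rule exI[of _ "p + 2"])
              (use 2 p2 d2 tk op(5) I(8) Fs in auto)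
          then show "\<exists>\<tau>'. I \<tau>' R2 M2 \<and>
            elen (Reg 8) + elen (Reg 0) + 2 + (elen (Cell (Reg 8)) + elen (Cst 1) + 2 + t0) + \<tau>' \<le> \<tau>"
            using cost kc 2(1) by (intro exI[of _ "tok_cost * length (concat (map toks (Hs @ Gs))) + 4"]) simp
        qed
      qed (use m tc I small in auto)
    qed
    show "H w ?body R' M' (\<lambda>t R' M'. \<exists>\<tau>'. I \<tau>' R' M' \<and> elen (Reg 8) + elen (Reg 0) + 2 + t + \<tau>' \<le> \<tau>)"
    proof (cases G)
      case (Conj Hs)
      then show ?thesis using FG by (intro op[of TAnd Hs]) auto
    next
      case (Disj Hs)
      then show ?thesis using FG by (intro op[of TOr Hs]) auto
    next
      case (First g)
      let ?v = "length (gate_vars g)" and ?k = "length (gate_code g)"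
      have en: "encode G = [0, ?v, ?k] @ gate_vars g @ map of_bool (gate_code g)" using First by simp
      have lenG: "length (encode G) = 3 + ?v + ?k" using en by simp
      have g: "gate_at M' p g"
        unfolding gate_at_def
      proof (intro conjI allI impI)
        show "M' (p + 1) = ?v" "M' (p + 2) = ?k" using M'inp[of 1] M'inp[of 2] en by auto
        show "M' (p + 3 + k) = gate_vars g ! k" if "k < ?v" for k
          using M'inp[of "3 + k"] en that by (simp add: nth_append add.assoc)
        show "M' (p + 3 + ?v + k) = of_bool (gate_code g ! k)" if "k < ?k" for k
          using M'inp[of "3 + ?v + k"] en that by (simp add: nth_append add.assoc)
      qed
      have m0: "M' p = 0" using M'inp[of 0] en by simp
      have F1g: "F1 E e T n (First g)" using FG First by simp
      have pl': "p + 3 + ?v + ?k \<le> L" using pl lenG by simp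
      have "length ts < L" using len First L_ge by simp
      from gate_case_correct[OF I(5) this I(1,2,4) g F1g pl']
      have *: "H w (gate_case E d) R' M' (\<lambda>t R' M'. t \<le> tok_cost - 20 \<and> creg R' \<and>
        R' 8 = p + 3 + ?v + ?k \<and> R' 9 = Suc (length ts) \<and> layout (ts @ [TGate g]) M')" .
      have cost: "\<tau> = tok_cost + (tok_cost * length (concat (map toks Gs)) + 4)"
        using I(9) Fs First by (simp add: algebra_simps)
      have tc: "200 \<le> tok_cost" by (simp add: tok_cost_def)
      show ?thesis
      proof (rule H_IfLess)
        show "H w (gate_case E d) R' M' (\<lambda>t R' M'. \<exists>\<tau>'. I \<tau>' R' M' \<and>
            elen (Reg 8) + elen (Reg 0) + 2 + (elen (Cell (Reg 8)) + elen (Cst 1) + 1 + t) + \<tau>' \<le> \<tau>)"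
        proof (rule H_mono[OF *], elim conjE)
          fix t0 R2 M2 assume 2: "t0 \<le> tok_cost - 20" "creg R2" "R2 8 = p + 3 + ?v + ?k" "R2 9 = Suc (length ts)"
            "layout (ts @ [TGate g]) M2"
          have dr2: "drop (p + 3 + ?v + ?k) inp = concat (map encode Gs)"
            using dD(3) lenG by (simp add: add.assoc)
          have "I (tok_cost * length (concat (map toks Gs)) + 4) R2 M2"
            unfolding I_def
            by (rule exI[of _ "ts @ [TGate g]"], rule exI[of _ "Gs"], rule exI[of _ "p + 3 + ?v + ?k"])
              (use 2 pl' dr2 I(7,8) Fs First in auto)
          then show "\<exists>\<tau>'. I \<tau>' R2 M2 \<and>
            elen (Reg 8) + elen (Reg 0) + 2 + (elen (Cell (Reg 8)) + elen (Cst 1) + 1 + t0) + \<tau>' \<le> \<tau>"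
            using cost tc 2(1) by (intro exI[of _ "tok_cost * length (concat (map toks Gs)) + 4"]) simp
        qed
      qed (use m0 I small in auto)
    qed
  qed
  show ?thesis
    unfolding parse_def
    apply (rule H_Seq, rule H_Assign)
    subgoal using small by simp
    apply (rule H_Seq, rule H_Assign)
    subgoal using small by simp
    apply (rule H_mono[OF loop])
    subgoal by simp
    subgoal premises prems for t R' M'
    proof -
      from prems obtain \<tau>' where "I \<tau>' R' M'" and lt: "\<not> R' 8 < R' 0" and t: "t \<le> tok_cost * length (toks F) + 4" by auto
      then obtain ts Fs p where I: "creg R'" "R' 8 = p" "p \<le> L" "R' 9 = length ts" "layout ts M'"
        "drop p inp = concat (map encode Fs)" "ts @ concat (map toks Fs) = toks F" unfolding I_def by blast
      have "p = L" using lt I by (simp add: creg_def)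
      then have "Fs = []" using I(6) encode_nonempty by (cases Fs) (auto simp: L_def)
      then show ?thesis using I t by simp
    qed
    done
qed

end

section \<open>Searching for a satisfying assignment\<close>

definition setup_regs :: "nat \<Rightarrow> com" where
  "setup_regs e =
   1 ::= Cell (Cst 0) ;; 2 ::= Reg 1 \<oslash> Cst 2 ;; 3 ::= Cst 2 <<< Reg 1 ;; 4 ::= Reg 0 \<otimes> Reg 3 ;;
   6 ::= Cst e \<otimes> Reg 1 ;; 5 ::= Cst 1 <<< Reg 6 ;;
   7 ::= (Cst 1 <<< (Reg 1 \<ominus> Reg 2)) \<oslash> Reg 1 \<oplus> Cst 1"

text \<open>A connective overwrites the second cell of the stack and drops the first, so its result
  is in place. Register 25 runs through the token positions from right to left.\<close>

definition stack_step :: com where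
  "stack_step =
   18 ::= Reg 18 \<oplus> Cst 1 ;;
   25 ::= Reg 9 \<ominus> Reg 18 ;;
   IfLess (Cell (Reg 4 \<oplus> Reg 25)) (Cst 1)
    (24 ::= Reg 24 \<ominus> Cst 1 ;;
     Put (Reg 24) (Cell (Cst 2 \<otimes> Reg 4 \<oplus> Reg 25 \<otimes> Reg 3 \<oplus> Reg 22) |||
                   Cell (Cst 3 \<otimes> Reg 4 \<oplus> Reg 25 \<otimes> Reg 3 \<oplus> Reg 23)))
    (IfLess (Cell (Reg 4 \<oplus> Reg 25)) (Cst 2)
      (Put (Reg 24 \<oplus> Cst 1) (Cell (Reg 24) &&& Cell (Reg 24 \<oplus> Cst 1)) ;; 24 ::= Reg 24 \<oplus> Cst 1)
      (Put (Reg 24 \<oplus> Cst 1) (Cell (Reg 24) ||| Cell (Reg 24 \<oplus> Cst 1)) ;; 24 ::= Reg 24 \<oplus> Cst 1))"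

definition eval_batch :: com where
  "eval_batch = 24 ::= Cst 5 \<otimes> Reg 4 ;; 18 ::= Cst 0 ;; WhileLess (Reg 18) (Reg 9) stack_step"

text \<open>The outcomes of all batches are merged in register 26 by a bitwise or, so one test for a
  nonzero word at the end replaces the inspection of single bits.\<close>

definition search :: com where
  "search =
   26 ::= Cst 0 ;;
   22 ::= Cst 0 ;;
   WhileLess (Reg 22) (Cst 1 <<< Reg 2)
    (23 ::= Cst 0 ;;
     WhileLess (Reg 23) (Reg 7)
      (eval_batch ;; 26 ::= Reg 26 ||| Cell (Reg 24) ;; 23 ::= Reg 23 \<oplus> Cst 1) ;;
     22 ::= Reg 22 \<oplus> Cst 1) ;;
   0 ::= Cst 0 ;;
   IfLess (Cst 0) (Reg 26) (0 ::= Cst 1) Skip"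

definition solver :: "program \<Rightarrow> nat \<Rightarrow> nat \<Rightarrow> com" where
  "solver E e d = setup_regs e ;; parse E d ;; search"

section \<open>Bit-parallel evaluation of the higher layers\<close>

context sat_instance
begin

text \<open>The assignment numbered \<open>r\<close> in block \<open>j\<close>, combined with \<open>a\<close> for the first half.\<close>

definition Z :: "nat \<Rightarrow> nat \<Rightarrow> nat \<Rightarrow> nat" where
  "Z a j r = a + (j * n + r) * 2 ^ h"

text \<open>Cell \<open>m\<close> packs position \<open>m\<close> of the \<open>n\<close> stacks of
  the individual assignments, bit \<open>r\<close> coming from assignment \<open>r\<close>. The bits
  from \<open>n\<close> on must be zero, as otherwise the final test for a nonzero word could report
  a spurious solution.\<close>

definition stack :: "tok list \<Rightarrow> nat \<Rightarrow> nat \<Rightarrow> nat \<Rightarrow> (nat \<Rightarrow> nat) \<Rightarrow> bool" where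
  "stack ts a j sp M \<longleftrightarrow> sp + height ts = 5 * K \<and>
     (\<forall>m<height ts. \<forall>r. bit (M (sp + m)) r \<longleftrightarrow> r < n \<and> run_toks (Z a j r) ts ! m)"

lemma stack_TGate:
  assumes "stack ts a j sp M" "0 < sp" "\<And>r. bit v r \<longleftrightarrow> r < n \<and> gval g (Z a j r)"
  shows "stack (TGate g # ts) a j (sp - 1) (M(sp - 1 := v))"
  unfolding stack_def
proof (intro conjI allI impI)
  show "sp - 1 + height (TGate g # ts) = 5 * K" using assms by (simp add: stack_def)
  fix m r assume m: "m < height (TGate g # ts)"
  show "bit ((M(sp - 1 := v)) (sp - 1 + m)) r \<longleftrightarrow> r < n \<and> run_toks (Z a j r) (TGate g # ts) ! m"
  proof (cases m)
    case (Suc m')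
    then have "sp - 1 + m = sp + m'" "sp + m' \<noteq> sp - 1" using assms(2) by linarith+
    then show ?thesis using assms(1,2) m Suc by (simp add: stack_def)
  qed (use assms in simp)
qed

lemma run_toks_Cons2:
  assumes "wf_toks ts" "2 \<le> height ts"
  obtains x y st where "run_toks z ts = x # y # st"
proof -
  have "2 \<le> length (run_toks z ts)" using length_run_toks[OF assms(1)] assms(2) by simp
  then show thesis using that by (cases "run_toks z ts"; cases "tl (run_toks z ts)") auto
qed

lemma stack_op:
  assumes "stack ts a j sp M" "wf_toks ts" "2 \<le> height ts" "t = TAnd \<or> t = TOr"
    and v: "v = (if t = TAnd then and (M sp) (M (sp + 1)) else or (M sp) (M (sp + 1)))"
  shows "stack (t # ts) a j (sp + 1) (M(sp + 1 := v))"
  unfolding stack_def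
proof (intro conjI allI impI)
  have ht: "height (t # ts) = height ts - 1" using assms(4) by auto
  show "sp + 1 + height (t # ts) = 5 * K" using assms ht by (simp add: stack_def)
  fix m r assume m: "m < height (t # ts)"
  obtain x y st where xy: "run_toks (Z a j r) ts = x # y # st" using run_toks_Cons2[OF assms(2,3)] .
  have b: "bit (M (sp + m)) r \<longleftrightarrow> r < n \<and> (x # y # st) ! m" if "m < height ts" for m
    using assms(1) that xy by (auto simp: stack_def)
  have run: "run_toks (Z a j r) (t # ts) = (if t = TAnd then x \<and> y else x \<or> y) # st"
    using assms(4) xy by auto
  show "bit ((M(sp + 1 := v)) (sp + 1 + m)) r \<longleftrightarrow> r < n \<and> run_toks (Z a j r) (t # ts) ! m"
  proof (cases m)
    case 0
    then show ?thesis using b[of 0] b[of 1] assms(3) v run by (auto simp: bit_and_iff bit_or_iff)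
  next
    case (Suc m')
    then show ?thesis using b[of "Suc m"] m ht run by simp
  qed
qed

lemma eval_batch_correct:
  fixes a j :: nat
  defines "ts \<equiv> toks F"
  assumes R: "creg R" "R 9 = length ts" "R 22 = a" "R 23 = j" and a: "a < 2 ^ h" "j < J"
    and lay: "\<And>q. q < length ts \<Longrightarrow> M (K + q) = tok_code (ts ! q) \<and> table_ok M q (ts ! q)"
  shows "H w eval_batch R M (\<lambda>t R' M'. t \<le> 60 * length ts + 20 \<and>
     (\<forall>r. r \<notin> {18, 24, 25} \<longrightarrow> R' r = R r) \<and> (\<forall>x<4 * K. M' x = M x) \<and> R' 24 < 5 * K \<and>
     (\<forall>r. bit (M' (R' 24)) r \<longleftrightarrow> r < n \<and> eval (assignment n (Z a j r)) F))"
proof -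
  let ?N = "length ts"
  \<comment> \<open>After \<open>k\<close> rounds the last \<open>k\<close> tokens have been
    processed.\<close>
  define I where "I k R' M' \<longleftrightarrow> (\<forall>r. r \<notin> {18, 24, 25} \<longrightarrow> R' r = R r) \<and> (\<forall>x<4 * K. M' x = M x) \<and>
    stack (drop (?N - k) ts) a j (R' 24) M'" for k :: nat and R' M' :: "nat \<Rightarrow> nat"
  have NL: "?N < L" using L_ge by (simp add: ts_def)
  have aS: "a < S" "j < S" using a Jn_le by auto
  have wf: "wf_toks ts" "height ts = 1" using wf_toks_toks[OF F1, of "[]"] by (auto simp: ts_def)
  have small: "5 * K < 2 ^ w" "5 < (2::nat) ^ w" "?N + 1 < 2 ^ w"
    using big' K_ge NL by linarith+
  have body: "H w stack_step R1 M1 (\<lambda>t R' M'. t \<le> 56 \<and> R' 18 = Suc k \<and> I (Suc k) R' M')"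
    if I: "I k R1 M1" and k: "R1 18 = k" "k < ?N" for k R1 M1
  proof -
    define q where "q = ?N - Suc k"
    define us where "us = drop (Suc q) ts"
    have q: "q < ?N" "?N - k = Suc q" using k by (auto simp: q_def)
    have dr: "drop q ts = ts ! q # us" using q by (simp add: us_def Cons_nth_drop_Suc)
    have "wf_toks (ts ! q # us)" using wf_toks_drop[OF wf(1), of q] dr by simp
    have st: "stack us a j (R1 24) M1" using I q by (simp add: I_def us_def)
    define sp where "sp = R1 24"
    have hus: "height us < ?N" using height_le_length[of us] q by (simp add: us_def)
    have sp: "sp + height us = 5 * K" using st by (simp add: stack_def sp_def)
    \<comment> \<open>The stack holds fewer than \<open>L \<le> K\<close> values, so growing down
      from \<open>5 * K\<close> it never reaches the tables below \<open>4 * K\<close>.\<close>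
    have sp2: "4 * K < sp" "sp \<le> 5 * K" using sp hus NL K_ge by linarith+
    have r: "R1 3 = S" "R1 4 = K" "R1 9 = ?N" "R1 22 = a" "R1 23 = j" "R1 24 = sp"
      using I R by (auto simp: I_def creg_def sp_def)
    have M1: "M1 x = M x" if "x < 4 * K" for x using I that by (simp add: I_def)
    have qK: "K + q < 2 * K" using q NL K_ge by linarith
    have tk: "M1 (K + q) = tok_code (ts ! q)" using lay[OF q(1)] M1 qK by simp
    have ix: "q * S + a < K" "q * S + j < K" using idx_less[of q] q NL aS by auto
    have bd: "K + q < 2 ^ w" "q * S < 2 ^ w" "2 * K + q * S < 2 ^ w" "3 * K + q * S < 2 ^ w"
      "2 * K + q * S + a < 2 ^ w" "3 * K + q * S + j < 2 ^ w" "2 * K < 2 ^ w" "3 * K < 2 ^ w" "k + 1 < 2 ^ w" "sp + 1 < 2 ^ w"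
      using qK ix big' K_ge sp2 k small by linarith+
    have q': "?N - (k + 1) = q" by (simp add: q_def)
    define R2 where "R2 = R1(18 := Suc k, 25 := q)"
    have I': "I (Suc k) R' M'" if "\<forall>r. r \<notin> {18, 24, 25} \<longrightarrow> R' r = R1 r" "stack (ts ! q # us) a j (R' 24) M'"
      "\<forall>x<4 * K. M' x = M1 x" for R' M'
      using that I dr by (auto simp: I_def q_def)
    let ?v = "or (M1 (2 * K + q * S + a)) (M1 (3 * K + q * S + j))"
    have gate: "stack (ts ! q # us) a j (sp - 1) (M1(sp - 1 := ?v))" if "M1 (K + q) < 1"
    proof -
      have "tok_code (ts ! q) = 0" using that tk by simp
      then obtain g where g: "ts ! q = TGate g" by (cases "ts ! q") auto
      have "table_ok M q (TGate g)" using lay[OF q(1)] g by simp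
      then have "bit ?v r \<longleftrightarrow> r < n \<and> gval g (Z a j r)" for r
        using a ix M1 unfolding table_ok_def Z_def by simp
      then show ?thesis using stack_TGate[OF st] sp2 g by (simp add: sp_def)
    qed
    have op: "stack (ts ! q # us) a j (sp + 1) (M1(sp + 1 := v))"
      if "\<not> M1 (K + q) < 1" "v = (if M1 (K + q) < 2 then and (M1 sp) (M1 (sp + 1)) else or (M1 sp) (M1 (sp + 1)))" for v
    proof -
      have t: "ts ! q = TAnd \<or> ts ! q = TOr" using that(1) tk by (cases "ts ! q") auto
      have "wf_toks us \<and> 2 \<le> height us" using t \<open>wf_toks (ts ! q # us)\<close> by auto
      then show ?thesis using stack_op[OF st, of "ts ! q" v] t that(2) tk by (auto simp: sp_def)
    qed
    have ne: "x \<noteq> sp - 1" "x \<noteq> sp + 1" if "x < 4 * K" for x using that sp2 by auto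
    show ?thesis
      unfolding stack_step_def
      apply (rule H_Seq, rule H_Assign)
      subgoal using bd k by simp
      apply (rule H_Seq, rule H_Assign)
      subgoal using r k by simp
      apply (rule H_IfLess)
      subgoal using r k bd q' by simp
      subgoal using small by simp
      subgoal
        apply (intro H_Seq H_Put H_Assign)
        subgoal using r small sp2 by simp
        subgoal by simp
        subgoal using r k bd q' small by simp
        subgoal using r k q' ne gate by (intro conjI I') auto
        done
      subgoal
        apply (rule H_IfLess)
        subgoal using r k bd q' by simp
        subgoal using small by simp
        subgoal
          apply (intro H_Seq H_Put H_Assign)
          subgoal using r bd small by simp
          subgoal using r bd small by simp
          subgoal using r bd small by simp
          subgoal using r k q' ne op by (intro conjI I') auto
          done
        subgoal
          apply (intro H_Seq H_Put H_Assign)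
          subgoal using r bd small by simp
          subgoal using r bd small by simp
          subgoal using r bd small by simp
          subgoal using r k q' ne op by (intro conjI I') auto
          done
        done
      done
  qed
  have "H w (WhileLess (Reg 18) (Reg 9) stack_step) (R(24 := 5 * K, 18 := 0)) M
    (\<lambda>t R' M'. t \<le> (?N - 0) * (56 + elen (Reg 9) + 3) + elen (Reg 9) + 3 \<and> R' 18 = ?N \<and> I ?N R' M')"
  proof (rule H_for[where I = I])
    show "I 0 (R(24 := 5 * K, 18 := 0)) M" by (auto simp: I_def stack_def)
    show "ok w (Reg 9) R' M' \<and> ev (Reg 9) R' M' = ?N" if "I x R' M'" for x R' M'
      using that R by (simp add: I_def)
  qed (use body in auto)
  then have *: "H w (WhileLess (Reg 18) (Reg 9) stack_step) (R(24 := 5 * K, 18 := 0)) M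
    (\<lambda>t R' M'. t \<le> 60 * ?N + 4 \<and> I ?N R' M')" by (rule H_mono) auto
  have r4: "R 4 = K" using R by (simp add: creg_def)
  show ?thesis
    unfolding eval_batch_def
    apply (rule H_Seq, rule H_Assign)
    subgoal using r4 small by simp
    apply (rule H_Seq, rule H_Assign)
    subgoal using small by simp
    apply (rule H_mono[where Q = "\<lambda>t R' M'. t \<le> 60 * ?N + 4 \<and> I ?N R' M'"])
    subgoal using * r4 by simp
    subgoal premises prems for t R' M'
    proof -
      have I: "I ?N R' M'" and t: "t \<le> 60 * ?N + 4" using prems by auto
      then have st: "stack ts a j (R' 24) M'" by (simp add: I_def)
      have "run_toks z ts ! 0 = eval (assignment n z) F" for z
        using run_toks_toks[OF F1 n, of z "[]"] by (simp add: ts_def)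
      then have "\<forall>r. bit (M' (R' 24)) r \<longleftrightarrow> r < n \<and> eval (assignment n (Z a j r)) F"
        using st wf(2) unfolding stack_def by (metis add.right_neutral less_one)
      then show ?thesis using I t st wf(2) by (auto simp: I_def stack_def)
    qed
    done
qed

text \<open>Read as a binary number, an assignment is divided by \<open>2 ^ h\<close>; the quotient
  is divided by \<open>n\<close> to obtain block and position. The additional block in
  \<open>J\<close> covers the remainder of that division.\<close>

lemma Z_surj:
  assumes "length x = n"
  shows "\<exists>a<2 ^ h. \<exists>j<J. \<exists>r<n. assignment n (Z a j r) = x"
proof -
  define z where "z = horner_sum of_bool (2::nat) x"
  have bz: "bit z v \<longleftrightarrow> v < n \<and> x ! v" for v
    using assms by (auto simp: z_def bit_horner_sum_bit_iff)
  have zx: "assignment n z = x"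
    using assms by (auto simp: assignment_def bz intro!: nth_equalityI)
  have "z < 2 ^ n" using horner_sum_of_bool_2_less[of x] assms by (simp add: z_def)
  define a where "a = z mod 2 ^ h"
  define b where "b = z div 2 ^ h"
  have "(2::nat) ^ n = 2 ^ (n - h) * 2 ^ h" by (simp add: power_add[symmetric] h_def)
  then have b: "b < 2 ^ (n - h)" using \<open>z < 2 ^ n\<close> by (simp add: b_def less_mult_imp_div_less)
  then have "b < J * n" using Jn_le(4) by linarith
  then have "b div n < J" by (simp add: less_mult_imp_div_less)
  moreover have "a < 2 ^ h" by (simp add: a_def)
  moreover have "b mod n < n" using n by simp
  moreover have "Z a (b div n) (b mod n) = z" by (simp add: Z_def a_def b_def mod_div_mult_eq)
  ultimately show ?thesis using zx by metis
qed

text \<open>From right to left every number is a legitimate witness, because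
  \<open>assignment\<close> reads only its lowest \<open>n\<close> bits; positions past the last
  real assignment merely repeat others.\<close>

lemma satisfiable_iff: "satisfiable n F \<longleftrightarrow> (\<exists>a<2 ^ h. \<exists>j<J. \<exists>r<n. eval (assignment n (Z a j r)) F)"
proof
  assume "satisfiable n F"
  then show "\<exists>a<2 ^ h. \<exists>j<J. \<exists>r<n. eval (assignment n (Z a j r)) F"
    unfolding satisfiable_def using Z_surj by metis
next
  assume "\<exists>a<2 ^ h. \<exists>j<J. \<exists>r<n. eval (assignment n (Z a j r)) F"
  then show "satisfiable n F" unfolding satisfiable_def assignment_def
    by (metis diff_zero length_map length_upt)
qed

lemma search_correct:
  assumes R: "creg R" "R 9 = length (toks F)" and lay: "layout (toks F) M"
  shows "H w search R M (\<lambda>t R' M'. t \<le> 2 ^ h * (J * (60 * length (toks F) + 40) + 30) + 40 \<and>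
    R' 0 = of_bool (satisfiable n F))"
proof -
  let ?N = "length (toks F)"
  define ev' where "ev' a j r \<longleftrightarrow> eval (assignment n (Z a j r)) F" for a j r
  define P where "P A R' M' \<longleftrightarrow> creg R' \<and> R' 9 = ?N \<and> (\<forall>x<4 * K. M' x = M x) \<and>
    (\<forall>r. bit (R' 26) r \<longleftrightarrow> r < n \<and> (\<exists>(a, j)\<in>A. ev' a j r))" for A and R' M' :: "nat \<Rightarrow> nat"
  \<comment> \<open>The pairs searched so far: all blocks for the values before \<open>a\<close>,
    and the first \<open>j\<close> blocks for \<open>a\<close>. At \<open>j = J\<close> this set
    coincides with the start of the next row, which connects the two loops.\<close>
  let ?A = "\<lambda>a j. {0..<a} \<times> {0..<J} \<union> {a} \<times> {0..<j}"
  have small: "5 * K < 2 ^ w" "5 < (2::nat) ^ w" "2 ^ h < (2::nat) ^ w" "J < 2 ^ w" "S < 2 ^ w"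
  proof -
    have "S \<le> K" using L_ge by (simp add: K_def)
    then show "5 * K < 2 ^ w" "5 < (2::nat) ^ w" "2 ^ h < (2::nat) ^ w" "J < 2 ^ w" "S < 2 ^ w"
      using big'(4) K_ge Jn_le(3,5) by linarith+
  qed
  have lay': "M' (K + q) = tok_code (toks F ! q) \<and> table_ok M' q (toks F ! q)"
    if q: "q < ?N" and same: "\<forall>x<4 * K. M' x = M x" for q M'
  proof -
    have o: "M (K + q) = tok_code (toks F ! q)" "table_ok M q (toks F ! q)" using lay q by (auto simp: layout_def)
    have "q < L" using q L_ge by simp
    then have "q * S + a < K" if "a < S" for a using idx_less that by simp
    then have "2 * K + q * S + a < 4 * K" "3 * K + q * S + a < 4 * K" if "a < S" for a using that by fastforce+
    moreover have "a < S" if "a < 2 ^ h" for a using that Jn_le(5) by simp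
    moreover have "j < S" if "j < J" for j using that Jn_le(3) by simp
    ultimately have "table_ok M' q (toks F ! q)" using o(2) same unfolding table_ok_def by simp
    moreover have "K + q < 4 * K" using \<open>q < L\<close> K_ge by linarith
    ultimately show ?thesis using o same by simp
  qed
  let ?body1 = "eval_batch ;; 26 ::= Reg 26 ||| Cell (Reg 24) ;; 23 ::= Reg 23 \<oplus> Cst 1"
  have body1: "H w ?body1 R1 M1 (\<lambda>t R' M'. t \<le> 60 * ?N + 30 \<and> R' 23 = Suc j \<and> (P (?A a (Suc j)) R' M' \<and> R' 22 = a))"
    if I: "P (?A a j) R1 M1 \<and> R1 22 = a" and j: "R1 23 = j" "j < J" and a: "a < 2 ^ h" for a j R1 M1
  proof -
    have p: "creg R1" "R1 9 = ?N" "\<forall>x<4 * K. M1 x = M x" "R1 22 = a"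
       and b: "\<And>r. bit (R1 26) r \<longleftrightarrow> r < n \<and> (\<exists>(a, j)\<in>?A a j. ev' a j r)"
      using I by (auto simp: P_def)
    have jw: "j + 1 < 2 ^ w" using j small by linarith
    show ?thesis
    proof (rule H_Seq, rule H_mono[OF eval_batch_correct[OF p(1,2,4) j(1) a j(2)]])
      show "M1 (K + q) = tok_code (toks F ! q) \<and> table_ok M1 q (toks F ! q)" if "q < ?N" for q
        using lay'[OF that p(3)] .
      fix t R2 M2
      assume 2: "t \<le> 60 * ?N + 20 \<and> (\<forall>r. r \<notin> {18, 24, 25} \<longrightarrow> R2 r = R1 r) \<and> (\<forall>x<4 * K. M2 x = M1 x) \<and> R2 24 < 5 * K \<and>
        (\<forall>r. bit (M2 (R2 24)) r \<longleftrightarrow> r < n \<and> eval (assignment n (Z a j r)) F)"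
      have A: "?A a (Suc j) = insert (a, j) (?A a j)" by (auto simp: less_Suc_eq)
      have "bit (or (R1 26) (M2 (R2 24))) r \<longleftrightarrow> r < n \<and> (\<exists>(a, j)\<in>?A a (Suc j). ev' a j r)" for r
        unfolding A using b[of r] 2 by (auto simp: bit_or_iff ev'_def)
      moreover have "R2 26 = R1 26" "R2 23 = j" "R2 22 = a" "creg R2" "R2 9 = ?N"
        using 2 p j by (auto simp: creg_def)
      ultimately show "H w (26 ::= Reg 26 ||| Cell (Reg 24) ;; 23 ::= Reg 23 \<oplus> Cst 1) R2 M2
         (\<lambda>t2 R' M'. t + t2 \<le> 60 * ?N + 30 \<and> R' 23 = Suc j \<and> (P (?A a (Suc j)) R' M' \<and> R' 22 = a))"
        using 2 p(3) jw by (intro H_Seq H_Assign) (auto simp: P_def creg_def)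
    qed
  qed
  let ?loop1 = "WhileLess (Reg 23) (Reg 7) ?body1"
  let ?body2 = "23 ::= Cst 0 ;; ?loop1 ;; 22 ::= Reg 22 \<oplus> Cst 1"
  have body2: "H w ?body2 R1 M1 (\<lambda>t R' M'. t \<le> J * (60 * ?N + 40) + 20 \<and> R' 22 = Suc a \<and> P (?A (Suc a) 0) R' M')"
    if I: "P (?A a 0) R1 M1" and a: "R1 22 = a" "a < 2 ^ h" for a R1 M1
  proof (rule H_Seq, rule H_Assign)
    have *: "H w ?loop1 (R1(23 := 0)) M1 (\<lambda>t R' M'. t \<le> (J - 0) * (60 * ?N + 30 + elen (Reg 7) + 3) + elen (Reg 7) + 3 \<and>
      R' 23 = J \<and> (P (?A a J) R' M' \<and> R' 22 = a))"
    proof (rule H_for[where I = "\<lambda>j R' M'. P (?A a j) R' M' \<and> R' 22 = a"])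
      show "P (?A a 0) (R1(23 := 0)) M1 \<and> (R1(23 := 0)) 22 = a" using I a by (auto simp: P_def creg_def)
      show "ok w (Reg 7) R' M' \<and> ev (Reg 7) R' M' = J" if "P (?A a x) R' M' \<and> R' 22 = a" for x R' M'
        using that by (simp add: P_def creg_def)
      show "H w ?body1 R' M' (\<lambda>t R' M'. t \<le> 60 * ?N + 30 \<and> R' 23 = Suc x \<and> (P (?A a (Suc x)) R' M' \<and> R' 22 = a))"
        if "P (?A a x) R' M' \<and> R' 22 = a" "R' 23 = x" "x < J" for x R' M'
        using body1[OF that a(2)] .
    qed auto
    have A: "?A (Suc a) 0 = ?A a J" by (auto simp: less_Suc_eq)
    have aw: "a + 1 < 2 ^ w" using a small by linarith
    have time: "J * (60 * ?N + 34) \<le> J * (60 * ?N + 40)" by (intro mult_le_mono2) simp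
    show "H w (?loop1 ;; 22 ::= Reg 22 \<oplus> Cst 1) (R1(23 := ev (Cst 0) R1 M1)) M1
      (\<lambda>t R' M'. elen (Cst 0) + 1 + t \<le> J * (60 * ?N + 40) + 20 \<and> R' 22 = Suc a \<and> P (?A (Suc a) 0) R' M')"
    proof (rule H_Seq, rule H_mono)
      show "H w ?loop1 (R1(23 := ev (Cst 0) R1 M1)) M1 (\<lambda>t R' M'. t \<le> J * (60 * ?N + 34) + 4 \<and> P (?A a J) R' M' \<and> R' 22 = a)"
        unfolding ev.simps by (rule H_mono[OF *]) (auto simp: algebra_simps)
      show "H w (22 ::= Reg 22 \<oplus> Cst 1) R2 M2
         (\<lambda>t2 R' M'. elen (Cst 0) + 1 + (t + t2) \<le> J * (60 * ?N + 40) + 20 \<and> R' 22 = Suc a \<and> P (?A (Suc a) 0) R' M')"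
        if "t \<le> J * (60 * ?N + 34) + 4 \<and> P (?A a J) R2 M2 \<and> R2 22 = a" for t R2 M2
      proof -
        have "t \<le> J * (60 * ?N + 40) + 4" using that time by linarith
        then show ?thesis unfolding A using that aw by (intro H_Assign) (auto simp: P_def creg_def)
      qed
    qed
  qed (use small in simp)
  let ?R0 = "R(26 := 0, 22 := 0)"
  have loop2: "H w (WhileLess (Reg 22) (Cst 1 <<< Reg 2) ?body2) ?R0 M
    (\<lambda>t R' M'. t \<le> (2 ^ h - 0) * (J * (60 * ?N + 40) + 20 + elen (Cst 1 <<< Reg 2) + 3) + elen (Cst 1 <<< Reg 2) + 3 \<and>
      R' 22 = 2 ^ h \<and> P (?A (2 ^ h) 0) R' M')"
  proof (rule H_for[where I = "\<lambda>a. P (?A a 0)"])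
    show "P (?A 0 0) ?R0 M" using R by (auto simp: P_def creg_def)
    show "ok w (Cst 1 <<< Reg 2) R' M' \<and> ev (Cst 1 <<< Reg 2) R' M' = 2 ^ h" if "P (?A x 0) R' M'" for x R' M'
      using that small by (auto simp: P_def creg_def)
    show "H w ?body2 R' M' (\<lambda>t R' M'. t \<le> J * (60 * ?N + 40) + 20 \<and> R' 22 = Suc x \<and> P (?A (Suc x) 0) R' M')"
      if "P (?A x 0) R' M'" "R' 22 = x" "x < 2 ^ h" for x R' M'
      using body2[OF that] .
  qed auto
  have res: "0 < R' 26 \<longleftrightarrow> satisfiable n F" if "P (?A (2 ^ h) 0) R' M'" for R' M'
  proof -
    have b: "bit (R' 26) r \<longleftrightarrow> r < n \<and> (\<exists>a<2 ^ h. \<exists>j<J. ev' a j r)" for r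
      using that by (auto simp: P_def)
    have "R' 26 = 0 \<longleftrightarrow> (\<forall>r. \<not> bit (R' 26) r)" by (simp add: bit_eq_iff)
    then show ?thesis using b by (auto simp: satisfiable_iff ev'_def)
  qed
  show ?thesis
    unfolding search_def
    apply (rule H_Seq, rule H_Assign)
    subgoal using small by simp
    apply (rule H_Seq, rule H_Assign)
    subgoal using small by simp
    apply (rule H_Seq)
    apply (rule H_mono[where Q = "\<lambda>t R' M'. t \<le> 2 ^ h * (J * (60 * ?N + 40) + 30) + 6 \<and> P (?A (2 ^ h) 0) R' M'"])
    subgoal unfolding ev.simps by (rule H_mono[OF loop2]) (auto simp: algebra_simps)
    subgoal for t R1 M1
      using small res[of R1 M1]
      by (intro H_Seq H_Assign H_IfLess H_Skip) auto
    done
qed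

lemma setup_regs_correct:
  "H w (setup_regs e) ((\<lambda>_. 0)(0 := L)) (\<lambda>a. if a < L then inp ! a else 0)
    (\<lambda>t R' M'. t \<le> 40 \<and> creg R' \<and> M' = (\<lambda>a. if a < L then inp ! a else 0))"
proof -
  have i0: "inp ! 0 = n" by (simp add: sat_input_def)
  have en: "e * n < B" by (simp add: B_def)
  have e: "e \<le> e * n" using n by simp
  have BB: "B \<le> B * B" using B_pos by simp
  have hn: "(2::nat) ^ (n - h) \<le> 2 ^ n" by (intro power_increasing) auto
  have J: "J \<le> S" using Jn_le by simp
  have SK: "S \<le> K" using L_ge by (simp add: K_def)
  have small: "2 < (2::nat) ^ w" "S < 2 ^ w" "K < 2 ^ w" "e < 2 ^ w" "e * n < 2 ^ w" "2 ^ (n - h) < (2::nat) ^ w" "J < 2 ^ w"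
    using big' K_ge SK en e BB hn J Jn_le(6) by linarith+
  have "B < 2 ^ w"
  proof -
    have "8 * B \<le> 8 * K * B" using K_ge by simp
    then show ?thesis using big'(1) B_pos by linarith
  qed
  have S: "S = 2 * 2 ^ n" by (simp add: S_def)
  note defs = S_def h_def J_def K_def B_def
  show ?thesis
    unfolding setup_regs_def
    apply (intro H_Seq H_Assign)
    using small L_ge i0 \<open>B < 2 ^ w\<close>
           apply (auto simp: creg_def defs mult.commute)
    done
qed

lemma solver_correct:
  "H w (solver E e d) ((\<lambda>_. 0)(0 := L)) (\<lambda>a. if a < L then inp ! a else 0)
    (\<lambda>t R' M'. t \<le> tok_cost * length (toks F) + 2 ^ h * (J * (60 * length (toks F) + 40) + 30) + 90 \<and>
      R' 0 = of_bool (satisfiable n F))"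
proof -
  have lay: "layout [] (\<lambda>a. if a < L then inp ! a else 0)" using K_ge by (auto simp: layout_def)
  show ?thesis
    unfolding solver_def
    apply (rule H_Seq)
    apply (rule H_mono[OF setup_regs_correct])
    apply (elim conjE, hypsubst)
    apply (rule H_Seq)
    apply (rule H_mono[OF parse_correct[OF _ lay]], assumption)
    apply (elim conjE)
    apply (rule H_mono[OF search_correct]; simp)
    done
qed

end

section \<open>The compiled solver on the machine\<close>

lemma cregs_sim: "(\<forall>r\<in>instr_regs ins. r < d) \<Longrightarrow> cregs (30 + d) (sim l ins)"
  by (cases ins) (auto simp: sim_op_def)

lemma cregs_dispatch: "(\<forall>ins\<in>set xs. \<forall>r\<in>instr_regs ins. r < d) \<Longrightarrow> cregs (30 + d) (dispatch l i xs)"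
  by (induction xs arbitrary: i) (auto simp: cregs_sim)

lemma cregs_clear_regs: "d' \<le> d \<Longrightarrow> cregs (30 + d) (clear_regs d')"
  by (induction d') auto

lemma cregs_solver:
  assumes "\<forall>ins\<in>set E. \<forall>r\<in>instr_regs ins. r < d" "0 < d"
  shows "cregs (30 + d) (solver E e d)"
  using assms cregs_dispatch[OF assms(1), of "length E" 0] cregs_clear_regs[of d d]
  by (simp add: solver_def setup_regs_def parse_def gate_case_def op_case_def fill_table_def eval_gate_def
      load_gate_def interp_def search_def eval_batch_def stack_step_def)

lemma (in sat_instance) computes_within_solver:
  assumes "\<forall>ins\<in>set E. \<forall>r\<in>instr_regs ins. r < d"
  shows "\<exists>k \<le> tok_cost * length (toks F) + 2 ^ h * (J * (60 * length (toks F) + 40) + 30) + 90.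
    computes_within (code (30 + d) (solver E e d) 0) w inp k (satisfiable n F)"
proof -
  let ?M = "\<lambda>a. if a < L then inp ! a else 0"
  let ?P = "code (30 + d) (solver E e d) 0"
  obtain k R' M' where k: "run w (solver E e d) ((\<lambda>_. 0)(0 := L)) ?M k R' M'"
     "k \<le> tok_cost * length (toks F) + 2 ^ h * (J * (60 * length (toks F) + 40) + 30) + 90"
     "R' 0 = of_bool (satisfiable n F)"
    using solver_correct by (auto simp: H_def)
  have small: "L < 2 ^ w" using K_ge big'(4) by linarith
  \<comment> \<open>The machine also requires every input cell to be a word. Variables are below
    \<open>n\<close>, while the lengths stored in the encoding are bounded by its own length; tags
    and code bits are small.\<close>
  have enc: "x \<le> L + n" if "F1 E e T n G" "x \<in> set (encode G)" "length (encode G) \<le> L" for G x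
    using that
  proof (induction G)
    case (First g)
    then have "set (gate_vars g) \<subseteq> {0..<n}" by auto
    with First show ?case by (auto dest: subsetD)
  next
    case (Conj Fs)
    have "length (encode G) \<le> length (concat (map encode Fs))" if "G \<in> set Fs" for G
      using that by (auto simp: length_concat intro!: member_le_sum_list)
    moreover have "length Fs \<le> length (concat (map encode Fs))"
    proof -
      have "1 \<le> length (encode G)" for G by (cases G) auto
      then have "1 * (\<Sum>G\<leftarrow>Fs. 1) \<le> (\<Sum>G\<leftarrow>Fs. length (encode G))" by (intro sum_list_scaled_le) auto
      then show ?thesis by (simp add: length_concat comp_def sum_list_triv)
    qed
    ultimately show ?case using Conj L_ge by fastforce
  next
    case (Disj Fs)
    have "length (encode G) \<le> length (concat (map encode Fs))" if "G \<in> set Fs" for G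
      using that by (auto simp: length_concat intro!: member_le_sum_list)
    moreover have "length Fs \<le> length (concat (map encode Fs))"
    proof -
      have "1 \<le> length (encode G)" for G by (cases G) auto
      then have "1 * (\<Sum>G\<leftarrow>Fs. 1) \<le> (\<Sum>G\<leftarrow>Fs. length (encode G))" by (intro sum_list_scaled_le) auto
      then show ?thesis by (simp add: length_concat comp_def sum_list_triv)
    qed
    ultimately show ?case using Disj L_ge by fastforce
  qed
  have nS: "n < S" using less_exp[of n] Jn_le(6) by linarith
  have SK: "S \<le> K" using L_ge by (simp add: K_def)
  have Le: "length (encode F) \<le> L" by (simp add: L_def sat_input_def)
  have words: "x < 2 ^ w" if "x \<in> set inp" for x
  proof -
    have "x \<le> L + n" using that enc[OF F1 _ Le] by (auto simp: sat_input_def)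
    then show ?thesis using nS SK K_ge big'(4) by linarith
  qed
  have wf: "wf_mem w ((\<lambda>_. 0)(0 := L)) ?M"
    using small words by (auto simp: wf_mem_def L_def)
  have "\<exists>\<sigma>'. (step ?P w ^^ k) (init_state inp) = \<sigma>' \<and> pc \<sigma>' = 0 + clen (solver E e d) \<and> mem \<sigma>' = M' \<and>
    (\<forall>r<30 + d. regs \<sigma>' r = R' r)"
    by (rule code_correct[OF k(1) wf cregs_solver[OF assms d]])
      (auto simp: code_at_def init_state_def L_def)
  then have "computes_within ?P w inp k (satisfiable n F)"
    using small words k(3) by (auto simp: computes_within_def L_def Let_def)
  then show ?thesis using k(2) by blast
qed

section \<open>Running time\<close>

text \<open>The source is \<open>m div 4 + 1 \<le> 2 ^ (m div 4)\<close>. It later trades the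
  division by \<open>n\<close> for a quarter of the exponent.\<close>

lemma le_powr_quarter: "real m \<le> 4 * 2 powr (real m / 4)"
proof -
  have "m \<le> 4 * (m div 4 + 1)" by simp
  also have "\<dots> \<le> 4 * 2 ^ (m div 4)" unfolding Suc_eq_plus1[symmetric] by (intro mult_le_mono2 Suc_leI less_exp)
  finally have "real m \<le> real (4 * 2 ^ (m div 4))" by (simp only: of_nat_le_iff)
  also have "\<dots> = 4 * 2 ^ (m div 4)" by simp
  also have "(2::real) ^ (m div 4) = 2 powr real (m div 4)" by (simp add: powr_realpow)
  also have "\<dots> \<le> 2 powr (real m / 4)"
    using of_nat_div_le_of_nat[of m 4, where ?'a = real] by (intro powr_mono) auto
  finally show ?thesis by simp
qed

text \<open>The little-o bound holds from some \<open>m0\<close> on, and the finitely many earlier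
  values are absorbed into \<open>A\<close>. The quarter is chosen to fit tables with about
  \<open>2 ^ (n / 2)\<close> entries.\<close>

lemma subexponential_bound:
  assumes "subexponential T"
  shows "\<exists>A\<ge>1. \<forall>m. real (T m) \<le> A * 2 powr (real m / 4)"
proof -
  obtain g where g: "g \<in> o(\<lambda>m. real m)" "\<And>m. real (T m) \<le> 2 powr g m"
    using assms by (auto simp: subexponential_def)
  from landau_o.smallD[OF g(1), of "1 / 4"] obtain m0 where m0: "\<And>m. m0 \<le> m \<Longrightarrow> \<bar>g m\<bar> \<le> real m / 4"
    by (auto simp: eventually_at_top_linorder)
  define A where "A = 1 + (\<Sum>m<m0. real (T m))"
  have A: "1 \<le> A" by (simp add: A_def sum_nonneg)
  have "real (T m) \<le> A * 2 powr (real m / 4)" for m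
  proof (cases "m < m0")
    case True
    then have "real (T m) \<le> (\<Sum>m<m0. real (T m))" by (intro member_le_sum) auto
    then have "real (T m) \<le> A * 1" by (simp add: A_def)
    also have "\<dots> \<le> A * 2 powr (real m / 4)" using A by (intro mult_left_mono ge_one_powr_ge_zero) auto
    finally show ?thesis .
  next
    case False
    then have "g m \<le> real m / 4" using m0[of m] by simp
    then have "real (T m) \<le> 1 * 2 powr (real m / 4)"
      using g(2)[of m] by (smt (verit) powr_mono)
    also have "\<dots> \<le> A * 2 powr (real m / 4)" using A by (intro mult_right_mono) auto
    finally show ?thesis .
  qed
  with A show ?thesis by blast
qed

text \<open>The input has length at most \<open>(T n + 5) * s\<close>; for it to fit, the first
  factor must be a power of two with exponent linear in \<open>n\<close>, since this is what the
  word size provides.\<close>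

lemma add_5_le_pow2:
  assumes "1 \<le> A" "\<And>m. real (T m) \<le> A * 2 powr (real m / 4)"
  shows "\<exists>c. \<forall>m>0. T m + 5 \<le> 2 ^ (c * m)"
proof -
  obtain c where c: "A + 5 < 2 ^ c" using real_arch_pow[of 2 "A + 5"] by auto
  have "T m + 5 \<le> 2 ^ ((c + 1) * m)" if "0 < m" for m
  proof -
    have one: "1 \<le> 2 powr (real m / 4)" by (rule ge_one_powr_ge_zero) auto
    have "real (T m + 5) \<le> A * 2 powr (real m / 4) + 5 * 2 powr (real m / 4)" using assms(2)[of m] one by simp
    also have "\<dots> = (A + 5) * 2 powr (real m / 4)" by (simp add: algebra_simps)
    also have "\<dots> \<le> 2 ^ c * 2 powr real m" using c assms(1) by (intro mult_mono powr_mono) auto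
    also have "\<dots> = 2 ^ (c + m)" by (simp add: powr_realpow power_add)
    also have "\<dots> \<le> 2 ^ ((c + 1) * m)" using that by (intro power_increasing) auto
    finally show ?thesis by (metis of_nat_le_iff of_nat_numeral of_nat_power)
  qed
  then show ?thesis by blast
qed

lemma instrs_within_exists:
  "\<exists>d>0. \<exists>m. \<forall>ins\<in>set E. (\<forall>r\<in>instr_regs ins. r < d) \<and> instr_const ins < m"
proof (induction E)
  case (Cons ins E)
  then obtain d m where dm: "0 < d" "\<forall>ins\<in>set E. (\<forall>r\<in>instr_regs ins. r < d) \<and> instr_const ins < m" by blast
  have "finite (instr_regs ins)" by (cases ins) auto
  then obtain d' where "\<forall>r\<in>instr_regs ins. r < d'" using finite_nat_set_iff_bounded by blast
  with dm have "\<forall>i\<in>set (ins # E). (\<forall>r\<in>instr_regs i. r < max d d') \<and>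
      instr_const i < max m (Suc (instr_const ins))"
    by (auto simp: less_max_iff_disj)
  moreover have "0 < max d d'" using dm(1) by simp
  ultimately show ?case by blast
qed auto

context sat_instance
begin

text \<open>Costs are measured in \<open>q = 2 powr (n / 4)\<close> and
  \<open>X = 2 ^ n / n\<close>. A gate has O(\<open>q * q\<close>) table entries of cost
  O(\<open>q\<close>) each, and \<open>q * q * q = 2 ^ n / q\<close> is at most \<open>8 * X\<close>
  because \<open>n \<le> 8 * q\<close>. The search visits
  \<open>2 ^ h * J \<le> X + 2 ^ h \<le> 9 * X\<close> batches. In \<open>G\<close>, 304 is the 200
  from \<open>gate_cost\<close> plus its additive 100 and the 4 of the loop test.\<close>

lemma time_bound:
  assumes A: "1 \<le> A" "\<And>m. real (T m) \<le> A * 2 powr (real m / 4)"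
  defines "G \<equiv> 4 * real (length E) + 2 * real d + 304"
  shows "real (tok_cost * length (toks F) + 2 ^ h * (J * (60 * length (toks F) + 40) + 30) + 90) \<le>
    (192 * A * G + 5600) * (2 ^ n * (real (formula_size F) / real n + 1))"
proof -
  let ?s = "real (formula_size F)"
  define q where "q = 2 powr (real n / 4)"
  define X where "X = 2 ^ n / real n"
  have n1: "1 \<le> real n" using n by simp
  have s1: "1 \<le> ?s" using formula_size_pos[OF F1] by simp
  have N: "real (length (toks F)) \<le> 2 * ?s" using length_toks[OF F1] by linarith
  have q1: "1 \<le> q" unfolding q_def by (rule ge_one_powr_ge_zero) auto
  have q4: "q * q * q * q = 2 ^ n"
    by (simp add: q_def powr_add[symmetric] powr_realpow)
  have nq: "real n \<le> 8 * q" using le_powr_quarter[of n] q1 by (simp add: q_def)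
  have q3X: "q * q * q \<le> 8 * X"
  proof -
    have "q * q * q * real n \<le> q * q * q * (8 * q)" using nq by (intro mult_left_mono) auto
    also have "\<dots> = 8 * 2 ^ n" using q4 by simp
    finally have "q * q * q * real n \<le> 8 * 2 ^ n" .
    then show ?thesis using n1 by (simp add: X_def field_simps)
  qed
  have q2: "q * q \<le> q * q * q" using q1 by simp
  have hX: "2 ^ h \<le> 8 * X"
  proof -
    have "(2::real) ^ h = 2 powr real h" by (simp add: powr_realpow)
    also have "\<dots> \<le> 2 powr (real n / 4 + real n / 4)" by (intro powr_mono) (auto simp: h_def)
    also have "\<dots> = q * q" unfolding q_def by (rule powr_add)
    finally show ?thesis using q2 q3X by linarith
  qed
  have oneX: "1 \<le> 8 * X" using hX one_le_power[of "2::real" h] by linarith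
  have nh: "2 ^ (n - h) \<le> 2 * (q * q)"
  proof -
    have "n - h \<le> h + 1" by (simp add: h_def)
    then have "real (n - h) \<le> 1 + (real n / 4 + real n / 4)" by (simp add: h_def)
    then have "(2::real) powr real (n - h) \<le> 2 powr (1 + (real n / 4 + real n / 4))" by (intro powr_mono) auto
    also have "\<dots> = 2 * (q * q)" unfolding q_def by (simp only: powr_add powr_one)
    finally show ?thesis by (simp add: powr_realpow)
  qed
  have n2: "real n \<le> 4 * (q * q)"
  proof -
    have "n \<le> 2 * (n - h)" by (simp add: h_def)
    also have "\<dots> \<le> 2 * 2 ^ (n - h)" using less_exp[of "n - h"] by simp
    finally have "real n \<le> real (2 * 2 ^ (n - h))" by (simp only: of_nat_le_iff)
    then show ?thesis using nh by simp
  qed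
  have G: "304 \<le> G" by (simp add: G_def)
  have T: "real (T n + 1) \<le> 2 * A * q"
  proof -
    have "1 * 1 \<le> A * q" using A(1) q1 by (intro mult_mono) auto
    then show ?thesis using A(2)[of n] by (simp add: q_def)
  qed
  have gc: "real (gate_cost + 4) \<le> real (T n + 1) * G"
  proof -
    have "104 * 1 \<le> 104 * real (T n + 1)" by (intro mult_left_mono) auto
    then show ?thesis by (simp add: gate_cost_def G_def algebra_simps)
  qed
  have tc: "real tok_cost \<le> (96 * A * G + 1600) * X"
  proof -
    have "real (2 ^ (n - h) + n) * real (gate_cost + 4) \<le> (6 * (q * q)) * (2 * A * q * G)"
    proof (intro mult_mono)
      \<comment> \<open>Two units of \<open>q * q\<close> come from \<open>2 ^ (n - h)\<close>,
        where rounding up is paid by a factor 2, and four from \<open>n\<close>.\<close>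
      show "real (2 ^ (n - h) + n) \<le> 6 * (q * q)" using nh n2 by simp
      have "real (T n + 1) * G \<le> 2 * A * q * G" using T G by (intro mult_right_mono) auto
      then show "real (gate_cost + 4) \<le> 2 * A * q * G" using gc by linarith
    qed auto
    also have "\<dots> = 12 * A * G * (q * q * q)" by (simp add: algebra_simps)
    also have "\<dots> \<le> 12 * A * G * (8 * X)" using q3X A G by (intro mult_left_mono) auto
    finally have "real ((2 ^ (n - h) + n) * (gate_cost + 4)) \<le> 96 * A * G * X" by simp
    then show ?thesis using oneX by (simp add: tok_cost_def algebra_simps)
  qed
  have X0: "0 < X" using oneX by linarith
  have sX: "X \<le> ?s * X" using s1 X0 by simp
  have J: "2 ^ h * real J \<le> 9 * X"
  proof -
    have "real (2 ^ (n - h) div n) \<le> 2 ^ (n - h) / real n" using of_nat_div_le_of_nat[of "2 ^ (n - h)" n, where ?'a = real] by simp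
    then have "2 ^ h * real J \<le> 2 ^ h * (2 ^ (n - h) / real n + 1)" by (intro mult_left_mono) (auto simp: J_def)
    also have "\<dots> = 2 ^ (h + (n - h)) / real n + 2 ^ h" by (simp add: power_add algebra_simps)
    also have "h + (n - h) = n" by (simp add: h_def)
    finally show ?thesis using hX by (simp add: X_def)
  qed
  have "real tok_cost * real (length (toks F)) \<le> ((96 * A * G + 1600) * X) * (2 * ?s)"
    using tc N A G X0 by (intro mult_mono) auto
  moreover have "2 ^ h * real J * (60 * real (length (toks F)) + 40) \<le> (9 * X) * (160 * ?s)"
    using N s1 X0 by (intro mult_mono[OF J]) auto
  ultimately have "real (tok_cost * length (toks F) + 2 ^ h * (J * (60 * length (toks F) + 40) + 30) + 90) \<le>
      ((96 * A * G + 1600) * X) * (2 * ?s) + (9 * X) * (160 * ?s) + 30 * (8 * X) + 90 * (8 * X)"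
    using hX oneX by (simp add: algebra_simps)
  \<comment> \<open>The constant is \<open>5600 = 2 * 1600 + 9 * 160 + 30 * 8 + 90 * 8\<close>;
    terms without the factor \<open>?s\<close> are raised by \<open>1 \<le> ?s\<close>.\<close>
  also have "\<dots> \<le> (192 * A * G + 5600) * (?s * X)"
    using sX by (simp add: algebra_simps)
  also have "\<dots> \<le> (192 * A * G + 5600) * (2 ^ n * (?s / real n + 1))"
    using A G by (intro mult_left_mono) (auto simp: X_def algebra_simps)
  finally show ?thesis .
qed

end

theorem theoremB1:
  fixes E :: program and e :: nat and T :: "nat \<Rightarrow> nat"
  assumes "subexponential T"
  shows "\<exists>P c C. solves_F1_SAT E e T P c (\<lambda>n s. C * (2 ^ n * (real s / real n + 1)))"
proof -
  obtain A where A: "1 \<le> A" "\<And>m. real (T m) \<le> A * 2 powr (real m / 4)"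
    using subexponential_bound[OF assms] by auto
  obtain c0 where c0: "\<And>m. 0 < m \<Longrightarrow> T m + 5 \<le> 2 ^ (c0 * m)" using add_5_le_pow2[OF A] by auto
  obtain d m where d: "0 < d" and ins: "\<forall>ins\<in>set E. (\<forall>r\<in>instr_regs ins. r < d) \<and> instr_const ins < m"
    using instrs_within_exists[of E] by auto
  \<comment> \<open>\<open>c0\<close> pays for the input length, \<open>2 * e\<close> for products
    of two interpreter words, and 5 for the remaining powers, such as
    \<open>8 * 2 ^ (n + 1) \<le> 2 ^ (5 * n)\<close>. The last two summands make the program length
    and the constants of \<open>E\<close> fit into a word.\<close>
  define c where "c = c0 + 2 * e + 5 + length E + m"
  define C where "C = 192 * A * (4 * real (length E) + 2 * real d + 304) + 5600"
  have "\<exists>k. real k \<le> C * (2 ^ n * (real (formula_size F) / real n + 1)) \<and>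
      computes_within (code (30 + d) (solver E e d) 0) w (sat_input n F) k (satisfiable n F)"
    if n: "1 \<le> n" and F1: "F1 E e T n F" and w: "real c * log 2 (2 ^ n * real (formula_size F)) \<le> real w" for n F w
  proof -
    let ?s = "formula_size F"
    have s: "1 \<le> ?s" using formula_size_pos[OF F1] by simp
    have "(2 ^ n * ?s) ^ c \<le> 2 ^ w"
    proof -
      have pos: "0 < 2 ^ n * real ?s" using s by simp
      have "log 2 ((2 ^ n * real ?s) ^ c) \<le> real w" using w pos by (simp add: log_nat_power)
      then have "(2 ^ n * real ?s) ^ c \<le> 2 powr real w" using pos by (subst (asm) log_le_iff) auto
      then have "real ((2 ^ n * ?s) ^ c) \<le> real (2 ^ w)" by (simp add: powr_realpow)
      then show ?thesis by (simp only: of_nat_le_iff)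
    qed
    \<comment> \<open>A single factor \<open>?s\<close> of the power is kept, as the input length is
      linear in the size; the rest of the word size goes to powers of two.\<close>
    moreover have "?s ^ 1 \<le> ?s ^ c" using s by (intro power_increasing) (auto simp: c_def)
    then have "?s * 2 ^ (c * n) \<le> (2 ^ n * ?s) ^ c"
      by (simp add: power_mult_distrib power_mult[symmetric] mult.commute)
    ultimately have sw: "?s * 2 ^ (c * n) \<le> 2 ^ w" by linarith
    have pw: "(2::nat) ^ x \<le> 2 ^ w" if "x \<le> c * n" for x
    proof -
      have "(2::nat) ^ x \<le> 2 ^ (c * n)" using that by (intro power_increasing) auto
      also have "\<dots> \<le> ?s * 2 ^ (c * n)" using s by simp
      finally show ?thesis using sw by linarith
    qed
    have cn: "c * n = c0 * n + 2 * (e * n) + 5 * n + length E * n + m * n" by (simp add: c_def algebra_simps)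
    have lt: "x < 2 ^ w" if "x \<le> length E + m" for x
    proof -
      have "x \<le> (length E + m) * n" using that n by (metis le_trans mult.right_neutral mult_le_mono2)
      then have "x \<le> c * n" unfolding cn by (simp add: algebra_simps)
      then show ?thesis using less_le_trans[OF less_exp pw] by blast
    qed
    interpret sat_instance E e T n w d F
    proof
      show "length E < 2 ^ w" by (rule lt) simp
      show "\<forall>i\<in>set E. instr_within d (2 ^ w) i"
        using ins lt[of m] by (auto simp: instr_within_def intro: less_trans)
      show "(2::nat) ^ (e * n) * 2 ^ (e * n) \<le> 2 ^ w" "(2::nat) ^ (n + 1) * 2 ^ (n + 1) \<le> 2 ^ w"
        unfolding power_add[symmetric] by (rule pw, use n cn in simp)+
      have "length (sat_input n F) \<le> (T n + 5) * ?s" using length_encode_le[OF F1] by (simp add: sat_input_def)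
      also have "\<dots> \<le> 2 ^ (c0 * n) * ?s" using c0[of n] n by (intro mult_le_mono1) auto
      finally have "8 * (length (sat_input n F) * 2 ^ (n + 1)) * 2 ^ (e * n) \<le>
          2 ^ 3 * ((2 ^ (c0 * n) * ?s) * 2 ^ (n + 1)) * 2 ^ (e * n)"
        by (intro mult_le_mono) auto
      also have "\<dots> = ?s * 2 ^ (3 + c0 * n + (n + 1) + e * n)" by (simp add: power_add)
      also have "\<dots> \<le> ?s * 2 ^ (c * n)"
        using n cn by (intro mult_le_mono2 power_increasing) auto
      finally show "8 * (length (sat_input n F) * 2 ^ (n + 1)) * 2 ^ (e * n) \<le> 2 ^ w" using sw by linarith
    qed (use n F1 d in auto)
    obtain k where k: "k \<le> tok_cost * length (toks F) + 2 ^ h * (J * (60 * length (toks F) + 40) + 30) + 90"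
      "computes_within (code (30 + d) (solver E e d) 0) w (sat_input n F) k (satisfiable n F)"
      using computes_within_solver ins by blast
    have "real k \<le> real (tok_cost * length (toks F) + 2 ^ h * (J * (60 * length (toks F) + 40) + 30) + 90)"
      using k(1) by (simp only: of_nat_le_iff)
    also have "\<dots> \<le> C * (2 ^ n * (real ?s / real n + 1))"
      unfolding C_def by (rule time_bound[OF A])
    finally show ?thesis using k(2) by blast
  qed
  then show ?thesis unfolding solves_F1_SAT_def by blast
qed

end
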